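(* Let $1<p<\infty$ and let $g$ be an outer function in $H^p$ such that $|g|^p$ is a Muckenhoupt $(A_p)$ weight on $\mathbb{T}$. Let $I$ be an inner function with spectrum $\sigma(I)$. Then $$\{\overline{\lambda}:\lambda\in\sigma(I)\}= \sigma_{ap}\bigl(B|_{K^p_I(|g|^p)}\bigr).$$
   Context: $\mathbb{D}$ is the open unit disk, $\mathbb{T}$ the unit circle, $H^p$ the Hardy space of $\mathbb{D}$; $\operatorname{clos}$ denotes closure. For an outer function $g\in H^p$, $H^p(|g|^p)=\{f \text{ holomorphic in }\mathbb{D}: fg\in H^p\}$ with norm $\|f\|_{|g|^p}=\|fg\|_{H^p}$, and $H^p_0(|g|^p)=\{\psi\in H^p(|g|^p):\psi(0)=0\}$. For an inner function $I$, $K^p_I(|g|^p)$ is the set of $f\in H^p(|g|^p)$ for which there is $\psi\in H^p_0(|g|^p)$ with $f=I\overline{\psi}$ a.e. on $\mathbb{T}$ (boundary values). The spectrum of $I$ is $\sigma(I)=\{\lambda\in\operatorname{clos}\mathbb{D}:\liminf_{z\to\lambda,\,z\in\mathbb{D}}|I(z)|=0\}$. $B$ is the backward shift $Bf(z)=(f(z)-f(0))/z$; it leaves $K^p_I(|g|^p)$ invariant. For an operator $T$, the approximate point spectrum is $\sigma_{ap}(T)=\{\lambda\in\mathbb{C}:\exists (f_n)_n,\ \|f_n\|=1,\ (\lambda-T)f_n\to0\}$. A weight $w$ on $\mathbb{T}$ is a Muckenhoupt $(A_p)$ weight if $\sup_{J}\bigl(\frac1{|J|}\int_J w\,dx\bigr)\bigl(\frac1{|J|}\int_J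 w^{-1/(p-1)}dx\bigr)^{p-1}<\infty$, the supremum being over all subarcs $J$ of $\mathbb{T}$. *)

theory Defs
  imports "HOL-Complex_Analysis.Complex_Analysis"
begin

text \<open>
  Holomorphic functions on the disk are total functions of type
  \<^typ>\<open>complex \<Rightarrow> complex\<close>; no definition below depends on values off the open unit disk.
  Functions on the circle are evaluated at points \<^term>\<open>cis t\<close>, and null sets of the circle are
  null sets of parameters.
\<close>

definition integral_mean :: "real \<Rightarrow> (complex \<Rightarrow> complex) \<Rightarrow> real \<Rightarrow> real" where
  "integral_mean p f r =
     1 / (2 * pi) * integral {0..2 * pi} (\<lambda>t. norm (f (of_real r * cis t)) powr p)"

definition hardy_space :: "real \<Rightarrow> (complex \<Rightarrow> complex) set" where
  "hardy_space p =
     {f. f holomorphic_on ball 0 1 \<and> bdd_above (integral_mean p f ` {0..<1})}"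

text \<open>The supremum is a real one, hence only meaningful for elements of the Hardy space.\<close>

definition hardy_norm :: "real \<Rightarrow> (complex \<Rightarrow> complex) \<Rightarrow> real" where
  "hardy_norm p f = (SUP r\<in>{0..<1}. integral_mean p f r) powr (1 / p)"

definition has_radial_limit :: "(complex \<Rightarrow> complex) \<Rightarrow> complex \<Rightarrow> complex \<Rightarrow> bool" where
  "has_radial_limit f \<zeta> l \<longleftrightarrow> ((\<lambda>r. f (of_real r * \<zeta>)) \<longlongrightarrow> l) (at_left (1::real))"

text \<open>
  Unspecified where the radial limit does not exist; for a function in a Hardy space this is a
  null set.
\<close>

definition radial_limit :: "(complex \<Rightarrow> complex) \<Rightarrow> complex \<Rightarrow> complex" where
  "radial_limit f \<zeta> = Lim (at_left (1::real)) (\<lambda>r. f (of_real r * \<zeta>))"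

definition inner_function :: "(complex \<Rightarrow> complex) \<Rightarrow> bool" where
  "inner_function I \<longleftrightarrow>
     I holomorphic_on ball 0 1 \<and> bounded (I ` ball 0 1) \<and>
     (AE t in lebesgue_on {0..2 * pi}. \<exists>l. has_radial_limit I (cis t) l \<and> norm l = 1)"

definition outer_function :: "(complex \<Rightarrow> complex) \<Rightarrow> bool" where
  "outer_function g \<longleftrightarrow>
     (\<exists>c (\<phi> :: complex \<Rightarrow> real). norm c = 1 \<and> (\<forall>\<zeta>\<in>sphere 0 1. 0 < \<phi> \<zeta>) \<and>
        (\<lambda>t. ln (\<phi> (cis t))) absolutely_integrable_on {0..2 * pi} \<and>
        (\<forall>z\<in>ball 0 1. g z = c * exp (1 / (2 * pi) * integral {0..2 * pi}
            (\<lambda>t. (cis t + z) / (cis t - z) * of_real (ln (\<phi> (cis t)))))))"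

text \<open>
  An arc of the circle is the image of \<^term>\<open>{a..b}\<close> under \<^const>\<open>cis\<close> with
  \<^prop>\<open>a < b\<close> and \<^prop>\<open>b \<le> a + 2 * pi\<close>. The integrability conditions say that both averages
  are finite; almost everywhere positivity is needed because \<^prop>\<open>(0::real) powr (- s) = 0\<close>,
  whereas the negative power of a weight is infinite where the weight vanishes.
\<close>

definition muckenhoupt_weight :: "real \<Rightarrow> (complex \<Rightarrow> real) \<Rightarrow> bool" where
  "muckenhoupt_weight p w \<longleftrightarrow>
     (AE t in lebesgue_on {0..2 * pi}. 0 < w (cis t)) \<and>
     (\<lambda>t. w (cis t)) absolutely_integrable_on {0..2 * pi} \<and>
     (\<lambda>t. w (cis t) powr (- 1 / (p - 1))) absolutely_integrable_on {0..2 * pi} \<and>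
     bdd_above ((\<lambda>(a, b).
         (1 / (b - a) * integral {a..b} (\<lambda>t. w (cis t))) *
         (1 / (b - a) * integral {a..b} (\<lambda>t. w (cis t) powr (- 1 / (p - 1)))) powr (p - 1))
       ` {(a, b). a < b \<and> b \<le> a + 2 * pi})"

definition weighted_hardy_space :: "real \<Rightarrow> (complex \<Rightarrow> complex) \<Rightarrow> (complex \<Rightarrow> complex) set" where
  "weighted_hardy_space p g =
     {f. f holomorphic_on ball 0 1 \<and> (\<lambda>z. f z * g z) \<in> hardy_space p}"

definition weighted_hardy_norm ::
    "real \<Rightarrow> (complex \<Rightarrow> complex) \<Rightarrow> (complex \<Rightarrow> complex) \<Rightarrow> real" where
  "weighted_hardy_norm p g f = hardy_norm p (\<lambda>z. f z * g z)"

definition weighted_hardy_space0 :: "real \<Rightarrow> (complex \<Rightarrow> complex) \<Rightarrow> (complex \<Rightarrow> complex) set" where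
  "weighted_hardy_space0 p g = {\<psi> \<in> weighted_hardy_space p g. \<psi> 0 = 0}"

text \<open>The identity \<open>f = I * cnj \<psi>\<close> almost everywhere on the circle, between existing boundary values.\<close>

definition model_space ::
    "real \<Rightarrow> (complex \<Rightarrow> complex) \<Rightarrow> (complex \<Rightarrow> complex) \<Rightarrow> (complex \<Rightarrow> complex) set" where
  "model_space p g I =
     {f \<in> weighted_hardy_space p g. \<exists>\<psi> \<in> weighted_hardy_space0 p g.
        AE t in lebesgue_on {0..2 * pi}. \<exists>a b c.
          has_radial_limit f (cis t) a \<and> has_radial_limit I (cis t) b \<and>
          has_radial_limit \<psi> (cis t) c \<and> a = b * cnj c}"

definition inner_spectrum :: "(complex \<Rightarrow> complex) \<Rightarrow> complex set" where
  "inner_spectrum I =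
     {\<mu> \<in> closure (ball 0 1). Liminf (at \<mu> within ball 0 1) (\<lambda>z. ereal (norm (I z))) = 0}"

text \<open>The value at the origin is the removable singularity of the difference quotient.\<close>

definition backward_shift :: "(complex \<Rightarrow> complex) \<Rightarrow> complex \<Rightarrow> complex" where
  "backward_shift f z = (if z = 0 then deriv f 0 else (f z - f 0) / z)"

text \<open>
  The approximate point spectrum of the restriction of \<open>T\<close> to a \<open>T\<close>-invariant space \<open>X\<close> of
  functions on which \<open>N\<close> is the norm.
\<close>

definition approx_point_spectrum ::
    "(complex \<Rightarrow> complex) set \<Rightarrow> ((complex \<Rightarrow> complex) \<Rightarrow> real) \<Rightarrow>
     ((complex \<Rightarrow> complex) \<Rightarrow> (complex \<Rightarrow> complex)) \<Rightarrow> complex set" where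
  "approx_point_spectrum X N T =
     {\<mu>. \<exists>f :: nat \<Rightarrow> complex \<Rightarrow> complex. (\<forall>n. f n \<in> X \<and> N (f n) = 1) \<and>
           (\<lambda>n. N (\<lambda>z. \<mu> * f n z - T (f n) z)) \<longlonglongrightarrow> 0}"

end

theory Submission
  imports Defs
begin

text \<open>
  Write \<open>N\<close> for the norm of \<open>\<mu> f - B f\<close>, where \<open>f \<in> K\<close>. From \<open>(1 - \<mu> z) f = f 0 - z h\<close> with
  \<open>h = \<mu> f - B f\<close> one gets a bound \<open>|f| \<le> C (N + |h|)\<close> on the disk, hence a lower bound for \<open>\<mu> - B\<close>,
  as soon as \<open>f 0\<close> and \<open>f\<close> near \<open>a = 1 / \<mu>\<close> are controlled by \<open>N\<close>. For \<open>|\<mu>| < 1\<close> the boundary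
  conjugation \<open>h \<mapsto> I * cnj (z h)\<close> extends to the disk, and at \<open>cnj \<mu>\<close> its value is
  \<open>cnj (f 0) * I (cnj \<mu>)\<close>. For \<open>|\<mu>| \<ge> 1\<close> the numerator \<open>f 0 - z h\<close> vanishes at \<open>a\<close>, and \<open>h\<close> is
  Lipschitz near \<open>a\<close> with constant of order \<open>N\<close>: it is the integral of its boundary values against the
  reproducing kernel \<open>(1 - I z * cnj (I \<zeta>)) / (1 - z * cnj \<zeta>)\<close>, which is smooth in \<open>z\<close> near \<open>a\<close>
  uniformly in \<open>\<zeta>\<close> because \<open>I\<close> continues analytically across the circle off its spectrum.
  The Muckenhoupt condition gives \<open>|g|\<^sup>-\<^sup>q \<in> L\<^sup>1\<close>, so that functions of the weighted space are in
  \<open>H\<^sup>1\<close> and converge to their boundary values in \<open>L\<^sup>1\<close>. Conversely, if \<open>w\<close> tends to a point of the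
  spectrum and \<open>I w\<close> to \<open>0\<close>, the normalised kernels at \<open>w\<close> are approximate eigenvectors, since
  \<open>B k - cnj w * k = - cnj (I w) * B I\<close>.
\<close>

section \<open>The Poisson kernel\<close>

text \<open>Pointwise bounds in the disk are enough for a norm estimate: as \<open>g\<close> is in
  the Hardy space, the constant 1 lies in the weighted space, and dividing
  \<open>|f| \<le> C * (N + |h|)\<close> by \<open>N\<close> dominates \<open>f\<close> by
  \<open>C * N\<close> times two functions of bounded norm. The price is that every constant has to
  be linear in \<open>N\<close> and independent of \<open>f\<close>; hence the estimate of boundary
  values in \<open>L1\<close> by a fixed multiple of \<open>N\<close>. Members of \<open>K\<close>
  come with radial limits by definition, and these survive the backward shift and the conjugation.
  The function whose radial limits have to be constructed is \<open>g\<close>: the Muckenhoupt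
  condition speaks of \<open>radial_limit g\<close>, outerness of a density \<open>\<phi>\<close>,
  and identifying \<open>|g|\<close> with \<open>\<phi>\<close> almost everywhere takes Fatou's
  theorem for Poisson integrals and for bounded functions. The other obstacle is that an inner
  function has unimodular limits only almost everywhere, so the reflection principle is run on
  primitives, which are continuous up to the circle.\<close>

abbreviation circ :: "real measure" where
  "circ \<equiv> lebesgue_on {0..2 * pi}"

lemma compact_continuous_bound:
  fixes f :: "'a::metric_space \<Rightarrow> 'b::real_normed_vector"
  assumes "compact S" "continuous_on S f"
  obtains C where "\<And>x. x \<in> S \<Longrightarrow> norm (f x) \<le> C"
  using compact_imp_bounded[OF compact_continuous_image[OF assms(2,1)]] unfolding bounded_iff by (metis imageI)

text \<open>For \<open>r < 1\<close> a dilate is holomorphic across the unit circle, so Cauchy's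
  formula on that circle applies to it; statements about \<open>F\<close> itself come from letting
  the radius tend to 1.\<close>

lemma dilation_holomorphic:
  assumes F: "F holomorphic_on ball 0 1" and r: "0 < r"
  shows "(\<lambda>w. F (of_real r * w)) holomorphic_on ball 0 (1 / r)"
proof -
  have "F \<circ> (\<lambda>w. of_real r * w) holomorphic_on ball 0 (1 / r)"
    using r by (intro holomorphic_on_compose_gen[OF _ F] holomorphic_intros) (auto simp: norm_mult field_simps)
  then show ?thesis by (simp add: o_def)
qed

lemma dilation_tendsto:
  fixes R :: "nat \<Rightarrow> real"
  assumes F: "F holomorphic_on ball 0 1" and z: "norm z < 1" and R: "R \<longlonglongrightarrow> 1"
  shows "(\<lambda>n. F (of_real (R n) * z)) \<longlonglongrightarrow> F z"
proof -
  have "isCont F (of_real 1 * z)"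
    using holomorphic_on_imp_continuous_on[OF F] z by (simp add: continuous_on_eq_continuous_at)
  moreover have "(\<lambda>n. of_real (R n) * z) \<longlonglongrightarrow> of_real 1 * z" by (intro tendsto_intros R)
  ultimately show ?thesis using isCont_tendsto_compose[of "of_real 1 * z" F] by fastforce
qed

lemma inverse_add_2_tendsto: "(\<lambda>n. 1 / (real n + 2)) \<longlonglongrightarrow> 0"
  using LIMSEQ_ignore_initial_segment[OF lim_1_over_n[where 'a=real], of 2] by (simp add: add_ac)

section \<open>Integration over the circle and Cauchy's formula\<close>

lemma finite_measure_circ: "finite_measure circ"
  by (rule finite_measure_lebesgue_on) (simp add: lmeasurable_cbox[of 0 "2*pi::real", simplified])

lemma measure_circ: "measure circ (space circ) = 2 * pi"
  by (simp add: space_restrict_space measure_restrict_space)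

lemma circ_measurable_cont:
  fixes f :: "real \<Rightarrow> 'a::euclidean_space"
  assumes "continuous_on {0..2 * pi} f"
  shows "f \<in> borel_measurable circ"
  using assms by (rule continuous_imp_measurable_on_sets_lebesgue) simp

lemma cis_circ_measurable [measurable]: "cis \<in> borel_measurable circ"
  by (rule circ_measurable_cont) (intro continuous_intros)

lemma circ_integrable_bounded:
  fixes f :: "real \<Rightarrow> 'a::euclidean_space"
  assumes "f \<in> borel_measurable circ" "AE t in circ. norm (f t) \<le> C"
  shows "integrable circ f"
  using finite_measure.integrable_const_bound[OF finite_measure_circ assms(2,1)] .

lemma circ_integrable_cont:
  fixes f :: "real \<Rightarrow> 'a::euclidean_space"
  assumes "continuous_on {0..2 * pi} f"
  shows "integrable circ f"
proof -
  obtain C where "\<And>t. t \<in> {0..2*pi} \<Longrightarrow> norm (f t) \<le> C"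
    using compact_continuous_bound[OF compact_Icc assms] by blast
  then show ?thesis
    by (intro circ_integrable_bounded[of _ C] circ_measurable_cont assms AE_I2) (simp add: space_restrict_space)
qed

text \<open>On the circle \<open>d\<zeta> / (2 * pi * \<i>)\<close> is
  \<open>\<zeta> dt / (2 * pi)\<close>, which accounts for the extra factor
  \<open>cis t\<close>.\<close>

lemma circle_Cauchy:
  fixes F :: "complex \<Rightarrow> complex"
  assumes F: "F holomorphic_on ball 0 R" and R: "1 < R" and z: "norm z < 1"
  shows "(LINT t|circ. F (cis t) * cis t / (cis t - z)) = 2 * pi * F z"
proof -
  have sub: "cball 0 1 \<subseteq> ball (0::complex) R" using R by auto
  have cis: "cis t \<noteq> z" for t using z by (metis less_irrefl norm_cis)
  have "((\<lambda>u. F u/(u-z)) has_contour_integral (2 * of_real pi * \<i> * F z)) (part_circlepath 0 1 0 (2*pi))"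
    using Cauchy_integral_circlepath[of 0 1 F z] z holomorphic_on_subset[OF F] sub
      ball_subset_cball[of "0::complex" 1] holomorphic_on_imp_continuous_on
    by (auto simp: circlepath_def)
  then have "((\<lambda>t. F (cis t) / (cis t - z) * \<i> * cis t) has_integral (2 * of_real pi * \<i> * F z)) {0..2*pi}"
    by (simp add: has_contour_integral_part_circlepath_iff)
  then have "((\<lambda>t. - \<i> * (F (cis t) / (cis t - z) * \<i> * cis t)) has_integral - \<i> * (2 * of_real pi * \<i> * F z)) {0..2*pi}"
    by (rule has_integral_mult_right)
  then have I: "((\<lambda>t. F (cis t) * cis t / (cis t - z)) has_integral (2 * of_real pi * F z)) {0..2*pi}"
    by (simp add: field_simps)
  have "continuous_on {0..2*pi} (\<lambda>t. F (cis t) * cis t / (cis t - z))"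
    using R cis by (intro continuous_intros continuous_on_compose2[OF holomorphic_on_imp_continuous_on[OF F]]) auto
  from lebesgue_integral_eq_integral[OF circ_integrable_cont[OF this]] integral_unique[OF I]
  show ?thesis by simp
qed

lemma circle_mean:
  fixes F :: "complex \<Rightarrow> complex"
  assumes F: "F holomorphic_on ball 0 R" and R: "1 < R"
  shows "(LINT t|circ. F (cis t)) = 2 * pi * F 0"
  using circle_Cauchy[OF assms, of 0] by simp

text \<open>Left unnormalised: the total mass over the circle is \<open>2 * pi\<close>, and this
  factor appears in every representation formula below.\<close>

definition poisson :: "complex \<Rightarrow> real \<Rightarrow> real" where
  "poisson z t = (1 - (norm z)\<^sup>2) / (norm (cis t - z))\<^sup>2"

lemma Re_herglotz: "Re ((cis t + z) / (cis t - z)) = poisson z t"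
proof -
  have "Re ((cis t + z) / (cis t - z)) = Re ((cis t + z) * cnj (cis t - z)) / (norm (cis t - z))\<^sup>2"
    by (simp add: complex_div_cnj[of "cis t + z"] Re_divide_of_real flip: of_real_power)
  also have "Re ((cis t + z) * cnj (cis t - z)) = 1 - (norm z)\<^sup>2"
    using sin_cos_squared_add[of t] unfolding cmod_power2 by (simp add: algebra_simps power2_eq_square)
  finally show ?thesis by (simp add: poisson_def)
qed

text \<open>Partial fractions after writing 1 as \<open>cis t * cnj (cis t)\<close>. The first
  summand is the Cauchy kernel; the second is, as a function of \<open>cis t\<close>, holomorphic in
  the disk and zero at the origin.\<close>

lemma poisson_split:
  assumes "norm z < 1"
  shows "of_real (poisson z t) = cis t / (cis t - z) + cnj z * cis t / (1 - cnj z * cis t)"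
proof -
  have cis: "cis t \<noteq> z" using assms by (metis less_irrefl norm_cis)
  have "cnj (cis t) * cis t = 1" by (simp add: cis_cnj cis_mult)
  then have *: "1 - cnj z * cis t = cis t * cnj (cis t - z)" by (simp add: algebra_simps)
  have n: "cnj (cis t) - cnj z \<noteq> 0" using cis by (metis complex_cnj_cancel_iff eq_iff_diff_eq_0)
  have "of_real (poisson z t) = (1 - z * cnj z) / ((cis t - z) * (cnj (cis t) - cnj z))"
    by (simp add: poisson_def complex_norm_square[of z, symmetric] complex_norm_square[of "cis t - z"] flip: of_real_power)
  also have "\<dots> = cis t / (cis t - z) + cnj z / (cnj (cis t) - cnj z)"
    using cis n \<open>cnj (cis t) * cis t = 1\<close> by (simp add: divide_simps) (simp add: algebra_simps)
  finally show ?thesis unfolding * by simp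
qed

text \<open>The Cauchy part of the kernel reproduces \<open>F z\<close>; the other part contributes
  the mean of a holomorphic function that vanishes at the origin.\<close>

lemma circle_Poisson:
  fixes F :: "complex \<Rightarrow> complex"
  assumes F: "F holomorphic_on ball 0 R" and R: "1 < R" and z: "norm z < 1"
  shows "(LINT t|circ. poisson z t *\<^sub>R F (cis t)) = 2 * pi * F z"
proof -
  have cis: "cis t \<noteq> z" "cnj z * cis t \<noteq> 1" for t 
    using z by (metis less_irrefl norm_cis, metis z complex_mod_cnj norm_cis norm_mult norm_one mult.right_neutral less_irrefl)
  have cF: "continuous_on A (\<lambda>t. F (cis t))" for A :: "real set"
    using R by (intro continuous_intros continuous_on_compose2[OF holomorphic_on_imp_continuous_on[OF F]]) auto
  \<comment> \<open>\<open>R'\<close> keeps the disk free of the pole of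
    \<open>1 / (1 - cnj z * w)\<close>, which has modulus \<open>1 / norm z\<close>.\<close>
  define R' where "R' = (if z = 0 then R else min R (1 / norm z))"
  have R': "1 < R'" using R z by (auto simp: R'_def)
  have "(\<lambda>w::complex. F w * (cnj z * w) / (1 - cnj z * w)) holomorphic_on ball 0 R'"
  proof (intro holomorphic_intros holomorphic_on_subset[OF F])
    fix w :: complex assume "w \<in> ball 0 R'"
    then have "norm (cnj z * w) < 1" by (auto simp: norm_mult R'_def field_simps split: if_splits)
    then show "1 - cnj z * w \<noteq> 0" by auto
  qed (auto simp: R'_def)
  from circle_mean[OF this R'] have 2: "(LINT t|circ. F (cis t) * (cnj z * cis t) / (1 - cnj z * cis t)) = 0"
    by simp
  have "(LINT t|circ. poisson z t *\<^sub>R F (cis t)) 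
     = (LINT t|circ. F (cis t) * cis t / (cis t - z) + F (cis t) * (cnj z * cis t) / (1 - cnj z * cis t))"
    by (intro Bochner_Integration.integral_cong refl) (simp add: scaleR_conv_of_real poisson_split[OF z] algebra_simps)
  also have "\<dots> = (LINT t|circ. F (cis t) * cis t / (cis t - z)) + (LINT t|circ. F (cis t) * (cnj z * cis t) / (1 - cnj z * cis t))"
    using cis by (intro Bochner_Integration.integral_add circ_integrable_cont continuous_intros cF) auto
  finally show ?thesis using circle_Cauchy[OF assms] 2 by simp
qed

lemma poisson_nonneg: "norm z < 1 \<Longrightarrow> 0 \<le> poisson z t"
  by (simp add: poisson_def power_le_one)

lemma poisson_continuous: "norm z < 1 \<Longrightarrow> continuous_on A (poisson z)"
  unfolding poisson_def by (intro continuous_intros) (metis eq_iff_diff_eq_0 less_irrefl norm_cis norm_eq_zero power_eq_0_iff)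

lemma poisson_integral_1:
  assumes "norm z < 1" shows "(LINT t|circ. poisson z t) = 2 * pi"
proof -
  have "(LINT t|circ. poisson z t *\<^sub>R (1::complex)) = 2 * pi"
    using circle_Poisson[of "\<lambda>_. 1" 2 z] assms by simp
  moreover have "(LINT t|circ. poisson z t *\<^sub>R (1::complex)) = of_real (LINT t|circ. poisson z t)"
    by (simp add: scaleR_conv_of_real del: integral_scaleR_left)
  ultimately have "complex_of_real (LINT t|circ. poisson z t) = of_real (2 * pi)" by simp
  then show ?thesis by (simp only: of_real_eq_iff)
qed

lemma poisson_le:
  assumes "norm z < 1" shows "poisson z t \<le> 2 / (1 - norm z)"
proof -
  have d: "1 - norm z \<le> norm (cis t - z)" using norm_triangle_ineq2[of "cis t" z] by simp
  have "poisson z t \<le> (1 - (norm z)\<^sup>2) / (1 - norm z)\<^sup>2"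
    unfolding poisson_def using assms d by (intro divide_left_mono power_mono mult_pos_pos zero_less_power) (auto simp: power_le_one)
  also have "\<dots> = (1 + norm z) / (1 - norm z)"
    using assms by (simp add: power2_eq_square divide_simps) (simp add: algebra_simps)
  also have "\<dots> \<le> 2 / (1 - norm z)" using assms by (intro divide_right_mono) auto
  finally show ?thesis .
qed

lemma poisson_times_integrable:
  fixes u :: "real \<Rightarrow> 'a::euclidean_space"
  assumes "integrable circ u" "norm z < 1"
  shows "integrable circ (\<lambda>t. poisson z t *\<^sub>R u t)"
proof (rule Bochner_Integration.integrable_bound)
  show "integrable circ (\<lambda>t. (2 / (1 - norm z)) *\<^sub>R u t)" using assms by simp
  have [measurable]: "poisson z \<in> borel_measurable circ" "u \<in> borel_measurable circ"
    using assms by (auto intro: circ_measurable_cont poisson_continuous)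
  show "(\<lambda>t. poisson z t *\<^sub>R u t) \<in> borel_measurable circ" by measurable
  show "AE t in circ. norm (poisson z t *\<^sub>R u t) \<le> norm ((2 / (1 - norm z)) *\<^sub>R u t)"
    using poisson_le[OF assms(2)] poisson_nonneg[OF assms(2)] assms(2)
    by (intro AE_I2) (simp only: norm_scaleR, auto intro!: mult_right_mono simp del: times_divide_eq_left)
qed

section \<open>Radial limits of Poisson integrals\<close>

lemma integral_circ_indicator:
  fixes f :: "real \<Rightarrow> real"
  assumes "integrable circ f"
  shows "integrable circ (\<lambda>t. indicator {a..b} t * f t)"
proof (rule Bochner_Integration.integrable_bound[OF assms])
  have [measurable]: "indicator {a..b} \<in> borel_measurable circ"
    by (intro measurable_restrict_space1 borel_measurable_indicator) auto
  show "(\<lambda>t. indicator {a..b} t * f t) \<in> borel_measurable circ"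
    using assms by measurable
qed (simp add: indicator_def)

text \<open>Only the upper half of Lebesgue differentiation is kept, with the average multiplied
  out; it will be applied to functions of the form \<open>norm (u t - q)\<close>.\<close>

lemma one_sided_lebesgue_points:
  fixes f :: "real \<Rightarrow> real"
  assumes "\<And>a b. f integrable_on {a..b}"
  shows "AE x in lebesgue. \<forall>e>0. \<exists>d>0. \<forall>h. 0 < h \<and> h < d \<longrightarrow> integral {x..x + h} f \<le> h * (f x + e)"
proof -
  have a: "f integrable_on cbox a b" for a b using assms by simp
  obtain N where N: "negligible N" "\<And>x e. \<lbrakk>x \<notin> N; 0 < e\<rbrakk> \<Longrightarrow>
               \<exists>d>0. \<forall>h. 0 < h \<and> h < d \<longrightarrow> norm(integral (cbox x (x + h *\<^sub>R One)) f /\<^sub>R h ^ DIM(real) - f x) < e"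
    using integrable_ccontinuous_explicit[OF a] by blast
  show ?thesis
  proof (rule AE_I')
    show "N \<in> null_sets lebesgue" using N by (simp add: negligible_iff_null_sets)
    show "{x \<in> space lebesgue. \<not> (\<forall>e>0. \<exists>d>0. \<forall>h. 0 < h \<and> h < d \<longrightarrow> integral {x..x + h} f \<le> h * (f x + e))} \<subseteq> N"
    proof (clarify, rule ccontr)
      fix x e :: real
      assume "x \<notin> N" and e: "0 < e" and no: "\<not> (\<exists>d>0. \<forall>h. 0 < h \<and> h < d \<longrightarrow> integral {x..x + h} f \<le> h * (f x + e))"
      obtain d where d: "d > 0" "\<And>h. 0 < h \<Longrightarrow> h < d \<Longrightarrow> norm(integral (cbox x (x + h *\<^sub>R One)) f /\<^sub>R h ^ DIM(real) - f x) < e"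
        using N(2)[OF \<open>x \<notin> N\<close> e] by blast
      have "integral {x..x + h} f \<le> h * (f x + e)" if "0 < h" "h < d" for h
        using d(2)[OF that] that by (simp add: field_simps abs_less_iff)
      with no d(1) show False by blast
    qed
  qed
qed

text \<open>The left half of the window is the one-sided statement for the reflected function at
  \<open>- x\<close>; negation maps the exceptional null set to a null set.\<close>

lemma lebesgue_points_nonneg:
  fixes f :: "real \<Rightarrow> real"
  assumes "\<And>a b. f integrable_on {a..b}"
  shows "AE x in lebesgue. \<forall>e>0. \<exists>d>0. \<forall>h. 0 < h \<and> h < d \<longrightarrow> integral {x - h..x + h} f \<le> 2 * h * (f x + e)"
proof -
  have r: "(\<lambda>t. f (- t)) integrable_on {a..b}" for a b
    using assms[of "-b" "-a"] Henstock_Kurzweil_Integration.integrable_reflect_real[of f "-a" "-b"] by simp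
  define g where "g = (\<lambda>t. f (- t))"
  have "AE x in lebesgue. \<forall>e>0. \<exists>d>0. \<forall>h. 0 < h \<and> h < d \<longrightarrow> integral {- x..- x + h} g \<le> h * (f x + e)"
  proof -
    have "AE x in lebesgue. \<forall>e>0. \<exists>d>0. \<forall>h. 0 < h \<and> h < d \<longrightarrow> integral {x..x + h} g \<le> h * (g x + e)"
      using r unfolding g_def by (rule one_sided_lebesgue_points)
    then obtain N where N: "\<And>x. x \<in> space lebesgue - N \<Longrightarrow>
        \<forall>e>0. \<exists>d>0. \<forall>h. 0 < h \<and> h < d \<longrightarrow> integral {x..x + h} g \<le> h * (g x + e)"
      "N \<in> null_sets lebesgue" by (rule AE_E3) (rule that)
    have "negligible (uminus ` N)"
      using N(2) by (intro negligible_differentiable_image_negligible) (auto simp: negligible_iff_null_sets)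
    then have "AE x in lebesgue. x \<notin> uminus ` N"
      by (intro AE_not_in) (simp add: negligible_iff_null_sets)
    then show ?thesis
    proof (rule eventually_mono)
      fix x assume "x \<notin> uminus ` N"
      then have "- x \<in> space lebesgue - N" by (metis DiffI UNIV_I image_eqI minus_minus space_completion space_lborel space_borel)
      moreover have "g (- x) = f x" by (simp add: g_def)
      ultimately show "\<forall>e>0. \<exists>d>0. \<forall>h. 0 < h \<and> h < d \<longrightarrow> integral {- x..- x + h} g \<le> h * (f x + e)"
        using N(1)[of "- x"] by simp
    qed
  qed
  with one_sided_lebesgue_points[OF assms] show ?thesis
  proof eventually_elim
    case (elim x)
    show ?case
    proof (intro allI impI)
      fix e :: real assume "0 < e"
      from elim(1)[THEN spec, THEN mp, OF this] obtain d1 where d1: "d1 > 0"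
        "\<forall>h. 0 < h \<and> h < d1 \<longrightarrow> integral {x..x + h} f \<le> h * (f x + e)" by (elim exE conjE) (rule that)
      from elim(2)[THEN spec, THEN mp, OF \<open>0 < e\<close>] obtain d2 where d2: "d2 > 0"
        "\<forall>h. 0 < h \<and> h < d2 \<longrightarrow> integral {- x..- x + h} g \<le> h * (f x + e)" by (elim exE conjE) (rule that)
      have "integral {x - h..x + h} f \<le> 2 * h * (f x + e)" if "0 < h" "h < min d1 d2" for h
      proof -
        have "integral {x - h..x + h} f = integral {x - h..x} f + integral {x..x + h} f"
          using that assms by (simp add: Henstock_Kurzweil_Integration.integral_combine)
        moreover have "integral {- x..- x + h} g = integral {x - h..x} f"
          unfolding g_def using Henstock_Kurzweil_Integration.integral_reflect_real[of x "x - h" f] by simp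
        ultimately show ?thesis using d1(2)[rule_format, of h] d2(2)[rule_format, of h] that by (simp add: algebra_simps)
      qed
      then show "\<exists>d>0. \<forall>h. 0 < h \<and> h < d \<longrightarrow> integral {x - h..x + h} f \<le> 2 * h * (f x + e)"
        using d1(1) d2(1) by (intro exI[of _ "min d1 d2"]) auto
    qed
  qed
qed

lemma circ_integral_restrict:
  fixes f :: "real \<Rightarrow> real"
  assumes "integrable circ f"
  shows "(\<lambda>t. indicator {0..2*pi} t * f t) integrable_on {a..b}"
    "(LINT t|circ. indicator {a..b} t * f t) = integral {a..b} (\<lambda>t. indicator {0..2*pi} t * f t)"
proof -
  have i: "integrable lebesgue (\<lambda>t. indicator {0..2*pi} t * f t)"
    using assms by (subst (asm) integrable_restrict_space) auto
  then have "integrable lebesgue (\<lambda>t. indicator {a..b} t *\<^sub>R (indicator {0..2*pi} t * f t))"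
    by (intro integrable_mult_indicator) auto
  then have i2: "integrable (lebesgue_on {a..b}) (\<lambda>t. indicator {0..2*pi} t * f t)"
    by (subst integrable_restrict_space) auto
  then show "(\<lambda>t. indicator {0..2*pi} t * f t) integrable_on {a..b}"
    by (rule integrable_on_lebesgue_on) auto
  have "(LINT t|circ. indicator {a..b} t * f t) = (LINT t|lebesgue_on {a..b}. indicator {0..2*pi} t * f t)"
    by (simp add: integral_restrict_space mult_ac)
  also have "\<dots> = integral {a..b} (\<lambda>t. indicator {0..2*pi} t * f t)"
    using i2 by (rule lebesgue_integral_eq_integral) auto
  finally show "(LINT t|circ. indicator {a..b} t * f t) = integral {a..b} (\<lambda>t. indicator {0..2*pi} t * f t)" .
qed

lemma AE_circ_iff: "(AE t in circ. P t) \<longleftrightarrow> (AE t in lebesgue. 0 \<le> t \<and> t \<le> 2 * pi \<longrightarrow> P t)"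
  by (subst AE_restrict_space_iff) auto

lemma AE_circ_interior: "AE t in circ. 0 < t \<and> t < 2 * pi"
proof -
  have "{0, 2 * pi} \<in> null_sets lebesgue"
    using negligible_iff_null_sets by (metis negligible_finite finite.emptyI finite.insertI)
  then have "AE t in lebesgue. t \<notin> {0, 2 * pi}" by (rule AE_not_in)
  then show ?thesis unfolding AE_circ_iff by eventually_elim auto
qed

text \<open>The window is cut off at the ends of the parameter interval instead of being wrapped
  around, so this is the usual notion only for \<open>\<theta>\<close> strictly between
  \<open>0\<close> and \<open>2 * pi\<close>; the two end points form a null set.\<close>

definition lebesgue_point :: "(real \<Rightarrow> 'a::euclidean_space) \<Rightarrow> real \<Rightarrow> bool" where
  "lebesgue_point u \<theta> \<longleftrightarrow> (\<forall>e>0. \<exists>d>0. \<forall>h. 0 < h \<and> h < d \<longrightarrow>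
      (LINT t|circ. indicator {\<theta> - h..\<theta> + h} t * norm (u t - u \<theta>)) \<le> e * h)"

text \<open>The exceptional set in the differentiation theorem depends on the function, so the
  theorem is applied to \<open>norm (u t - q)\<close> for \<open>q\<close> in a countable dense set,
  and \<open>u x\<close> is then replaced by a nearby \<open>q\<close>.\<close>

lemma AE_lebesgue_point:
  fixes u :: "real \<Rightarrow> 'a::euclidean_space"
  assumes u: "integrable circ u"
  shows "AE \<theta> in circ. lebesgue_point u \<theta>"
proof -
  interpret finite_measure circ by (rule finite_measure_circ)
  obtain Q :: "'a set" where Q: "countable Q" "\<And>X. open X \<Longrightarrow> X \<noteq> {} \<Longrightarrow> \<exists>q\<in>Q. q \<in> X"
    using countable_dense_setE by blast
  have int: "integrable circ (\<lambda>t. norm (u t - q))" for q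
    using u by auto
  have "AE x in circ. \<forall>e>0. \<exists>d>0. \<forall>h. 0 < h \<and> h < d \<longrightarrow>
    (LINT t|circ. indicator {x - h..x + h} t * norm (u t - q)) \<le> 2 * h * (norm (u x - q) + e)" for q
  proof -
    let ?J = "\<lambda>x h. LINT t|circ. indicator {x - h..x + h} t * norm (u t - q)"
    have J: "?J x h = integral {x - h..x + h} (\<lambda>t. indicator {0..2 * pi} t * norm (u t - q))" for x h
      by (rule circ_integral_restrict(2)[OF int])
    have leb: "AE x in lebesgue. \<forall>e>0. \<exists>d>0. \<forall>h. 0 < h \<and> h < d \<longrightarrow>
        ?J x h \<le> 2 * h * (indicator {0..2 * pi} x * norm (u x - q) + e)"
      unfolding J by (rule lebesgue_points_nonneg[OF circ_integral_restrict(1)[OF int]])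
    have eq: "indicat_real {0..2 * pi} x * norm (u x - q) = norm (u x - q)" if "0 \<le> x \<and> x \<le> 2 * pi" for x
      using that by simp
    from leb show ?thesis
      unfolding AE_circ_iff
    proof eventually_elim
      case (elim x)
      show ?case
      proof
        assume "0 \<le> x \<and> x \<le> 2 * pi"
        from elim[unfolded eq[OF this]]
        show "\<forall>e>0. \<exists>d>0. \<forall>h. 0 < h \<and> h < d \<longrightarrow> ?J x h \<le> 2 * h * (norm (u x - q) + e)" .
      qed
    qed
  qed
  then have "AE x in circ. \<forall>q\<in>Q. \<forall>e>0. \<exists>d>0. \<forall>h. 0 < h \<and> h < d \<longrightarrow>
    (LINT t|circ. indicator {x - h..x + h} t * norm (u t - q)) \<le> 2 * h * (norm (u x - q) + e)"
    using Q(1) by (simp add: AE_ball_countable)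
  then show ?thesis
  proof (rule eventually_mono)
    fix x
    assume elim: "\<forall>q\<in>Q. \<forall>e>0. \<exists>d>0. \<forall>h. 0 < h \<and> h < d \<longrightarrow>
      (LINT t|circ. indicator {x - h..x + h} t * norm (u t - q)) \<le> 2 * h * (norm (u x - q) + e)"
    show "lebesgue_point u x" unfolding lebesgue_point_def
    proof (intro allI impI)
      fix e :: real assume e: "0 < e"
      \<comment> \<open>With \<open>e / 8\<close> both as distance of \<open>q\<close> and as
        tolerance, the contributions add up to \<open>6 * e * h / 8\<close>.\<close>
      obtain q where q: "q \<in> Q" "norm (u x - q) < e / 8"
        using Q(2)[of "ball (u x) (e/8)"] e by (auto simp: dist_norm)
      have e8: "0 < e / 8" using e by simp
      from bspec[OF elim q(1), THEN spec, THEN mp, OF e8]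
      obtain d where d: "d > 0" "\<forall>h. 0 < h \<and> h < d \<longrightarrow>
        (LINT t|circ. indicator {x - h..x + h} t * norm (u t - q)) \<le> 2 * h * (norm (u x - q) + e / 8)"
        by (elim exE conjE) (rule that)
      have "(LINT t|circ. indicator {x - h..x + h} t * norm (u t - u x)) \<le> e * h" if h: "0 < h" "h < d" for h
      proof -
        have c1: "integrable circ (\<lambda>t. indicat_real {x - h..x + h} t * norm (u x - q))"
          by (intro integral_circ_indicator) simp
        have c2: "(LINT t|circ. indicat_real {x - h..x + h} t * norm (u x - q)) \<le> 2 * h * norm (u x - q)"
        proof -
          have "(LINT t|circ. indicat_real {x - h..x + h} t * norm (u x - q)) 
             = integral {x - h..x + h} (\<lambda>t. indicator {0..2*pi} t * norm (u x - q))"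
            by (rule circ_integral_restrict) simp
          also have "\<dots> \<le> integral {x - h..x + h} (\<lambda>t. norm (u x - q))"
            by (intro integral_le circ_integral_restrict(1)) (auto simp: indicator_def)
          finally show ?thesis using h by simp
        qed
        have "(LINT t|circ. indicator {x - h..x + h} t * norm (u t - u x))
          \<le> (LINT t|circ. indicator {x - h..x + h} t * norm (u t - q) + indicator {x - h..x + h} t * norm (u x - q))"
        proof (intro integral_mono Bochner_Integration.integrable_add c1 integral_circ_indicator int)
          fix t
          have "norm (u t - u x) \<le> norm (u t - q) + norm (u x - q)"
            using norm_triangle_ineq4[of "u t - q" "u x - q"] by simp
          then show "indicator {x - h..x + h} t * norm (u t - u x) \<le> indicator {x - h..x + h} t * norm (u t - q) + indicator {x - h..x + h} t * norm (u x - q)"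
            by (simp add: indicator_def)
        qed
        also have "\<dots> = (LINT t|circ. indicator {x - h..x + h} t * norm (u t - q)) + (LINT t|circ. indicator {x - h..x + h} t * norm (u x - q))"
          by (intro Bochner_Integration.integral_add c1 integral_circ_indicator int)
        also have "\<dots> \<le> 2 * h * (norm (u x - q) + e / 8) + 2 * h * norm (u x - q)"
          using d(2)[rule_format, of h] h c2 by (intro add_mono) auto
        also have "\<dots> \<le> 2 * h * (e / 8 + e / 8) + 2 * h * (e / 8)"
          using q h e by (intro add_mono mult_left_mono) auto
        also have "\<dots> \<le> e * h" using e h by (simp add: field_simps)
        finally show ?thesis .
      qed
      then have "\<forall>h. 0 < h \<and> h < d \<longrightarrow> (LINT t|circ. indicator {x - h..x + h} t * norm (u t - u x)) \<le> e * h"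
        by (intro allI impI) (elim conjE)
      with d(1) show "\<exists>d>0. \<forall>h. 0 < h \<and> h < d \<longrightarrow> (LINT t|circ. indicator {x - h..x + h} t * norm (u t - u x)) \<le> e * h"
        by (intro exI[of _ d] conjI)
    qed
  qed
qed

section \<open>Size of the Poisson kernel near its peak and away from it\<close>

lemma norm_cis_diff_sq: "(norm (cis t - of_real r * cis \<theta>))\<^sup>2 = (1 - r)\<^sup>2 + 2 * r * (1 - cos (t - \<theta>))"
proof -
  have "(cos t - r * cos \<theta>)\<^sup>2 + (sin t - r * sin \<theta>)\<^sup>2 = (1 - r)\<^sup>2 + 2 * r * (1 - (cos t * cos \<theta> + sin t * sin \<theta>))"
    using sin_cos_squared_add[of t] sin_cos_squared_add[of \<theta>] by algebra
  then show ?thesis by (simp add: cmod_power2 cos_diff)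
qed

text \<open>\<open>1 - cos s\<close> is \<open>2 * (sin (s / 2))\<^sup>2\<close>, and
  \<open>sin x \<ge> x / 2\<close> up to \<open>x = 1 / 2\<close> because the derivative is still at
  least \<open>cos (pi / 3) = 1 / 2\<close> there.\<close>

lemma one_minus_cos_ge:
  fixes s :: real
  assumes "\<bar>s\<bar> \<le> 1" shows "s\<^sup>2 / 8 \<le> 1 - cos s"
proof -
  define x where "x = \<bar>s\<bar> / 2"
  have x: "0 \<le> x" "x \<le> 1/2" using assms by (auto simp: x_def)
  have "x / 2 \<le> sin x"
  proof (cases "x = 0")
    case False
    then obtain z where z: "0 < z" "z < x" "sin x - sin 0 = (x - 0) * cos z"
      using MVT2[of 0 x sin cos] x by (auto intro: DERIV_sin)
    have "cos (pi/3) \<le> cos z" using z x pi_gt3 by (intro cos_monotone_0_pi_le) auto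
    then have "1/2 \<le> cos z" by (simp add: cos_60)
    then have "x * (1/2) \<le> x * cos z" using x by (intro mult_left_mono) auto
    then show ?thesis using z(3) by simp
  qed auto
  then have "(x/2)\<^sup>2 \<le> (sin x)\<^sup>2" using x by (intro power_mono) auto
  moreover have "1 - cos s = 2 * (sin x)\<^sup>2"
    using cos_double_sin[of x] by (simp add: x_def)
  ultimately show ?thesis by (simp add: x_def power2_eq_square)
qed

text \<open>Peak value and quadratic decay, which balance at distance of order \<open>1 - r\<close>.
  The constant 16 is 8 from \<open>1 - cos s \<ge> s\<^sup>2 / 8\<close> (with
  \<open>2 * r \<ge> 1\<close>) times 2 from \<open>1 + r \<le> 2\<close>.\<close>

lemma poisson_near_bound:
  assumes r: "1/2 \<le> r" "r < 1" and s: "\<bar>t - \<theta>\<bar> \<le> 1"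
  shows "poisson (of_real r * cis \<theta>) t \<le> 2 / (1 - r)"
    and "t \<noteq> \<theta> \<Longrightarrow> poisson (of_real r * cis \<theta>) t \<le> 16 * (1 - r) / (t - \<theta>)\<^sup>2"
proof -
  have n: "norm (of_real r * cis \<theta>) = r" using r by (simp add: norm_mult)
  show "poisson (of_real r * cis \<theta>) t \<le> 2 / (1 - r)"
    using poisson_le[of "of_real r * cis \<theta>" t] r n by simp
  assume "t \<noteq> \<theta>"
  then have p: "0 < (t - \<theta>)\<^sup>2" by simp
  have "1 * ((t - \<theta>)\<^sup>2 / 8) \<le> 2 * r * (1 - cos (t - \<theta>))"
    using one_minus_cos_ge[OF s] r by (intro mult_mono) auto
  then have d: "(t - \<theta>)\<^sup>2 / 8 \<le> (norm (cis t - of_real r * cis \<theta>))\<^sup>2"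
    unfolding norm_cis_diff_sq by (smt (verit) zero_le_power2)
  have "poisson (of_real r * cis \<theta>) t \<le> (1 - r\<^sup>2) / ((t - \<theta>)\<^sup>2 / 8)"
    unfolding poisson_def n using d p r by (intro divide_left_mono mult_pos_pos) (auto simp: power_le_one)
  also have "\<dots> = 8 * ((1 + r) * (1 - r)) / (t - \<theta>)\<^sup>2" by (simp add: power2_eq_square algebra_simps)
  also have "\<dots> \<le> 8 * (2 * (1 - r)) / (t - \<theta>)\<^sup>2"
    using r p by (intro divide_right_mono mult_left_mono mult_right_mono) auto
  finally show "poisson (of_real r * cis \<theta>) t \<le> 16 * (1 - r) / (t - \<theta>)\<^sup>2" by simp
qed

text \<open>By compactness \<open>1 - cos (t - \<theta>)\<close> has a positive minimum
  \<open>c\<close> off the window: for \<open>\<theta>\<close> in the open interval,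
  \<open>\<bar>t - \<theta>\<bar> < 2 * pi\<close>, so the cosine is 1 only at
  \<open>t = \<theta>\<close>.\<close>

lemma poisson_far_bound:
  assumes "0 < \<theta>" "\<theta> < 2 * pi" "0 < \<delta>"
  obtains c where "0 < c" "\<And>r t. \<lbrakk>1/2 \<le> r; r < 1; t \<in> {0..2*pi}; \<delta> \<le> \<bar>t - \<theta>\<bar>\<rbrakk> \<Longrightarrow> poisson (of_real r * cis \<theta>) t \<le> 2 * (1 - r) / c"
proof -
  define A where "A = {0..2*pi} \<inter> {t. \<delta> \<le> \<bar>t - \<theta>\<bar>}"
  have "compact A" unfolding A_def
    by (intro compact_Int_closed closed_Collect_le continuous_intros) auto
  obtain c where c: "0 < c" "\<And>t. t \<in> A \<Longrightarrow> c \<le> 1 - cos (t - \<theta>)"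
  proof (cases "A = {}")
    case False
    obtain t0 where t0: "t0 \<in> A" "\<And>t. t \<in> A \<Longrightarrow> 1 - cos (t0 - \<theta>) \<le> 1 - cos (t - \<theta>)"
      using continuous_attains_inf[OF \<open>compact A\<close> False, of "\<lambda>t. 1 - cos (t - \<theta>)"] by (force intro!: continuous_intros)
    have "cos (t0 - \<theta>) \<noteq> 1"
    proof
      assume "cos (t0 - \<theta>) = 1"
      then obtain k :: int where k: "t0 - \<theta> = of_int k * 2 * pi" by (auto simp: cos_one_2pi_int)
      have "\<bar>of_int k * 2 * pi\<bar> < 2 * pi" using k t0(1) assms unfolding A_def by auto
      then have "\<bar>real_of_int k\<bar> < 1" by (simp add: abs_mult)
      then have "k = 0" by linarith
      with k t0(1) assms show False by (auto simp: A_def)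
    qed
    then show ?thesis using that[of "1 - cos (t0 - \<theta>)"] t0(2) cos_le_one[of "t0 - \<theta>"] by fastforce
  qed (use that[of 1] in auto)
  show ?thesis
  proof (rule that[OF c(1)])
    fix r t :: real assume r: "1/2 \<le> r" "r < 1" and t: "t \<in> {0..2*pi}" "\<delta> \<le> \<bar>t - \<theta>\<bar>"
    have n: "norm (of_real r * cis \<theta>) = r" using r by (simp add: norm_mult)
    have "1 * c \<le> 2 * r * (1 - cos (t - \<theta>))"
      using c t r by (intro mult_mono) (auto simp: A_def)
    then have d: "c \<le> (norm (cis t - of_real r * cis \<theta>))\<^sup>2"
      unfolding norm_cis_diff_sq by (smt (verit) zero_le_power2)
    have "poisson (of_real r * cis \<theta>) t \<le> (1 - r\<^sup>2) / c"
      unfolding poisson_def n using d c r by (intro divide_left_mono mult_pos_pos) (auto simp: power_le_one)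
    also have "\<dots> = (1 + r) * (1 - r) / c" by (simp add: power2_eq_square algebra_simps)
    also have "\<dots> \<le> 2 * (1 - r) / c"
      using r c by (intro divide_right_mono mult_right_mono) auto
    finally show "poisson (of_real r * cis \<theta>) t \<le> 2 * (1 - r) / c" .
  qed
qed

text \<open>Within distance \<open>2^J \<eta>\<close> of \<open>\<theta>\<close>, where \<open>\<eta> = 1 - r\<close>, the kernel is dominated by a step function
  that is constant on the dyadic shells around \<open>\<theta>\<close>.\<close>

lemma poisson_dyadic_bound:
  assumes r: "1/2 \<le> r" "r < 1" and s: "\<bar>t - \<theta>\<bar> \<le> 1" and J: "\<bar>t - \<theta>\<bar> \<le> 2 ^ J * (1 - r)"
  shows "poisson (of_real r * cis \<theta>) t \<le>
    (\<Sum>j\<le>J. 64 / (4 ^ j * (1 - r)) * indicator {\<theta> - 2 ^ j * (1 - r)..\<theta> + 2 ^ j * (1 - r)} t)"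
proof -
  define j where "j = (LEAST j. \<bar>t - \<theta>\<bar> \<le> 2 ^ j * (1 - r))"
  have j: "\<bar>t - \<theta>\<bar> \<le> 2 ^ j * (1 - r)" unfolding j_def by (rule LeastI[of _ J]) (rule J)
  have jJ: "j \<le> J" unfolding j_def by (rule Least_le) (rule J)
  have le: "poisson (of_real r * cis \<theta>) t \<le> 64 / (4 ^ j * (1 - r))"
  proof (cases j)
    case 0
    have "2 / (1 - r) \<le> 64 / (1 - r)" using r by (intro divide_right_mono) auto
    then show ?thesis using poisson_near_bound(1)[OF r s] 0 by simp
  next
    \<comment> \<open>Minimality of \<open>j\<close> puts \<open>t\<close> outside the shell
      \<open>i = j - 1\<close>, so the quadratic bound has denominator at least
      \<open>4 ^ i * (1 - r)\<^sup>2\<close>; passing from \<open>i\<close> to \<open>j\<close>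
      turns 16 into 64.\<close>
    case (Suc i)
    have "\<not> \<bar>t - \<theta>\<bar> \<le> 2 ^ i * (1 - r)"
      using not_less_Least[of i "\<lambda>j. \<bar>t - \<theta>\<bar> \<le> 2 ^ j * (1 - r)"] Suc by (simp add: j_def)
    then have i: "2 ^ i * (1 - r) < \<bar>t - \<theta>\<bar>" by simp
    then have ne: "t \<noteq> \<theta>" using r by (auto simp: mult_less_0_iff)
    have pos: "0 < 2 ^ i * (1 - r)" using r by simp
    have "(2 ^ i * (1 - r))\<^sup>2 \<le> \<bar>t - \<theta>\<bar>\<^sup>2" using i pos by (intro power_mono) auto
    then have sq: "4 ^ i * (1 - r)\<^sup>2 \<le> (t - \<theta>)\<^sup>2" 
      by (simp add: power_mult_distrib power_mult[symmetric] mult.commute[of i]) (simp add: power_mult)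
    have "poisson (of_real r * cis \<theta>) t \<le> 16 * (1 - r) / (t - \<theta>)\<^sup>2"
      by (rule poisson_near_bound(2)[OF r s ne])
    also have "\<dots> \<le> 16 * (1 - r) / (4 ^ i * (1 - r)\<^sup>2)"
      using sq r ne by (intro divide_left_mono mult_pos_pos) auto
    also have "\<dots> = 64 / (4 ^ j * (1 - r))" using r Suc by (simp add: power2_eq_square divide_simps)
    finally show ?thesis .
  qed
  have "t \<in> {\<theta> - 2 ^ j * (1 - r)..\<theta> + 2 ^ j * (1 - r)}" using j by (auto simp: abs_le_iff)
  then have "64 / (4 ^ j * (1 - r)) = 64 / (4 ^ j * (1 - r)) * indicator {\<theta> - 2 ^ j * (1 - r)..\<theta> + 2 ^ j * (1 - r)} t"
    by simp
  also have "\<dots> \<le> (\<Sum>j\<le>J. 64 / (4 ^ j * (1 - r)) * indicator {\<theta> - 2 ^ j * (1 - r)..\<theta> + 2 ^ j * (1 - r)} t)"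
    using jJ r by (intro member_le_sum) auto
  finally show ?thesis using le by linarith
qed

lemma dyadic_scale:
  fixes \<eta> \<delta> :: real
  assumes "0 < \<eta>" "\<eta> \<le> \<delta>"
  obtains J where "2 ^ J * \<eta> \<le> \<delta>" "\<delta> < 2 * (2 ^ J * \<eta>)"
proof -
  obtain n where "\<delta> / \<eta> < 2 ^ n" using real_arch_pow[of 2 "\<delta> / \<eta>"] by auto
  then have n: "\<delta> < 2 ^ n * \<eta>" using assms by (simp add: divide_less_eq)
  define N where "N = (LEAST n. \<delta> < 2 ^ n * \<eta>)"
  have N: "\<delta> < 2 ^ N * \<eta>" unfolding N_def by (rule LeastI[of _ n]) (rule n)
  then have "N \<noteq> 0" using assms by (cases N) auto
  then obtain J where J: "N = Suc J" by (cases N) auto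
  then have "\<not> \<delta> < 2 ^ J * \<eta>" using not_less_Least[of J "\<lambda>n. \<delta> < 2 ^ n * \<eta>"] by (simp add: N_def)
  with N J show ?thesis by (intro that[of J]) auto
qed

text \<open>The averages of \<open>v\<close> are small in windows of every small size, so the kernel
  is replaced by its dyadic majorant: shell \<open>j\<close> contributes at most
  \<open>64 / (4 ^ j * (1 - r)) * (e / 512 * (2 ^ j * (1 - r)))\<close>, a geometric series with sum
  at most \<open>e / 4\<close>. Away from \<open>\<theta>\<close> the kernel is of order
  \<open>1 - r\<close>.\<close>

lemma poisson_radial_limit_0:
  fixes v :: "real \<Rightarrow> real"
  assumes v: "integrable circ v" and v0: "\<And>t. 0 \<le> v t" and \<theta>: "0 < \<theta>" "\<theta> < 2 * pi"
    and leb: "\<And>e. 0 < e \<Longrightarrow> \<exists>d>0. \<forall>h. 0 < h \<and> h < d \<longrightarrow> (LINT t|circ. indicator {\<theta> - h..\<theta> + h} t * v t) \<le> e * h"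
  shows "((\<lambda>r. LINT t|circ. poisson (of_real r * cis \<theta>) t * v t) \<longlongrightarrow> 0) (at_left 1)"
proof (rule tendstoI)
  fix e :: real assume e: "0 < e"
  from e have "0 < e / 512" by simp
  from leb[OF this] obtain d where d: "0 < d"
    "\<forall>h. 0 < h \<and> h < d \<longrightarrow> (LINT t|circ. indicator {\<theta> - h..\<theta> + h} t * v t) \<le> e / 512 * h" by (elim exE conjE) (rule that)
  define \<delta> where "\<delta> = min d 1 / 2"
  have \<delta>: "0 < \<delta>" "\<delta> < d" "\<delta> < 1" using d(1) by (auto simp: \<delta>_def)
  obtain c where c: "0 < c" "\<And>r t. \<lbrakk>1/2 \<le> r; r < 1; t \<in> {0..2*pi}; \<delta>/2 \<le> \<bar>t - \<theta>\<bar>\<rbrakk> \<Longrightarrow> poisson (of_real r * cis \<theta>) t \<le> 2 * (1 - r) / c"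
    using poisson_far_bound[OF \<theta>, of "\<delta>/2"] \<delta> by (metis half_gt_zero)
  define V where "V = (LINT t|circ. v t)"
  have V0: "0 \<le> V" unfolding V_def using v0 by simp
  have bound: "(LINT t|circ. poisson (of_real r * cis \<theta>) t * v t) \<le> 2 * (1 - r) / c * V + e / 4"
    if r: "1/2 \<le> r" "r < 1" and r\<delta>: "1 - r \<le> \<delta>" for r
  proof -
    have n: "norm (of_real r * cis \<theta>) < 1" using r by (simp add: norm_mult)
    obtain J where J: "2 ^ J * (1 - r) \<le> \<delta>" "\<delta> < 2 * (2 ^ J * (1 - r))"
      using dyadic_scale[of "1 - r" \<delta>] r r\<delta> by auto
    let ?K = "\<lambda>j. {\<theta> - 2 ^ j * (1 - r)..\<theta> + 2 ^ j * (1 - r)}"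
    let ?S = "\<lambda>t. \<Sum>j\<le>J. 64 / (4 ^ j * (1 - r)) * (indicator (?K j) t * v t)"
    have S0: "0 \<le> ?S t" for t using r v0 by (intro sum_nonneg) auto
    have intK: "integrable circ (\<lambda>t. 64 / (4 ^ j * (1 - r)) * (indicator (?K j) t * v t))" for j
      using integral_circ_indicator[OF v, of "\<theta> - 2 ^ j * (1 - r)" "\<theta> + 2 ^ j * (1 - r)"] by simp
    have "(LINT t|circ. poisson (of_real r * cis \<theta>) t * v t) \<le> (LINT t|circ. 2 * (1 - r) / c * v t + ?S t)"
    proof (rule integral_mono)
      show "integrable circ (\<lambda>t. poisson (of_real r * cis \<theta>) t * v t)"
        using poisson_times_integrable[OF v n] by simp
      show "integrable circ (\<lambda>t. 2 * (1 - r) / c * v t + ?S t)"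
        using v intK by (intro Bochner_Integration.integrable_add Bochner_Integration.integrable_sum) auto
      fix t assume "t \<in> space circ"
      then have t: "t \<in> {0..2*pi}" by simp
      show "poisson (of_real r * cis \<theta>) t * v t \<le> 2 * (1 - r) / c * v t + ?S t"
      \<comment> \<open>Since \<open>\<delta> < 2 * (2 ^ J * (1 - r))\<close>, points within
        \<open>\<delta> / 2\<close> of \<open>\<theta>\<close> lie in the last shell; this is why
        the far bound was taken at \<open>\<delta> / 2\<close>.\<close>
      proof (cases "\<delta>/2 \<le> \<bar>t - \<theta>\<bar>")
        case True
        then have "poisson (of_real r * cis \<theta>) t * v t \<le> 2 * (1 - r) / c * v t"
          using c(2)[OF r t True] v0 by (intro mult_right_mono) auto
        then show ?thesis using S0[of t] by linarith
      next
        case False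
        have "poisson (of_real r * cis \<theta>) t * v t \<le> (\<Sum>j\<le>J. 64 / (4 ^ j * (1 - r)) * indicator (?K j) t) * v t"
          using poisson_dyadic_bound[OF r, of t \<theta> J] False J \<delta> v0[of t] by (intro mult_right_mono) auto
        also have "\<dots> = ?S t" by (simp add: sum_distrib_right mult.assoc)
        finally show ?thesis using r c(1) v0[of t] by (smt (verit) divide_nonneg_pos mult_nonneg_nonneg)
      qed
    qed
    also have "\<dots> = 2 * (1 - r) / c * V + (\<Sum>j\<le>J. 64 / (4 ^ j * (1 - r)) * (LINT t|circ. indicator (?K j) t * v t))"
      using v intK integral_circ_indicator[OF v] unfolding V_def
      by (subst Bochner_Integration.integral_add) (auto simp: Bochner_Integration.integral_sum)
    also have "(\<Sum>j\<le>J. 64 / (4 ^ j * (1 - r)) * (LINT t|circ. indicator (?K j) t * v t))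
        \<le> (\<Sum>j\<le>J. 64 / (4 ^ j * (1 - r)) * (e / 512 * (2 ^ j * (1 - r))))"
    proof (intro sum_mono mult_left_mono)
      fix j assume "j \<in> {..J}"
      then have "2 ^ j * (1 - r) \<le> 2 ^ J * (1 - r)" "0 < 2 ^ j * (1 - r)"
        using r by (auto intro!: mult_right_mono power_increasing)
      then show "(LINT t|circ. indicator (?K j) t * v t) \<le> e / 512 * (2 ^ j * (1 - r))"
        using d(2)[rule_format, of "2 ^ j * (1 - r)"] J(1) \<delta>(2) r by linarith
    qed (use r in auto)
    also have "\<dots> = e / 8 * (\<Sum>j\<le>J. (1/2) ^ j)"
    proof -
      have "64 / (4 ^ j * (1 - r)) * (e / 512 * (2 ^ j * (1 - r))) = e / 8 * (1/2) ^ j" for j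
      proof -
        have "(4::real) ^ j = 2 ^ j * 2 ^ j" by (simp flip: power_mult_distrib)
        then show ?thesis using r by (simp add: field_simps)
      qed
      then show ?thesis by (simp add: sum_distrib_left)
    qed
    also have "\<dots> \<le> e / 8 * 2"
    proof (intro mult_left_mono)
      have "(\<Sum>j\<le>J. (1/2::real) ^ j) \<le> (\<Sum>j. (1/2) ^ j)"
        by (rule sum_le_suminf) (auto simp: summable_geometric)
      then show "(\<Sum>j\<le>J. (1/2::real) ^ j) \<le> 2" by (simp add: suminf_geometric)
    qed (use e in auto)
    finally show ?thesis by simp
  qed
  have "((\<lambda>r. 2 * (1 - r) / c * V + e / 4) \<longlongrightarrow> 2 * (1 - 1) / c * V + e / 4) (at_left 1)"
    using c by (intro tendsto_intros) auto
  then have "\<forall>\<^sub>F r in at_left 1. 2 * (1 - r) / c * V + e / 4 < e / 2"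
    using e by (intro order_tendstoD) auto
  moreover have "\<forall>\<^sub>F r in at_left (1::real). r \<in> {max (1/2) (1 - \<delta>)<..<1}"
    using \<delta> by (intro eventually_at_left_real) auto
  ultimately show "\<forall>\<^sub>F r in at_left 1. dist (LINT t|circ. poisson (of_real r * cis \<theta>) t * v t) 0 < e"
  proof eventually_elim
    case (elim r)
    then have r: "1/2 \<le> r" "r < 1" "1 - r \<le> \<delta>" by auto
    have "0 \<le> (LINT t|circ. poisson (of_real r * cis \<theta>) t * v t)"
      using r v0 poisson_nonneg[of "of_real r * cis \<theta>"] by (intro Bochner_Integration.integral_nonneg) (auto simp: norm_mult)
    with bound[OF r] elim e show ?case by simp
  qed
qed

text \<open>The kernel has mass \<open>2 * pi\<close>, so subtracting the constant
  \<open>u \<theta>\<close> leaves the Poisson integral of a function whose norm has vanishing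
  averages at \<open>\<theta>\<close>.\<close>

theorem Fatou_poisson:
  fixes u :: "real \<Rightarrow> 'a::euclidean_space"
  assumes u: "integrable circ u"
  shows "AE \<theta> in circ. ((\<lambda>r. LINT t|circ. poisson (of_real r * cis \<theta>) t *\<^sub>R u t) \<longlongrightarrow> (2 * pi) *\<^sub>R u \<theta>) (at_left 1)"
  using AE_lebesgue_point[OF u] AE_circ_interior
proof eventually_elim
  case (elim \<theta>)
  interpret finite_measure circ by (rule finite_measure_circ)
  have iv: "integrable circ (\<lambda>t. u t - u \<theta>)" using u by simp
  have "((\<lambda>r. LINT t|circ. poisson (of_real r * cis \<theta>) t * norm (u t - u \<theta>)) \<longlongrightarrow> 0) (at_left 1)"
  proof (rule poisson_radial_limit_0[OF integrable_norm[OF iv] norm_ge_zero])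
    fix e :: real assume "0 < e"
    from elim(1)[unfolded lebesgue_point_def, THEN spec, THEN mp, OF this]
    show "\<exists>d>0. \<forall>h. 0 < h \<and> h < d \<longrightarrow> (LINT t|circ. indicator {\<theta> - h..\<theta> + h} t * norm (u t - u \<theta>)) \<le> e * h" .
  qed (use elim in auto)
  then have "((\<lambda>r. (LINT t|circ. poisson (of_real r * cis \<theta>) t *\<^sub>R u t) - (2 * pi) *\<^sub>R u \<theta>) \<longlongrightarrow> 0) (at_left 1)"
  proof (rule Lim_null_comparison[rotated])
    have "\<forall>\<^sub>F r in at_left (1::real). r \<in> {0<..<1}" by (intro eventually_at_left_real) auto
    then show "\<forall>\<^sub>F r in at_left (1::real). norm ((LINT t|circ. poisson (of_real r * cis \<theta>) t *\<^sub>R u t) - (2 * pi) *\<^sub>R u \<theta>)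
      \<le> (LINT t|circ. poisson (of_real r * cis \<theta>) t * norm (u t - u \<theta>))"
    proof eventually_elim
      case (elim r)
      then have n: "norm (of_real r * cis \<theta>) < 1" by (simp add: norm_mult)
      have "(LINT t|circ. poisson (of_real r * cis \<theta>) t *\<^sub>R u t) - (2 * pi) *\<^sub>R u \<theta>
          = (LINT t|circ. poisson (of_real r * cis \<theta>) t *\<^sub>R u t) - (LINT t|circ. poisson (of_real r * cis \<theta>) t *\<^sub>R u \<theta>)"
        using poisson_integral_1[OF n] poisson_times_integrable[of "\<lambda>_. 1::real", OF _ n] by simp
      also have "\<dots> = (LINT t|circ. poisson (of_real r * cis \<theta>) t *\<^sub>R (u t - u \<theta>))"
        unfolding scaleR_diff_right
        by (rule Bochner_Integration.integral_diff[symmetric, OF poisson_times_integrable[OF u n] poisson_times_integrable[OF integrable_const n]])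
      finally have eq: "(LINT t|circ. poisson (of_real r * cis \<theta>) t *\<^sub>R u t) - (2 * pi) *\<^sub>R u \<theta>
          = (LINT t|circ. poisson (of_real r * cis \<theta>) t *\<^sub>R (u t - u \<theta>))" .
      have "norm ((LINT t|circ. poisson (of_real r * cis \<theta>) t *\<^sub>R u t) - (2 * pi) *\<^sub>R u \<theta>)
        \<le> (LINT t|circ. norm (poisson (of_real r * cis \<theta>) t *\<^sub>R (u t - u \<theta>)))"
        unfolding eq by (rule integral_norm_bound)
      then show ?case using poisson_nonneg[OF n] by simp
    qed
  qed
  then show ?case by (simp add: LIM_zero_iff)
qed

section \<open>Radial limits of bounded holomorphic functions\<close>

lemma sphere_continuous_circ:
  fixes F :: "complex \<Rightarrow> complex"
  assumes F: "F holomorphic_on ball 0 1" and r: "0 \<le> r" "r < 1"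
  shows "continuous_on A (\<lambda>t. F (of_real r * cis t))"
  by (rule continuous_on_compose2[OF holomorphic_on_imp_continuous_on[OF F]])
    (use r in \<open>auto intro!: continuous_intros simp: norm_mult\<close>)

section \<open>Mean squares of dilates through Taylor coefficients\<close>

lemma circle_coefficient:
  fixes F :: "complex \<Rightarrow> complex"
  assumes F: "F holomorphic_on ball 0 1" and s: "0 < s" "s < 1"
  shows "(LINT t|circ. F (of_real s * cis t) / cis t ^ n) = 2 * pi * ((deriv ^^ n) F 0 / fact n) * of_real s ^ n"
proof -
  have sub: "cball 0 s \<subseteq> ball (0::complex) 1" using s by auto
  let ?a = "(deriv ^^ n) F 0 / fact n"
  have "((\<lambda>u. F u / (u - 0) ^ Suc n) has_contour_integral ((2 * pi * \<i>) / fact n * (deriv ^^ n) F 0)) (circlepath 0 s)"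
    using s sub ball_subset_cball[of "0::complex" s]
    by (intro Cauchy_has_contour_integral_higher_derivative_circlepath holomorphic_on_imp_continuous_on holomorphic_on_subset[OF F]) auto
  then have "((\<lambda>t. F (of_real s * cis t) / (of_real s * cis t) ^ Suc n * of_real s * \<i> * cis t) has_integral ((2 * pi * \<i>) / fact n * (deriv ^^ n) F 0)) {0..2*pi}"
    unfolding circlepath_def by (subst (asm) has_contour_integral_part_circlepath_iff) (auto simp: add_ac)
  from has_integral_mult_right[OF this, of "- \<i> * of_real s ^ n"]
  have "((\<lambda>t. - \<i> * of_real s ^ n * (F (of_real s * cis t) / (of_real s * cis t) ^ Suc n * of_real s * \<i> * cis t))
      has_integral - \<i> * of_real s ^ n * ((2 * pi * \<i>) / fact n * (deriv ^^ n) F 0)) {0..2*pi}" .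
  also have "(\<lambda>t. - \<i> * of_real s ^ n * (F (of_real s * cis t) / (of_real s * cis t) ^ Suc n * of_real s * \<i> * cis t))
    = (\<lambda>t. F (of_real s * cis t) / cis t ^ n)"
    using s by (intro ext) (simp add: power_mult_distrib field_simps)
  also have "- \<i> * of_real s ^ n * ((2 * pi * \<i>) / fact n * (deriv ^^ n) F 0) = 2 * pi * ?a * of_real s ^ n"
    by (simp add: field_simps)
  finally have I: "((\<lambda>t. F (of_real s * cis t) / cis t ^ n) has_integral 2 * pi * ?a * of_real s ^ n) {0..2*pi}" .
  have "continuous_on {0..2*pi} (\<lambda>t. F (of_real s * cis t) / cis t ^ n)"
    using s by (intro continuous_intros sphere_continuous_circ[OF F]) auto
  from lebesgue_integral_eq_integral[OF circ_integrable_cont[OF this]] integral_unique[OF I]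
  show ?thesis by simp
qed

text \<open>Parseval's identity: the power series of the first factor is integrated term by term,
  and each term picks out a Taylor coefficient of the second.\<close>

lemma circle_inner_sums:
  fixes F :: "complex \<Rightarrow> complex"
  assumes F: "F holomorphic_on ball 0 1" and r: "0 < r" "r < 1" and s: "0 < s" "s < 1"
  shows "(\<lambda>n. 2 * pi * (((deriv ^^ n) F 0 / fact n) * cnj ((deriv ^^ n) F 0 / fact n)) * of_real (r * s) ^ n) sums
    (LINT t|circ. F (of_real r * cis t) * cnj (F (of_real s * cis t)))"
proof -
  define a where "a n = (deriv ^^ n) F 0 / fact n" for n
  have ps: "(\<lambda>n. a n * w ^ n) sums F w" if "norm w < 1" for w
    using holomorphic_power_series[OF F, of w] that by (simp add: a_def)
  \<comment> \<open>Absolute convergence at radius \<open>r\<close> comes from convergence at the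
    larger radius \<open>(r + 1) / 2\<close>.\<close>
  have "summable (\<lambda>n. a n * of_real ((r + 1)/2) ^ n)"
    using r by (intro sums_summable[OF ps]) auto
  then have sum: "summable (\<lambda>n. norm (a n * of_real r ^ n))"
    by (rule powser_insidea) (use r in auto)
  obtain C where C: "\<And>t. t \<in> {0..2*pi} \<Longrightarrow> norm (F (of_real s * cis t)) \<le> C"
    by (rule compact_continuous_bound[OF compact_Icc sphere_continuous_circ[OF F]]) (use s that in auto)
  define f where "f n t = a n * (of_real r * cis t) ^ n * cnj (F (of_real s * cis t))" for n t
  have cf: "continuous_on {0..2*pi} (f n)" for n
    unfolding f_def using s by (intro continuous_intros sphere_continuous_circ[OF F]) auto
  have nf: "norm (f n t) \<le> norm (a n * of_real r ^ n) * C" if "t \<in> {0..2*pi}" for n t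
    unfolding f_def norm_mult norm_power using C[OF that] r by (auto intro!: mult_left_mono simp: norm_mult norm_power)
  have sums: "(\<lambda>n. f n t) sums (F (of_real r * cis t) * cnj (F (of_real s * cis t)))" for t
    unfolding f_def by (intro sums_mult2 ps) (use r in \<open>auto simp: norm_mult\<close>)
  have sumC: "summable (\<lambda>n. norm (a n * of_real r ^ n) * C)" using sum by (rule summable_mult2)
  have "(\<lambda>n. LINT t|circ. f n t) sums (LINT t|circ. (\<Sum>n. f n t))"
  proof (rule sums_integral)
    show "integrable circ (f n)" for n using cf by (rule circ_integrable_cont)
    show "AE t in circ. summable (\<lambda>n. norm (f n t))"
      by (intro AE_I2 summable_comparison_test'[OF sumC, of 0]) (use nf in auto)
    show "summable (\<lambda>n. LINT t|circ. norm (f n t))"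
    proof (rule summable_comparison_test'[OF summable_mult2[OF sumC, of "2*pi"], of 0])
      fix n
      have "(LINT t|circ. norm (f n t)) \<le> (LINT t|circ. norm (a n * of_real r ^ n) * C)"
        using nf by (intro integral_mono integrable_norm circ_integrable_cont[OF cf] circ_integrable_cont[OF continuous_on_const]) auto
      then show "norm (LINT t|circ. norm (f n t)) \<le> norm (a n * of_real r ^ n) * C * (2 * pi)"
        using measure_circ by (simp add: mult_ac)
    qed
  qed
  moreover have "(\<Sum>n. f n t) = F (of_real r * cis t) * cnj (F (of_real s * cis t))" for t
    using sums by (rule sums_unique[symmetric])
  moreover have "(LINT t|circ. f n t) = 2 * pi * (a n * cnj (a n)) * of_real (r * s) ^ n" for n
  proof -
    have "f n t = (a n * of_real r ^ n) * cnj (F (of_real s * cis t) / cis t ^ n)" for t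
    proof -
      have "cnj (inverse (cis t ^ n)) = cis t ^ n"
        by (simp add: cis_cnj flip: cis_inverse power_inverse)
      then show ?thesis by (simp add: f_def power_mult_distrib divide_inverse)
    qed
    then have "(LINT t|circ. f n t) = (a n * of_real r ^ n) * cnj (LINT t|circ. F (of_real s * cis t) / cis t ^ n)"
      by (simp only: integral_mult_right_zero Bochner_Integration.integral_cnj)
    then show ?thesis unfolding circle_coefficient[OF F s] by (simp add: a_def power_mult_distrib)
  qed
  ultimately show ?thesis by (simp add: a_def)
qed

text \<open>The series of the pairing depends on the radii through \<open>r * s\<close> alone, so
  both may be replaced by their geometric mean.\<close>

lemma circle_inner_eq:
  fixes F :: "complex \<Rightarrow> complex"
  assumes F: "F holomorphic_on ball 0 1" and r: "0 < r" "r < 1" and s: "0 < s" "s < 1"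
  shows "(LINT t|circ. F (of_real r * cis t) * cnj (F (of_real s * cis t))) =
    of_real (LINT t|circ. (norm (F (of_real (sqrt (r * s)) * cis t)))\<^sup>2)"
proof -
  have rs: "r * s < 1" using r s by (metis mult_strict_mono' mult.left_neutral less_le)
  then have q: "0 < sqrt (r * s)" "sqrt (r * s) < 1" using r s by auto
  have "(LINT t|circ. F (of_real r * cis t) * cnj (F (of_real s * cis t))) = 
    (LINT t|circ. F (of_real (sqrt (r * s)) * cis t) * cnj (F (of_real (sqrt (r * s)) * cis t)))"
    using sums_unique2[OF circle_inner_sums[OF F r s]] circle_inner_sums[OF F q q] r s by simp
  also have "\<dots> = (LINT t|circ. complex_of_real ((norm (F (of_real (sqrt (r * s)) * cis t)))\<^sup>2))"
    by (simp only: complex_norm_square)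
  finally show ?thesis by (simp only: integral_complex_of_real)
qed

text \<open>Hence the dilates of \<open>F\<close> are Cauchy in \<open>L\<^sup>2\<close> as soon as their norms converge.\<close>

lemma circle_L2_dist:
  fixes F :: "complex \<Rightarrow> complex"
  assumes F: "F holomorphic_on ball 0 1" and r: "0 < r" "r < 1" and s: "0 < s" "s < 1"
  defines "M \<equiv> \<lambda>x. LINT t|circ. (norm (F (of_real x * cis t)))\<^sup>2"
  shows "(LINT t|circ. (norm (F (of_real r * cis t) - F (of_real s * cis t)))\<^sup>2) = M r + M s - 2 * M (sqrt (r * s))"
proof -
  have c: "continuous_on {0..2*pi} (\<lambda>t. F (of_real r * cis t))" "continuous_on {0..2*pi} (\<lambda>t. F (of_real s * cis t))"
    using r s sphere_continuous_circ[OF F] by auto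
  have "(norm (a - b))\<^sup>2 = (norm a)\<^sup>2 + (norm b)\<^sup>2 - 2 * Re (a * cnj b)" for a b :: complex
    unfolding cmod_power2 by (simp add: power2_eq_square algebra_simps)
  then have "(LINT t|circ. (norm (F (of_real r * cis t) - F (of_real s * cis t)))\<^sup>2) =
    (LINT t|circ. (norm (F (of_real r * cis t)))\<^sup>2 + (norm (F (of_real s * cis t)))\<^sup>2 - 2 * Re (F (of_real r * cis t) * cnj (F (of_real s * cis t))))"
    by simp
  also have "\<dots> = M r + M s - 2 * (LINT t|circ. Re (F (of_real r * cis t) * cnj (F (of_real s * cis t))))"
  proof -
    have i: "integrable circ (\<lambda>t. (norm (F (of_real r * cis t)))\<^sup>2)" "integrable circ (\<lambda>t. (norm (F (of_real s * cis t)))\<^sup>2)"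
      "integrable circ (\<lambda>t. Re (F (of_real r * cis t) * cnj (F (of_real s * cis t))))"
      by (intro circ_integrable_cont continuous_intros c)+
    then show ?thesis unfolding M_def by (simp del: times_complex.sel)
  qed
  also have "(LINT t|circ. Re (F (of_real r * cis t) * cnj (F (of_real s * cis t)))) = Re (LINT t|circ. F (of_real r * cis t) * cnj (F (of_real s * cis t)))"
    by (intro integral_Re circ_integrable_cont continuous_intros c)
  finally show ?thesis by (simp add: circle_inner_eq[OF F r s] M_def)
qed

lemma circle_norm_integral_tendsto:
  fixes F :: "complex \<Rightarrow> complex"
  assumes F: "F holomorphic_on ball 0 1" and C: "\<And>z. norm z < 1 \<Longrightarrow> norm (F z) \<le> C"
    and m: "AE t in circ. ((\<lambda>r. norm (F (of_real r * cis t))) \<longlongrightarrow> m t) (at_left 1)" and mm: "m \<in> borel_measurable circ"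
  shows "((\<lambda>r. LINT t|circ. (norm (F (of_real r * cis t)))\<^sup>2) \<longlongrightarrow> (LINT t|circ. (m t)\<^sup>2)) (at_left 1)"
proof (rule tendsto_at_left_sequentially[of 0])
  fix S :: "nat \<Rightarrow> real" assume S: "\<And>n. S n < 1" "\<And>n. 0 < S n" "S \<longlonglongrightarrow> 1"
  have Sf: "filterlim S (at_left 1) sequentially"
    using S by (auto simp: filterlim_at intro!: always_eventually) (metis less_irrefl)
  show "(\<lambda>n. LINT t|circ. (norm (F (of_real (S n) * cis t)))\<^sup>2) \<longlonglongrightarrow> (LINT t|circ. (m t)\<^sup>2)"
  proof (rule integral_dominated_convergence)
    show "(\<lambda>t. (m t)\<^sup>2) \<in> borel_measurable circ" using mm by measurable
    show "(\<lambda>t. (norm (F (of_real (S n) * cis t)))\<^sup>2) \<in> borel_measurable circ" for n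
      using S by (intro circ_measurable_cont continuous_intros sphere_continuous_circ[OF F]) (auto simp: less_imp_le)
    show "integrable circ (\<lambda>_. C\<^sup>2)" by (intro circ_integrable_cont continuous_intros)
    show "AE t in circ. norm ((norm (F (of_real (S n) * cis t)))\<^sup>2) \<le> C\<^sup>2" for n
    proof (intro AE_I2)
      fix t
      have "norm (of_real (S n) * cis t) < 1" using S(1,2)[of n] by (simp add: norm_mult)
      from C[OF this] show "norm ((norm (F (of_real (S n) * cis t)))\<^sup>2) \<le> C\<^sup>2" by (simp add: power_mono)
    qed
    show "AE t in circ. (\<lambda>n. (norm (F (of_real (S n) * cis t)))\<^sup>2) \<longlonglongrightarrow> (m t)\<^sup>2"
      using m by eventually_elim (intro tendsto_power filterlim_compose[OF _ Sf], assumption)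
  qed
qed auto

text \<open>By monotone convergence the sum of the norms of the increments is finite almost
  everywhere, so the telescoping series converges absolutely there.\<close>

lemma AE_convergent_of_summable_L1:
  fixes f :: "nat \<Rightarrow> 'a \<Rightarrow> complex"
  assumes f: "\<And>n. integrable M (f n)" and s: "summable (\<lambda>n. LINT t|M. norm (f (Suc n) t - f n t))"
  shows "AE t in M. convergent (\<lambda>n. f n t)"
proof -
  let ?d = "\<lambda>n t. norm (f (Suc n) t - f n t)"
  have [measurable]: "f n \<in> borel_measurable M" for n using f by auto
  have "(\<integral>\<^sup>+t. (\<Sum>n. ennreal (?d n t)) \<partial>M) = (\<Sum>n. \<integral>\<^sup>+t. ennreal (?d n t) \<partial>M)"
    by (rule nn_integral_suminf) measurable
  also have "\<dots> = (\<Sum>n. ennreal (LINT t|M. ?d n t))"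
    using f by (subst nn_integral_eq_integral) auto
  also have "\<dots> < \<infinity>"
    using s by (subst suminf_ennreal2) auto
  finally have "AE t in M. (\<Sum>n. ennreal (?d n t)) \<noteq> \<infinity>"
    by (intro nn_integral_PInf_AE) auto
  then show ?thesis
  proof eventually_elim
    case (elim t)
    then have "summable (\<lambda>n. ?d n t)" by (intro summable_suminf_not_top) auto
    then have "summable (\<lambda>n. f (Suc n) t - f n t)" by (rule summable_norm_cancel)
    then have "convergent (\<lambda>n. \<Sum>k<n. f (Suc k) t - f k t)" by (simp add: summable_iff_convergent)
    then have "convergent (\<lambda>n. f n t - f 0 t)" using sum_lessThan_telescope[of "\<lambda>k. f k t"] by simp
    then have "convergent (\<lambda>n. f n t - f 0 t + f 0 t)" by (intro convergent_add convergent_const)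
    then show ?case by simp
  qed
qed

text \<open>Convergence of the modulus gives convergence of the mean squares, so the dilates are
  Cauchy in \<open>L2\<close>. A fast subsequence converges almost everywhere to some
  \<open>G\<close>, \<open>F\<close> is the Poisson integral of \<open>G\<close>, and Fatou's
  theorem for Poisson integrals returns limits along all radii. The hypothesis on the modulus is
  available for exponentials of Herglotz integrals, whose real parts are Poisson integrals.\<close>

theorem Fatou_bounded:
  fixes F :: "complex \<Rightarrow> complex"
  assumes F: "F holomorphic_on ball 0 1" and C: "\<And>z. norm z < 1 \<Longrightarrow> norm (F z) \<le> C"
    and m: "AE t in circ. ((\<lambda>r. norm (F (of_real r * cis t))) \<longlongrightarrow> m t) (at_left 1)" and mm: "m \<in> borel_measurable circ"
  shows "AE t in circ. \<exists>l. has_radial_limit F (cis t) l"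
proof -
  define M where "M x = (LINT t|circ. (norm (F (of_real x * cis t)))\<^sup>2)" for x
  define D where "D r s = (LINT t|circ. (norm (F (of_real r * cis t) - F (of_real s * cis t)))\<^sup>2)" for r s
  define L where "L = (LINT t|circ. (m t)\<^sup>2)"
  have Mlim: "(M \<longlongrightarrow> L) (at_left 1)"
    unfolding M_def L_def by (rule circle_norm_integral_tendsto[OF F C m mm])
  \<comment> \<open>Three values of \<open>M\<close> within \<open>e / 4\<close> of the limit leave
    at most \<open>e\<close> in \<open>M r + M s - 2 * M (sqrt (r * s))\<close>.\<close>
  have small: "\<exists>\<rho>. 0 < \<rho> \<and> \<rho> < 1 \<and> (\<forall>r s. \<rho> < r \<longrightarrow> r < 1 \<longrightarrow> \<rho> < s \<longrightarrow> s < 1 \<longrightarrow> D r s \<le> e)" if e: "0 < e" for e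
  proof -
    have "\<forall>\<^sub>F r in at_left 1. dist (M r) L < e / 4" using Mlim e by (intro tendstoD) auto
    then obtain b where b: "b < 1" "\<And>y. b < y \<Longrightarrow> y < 1 \<Longrightarrow> dist (M y) L < e / 4"
      by (subst (asm) eventually_at_left_field) auto
    define \<rho> where "\<rho> = max b (1/2)"
    have "D r s \<le> e" if rs: "\<rho> < r" "r < 1" "\<rho> < s" "s < 1" for r s
    proof -
      have 0: "0 < \<rho>" "\<rho> < 1" "b \<le> \<rho>" using b by (auto simp: \<rho>_def)
      have "\<rho> * \<rho> < r * s" using rs 0 by (intro mult_strict_mono) auto
      then have "sqrt (\<rho> * \<rho>) < sqrt (r * s)" by (rule real_sqrt_less_mono)
      then have q1: "\<rho> < sqrt (r * s)" using 0 by simp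
      have "r * s < 1 * 1" using rs 0 by (intro mult_strict_mono) auto
      then have "sqrt (r * s) < 1" by simp
      then have "dist (M r) L < e / 4" "dist (M s) L < e / 4" "dist (M (sqrt (r * s))) L < e / 4"
        using b(2) rs 0 q1 by auto
      moreover have "D r s = M r + M s - 2 * M (sqrt (r * s))"
        unfolding D_def M_def using rs 0 by (intro circle_L2_dist[OF F]) auto
      ultimately show ?thesis unfolding dist_real_def by linarith
    qed
    then show ?thesis using b by (intro exI[of _ \<rho>]) (auto simp: \<rho>_def)
  qed
  \<comment> \<open>The radii increase, so that the smallness of \<open>D s (R k)\<close> for
    \<open>s \<ge> R k\<close> applies to the next radius. The bound \<open>(1/4) ^ k\<close> is for
    squares and leaves order \<open>(1/2) ^ k\<close> in \<open>L1\<close>.\<close>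
  have "\<exists>R. \<forall>k::nat. (1 - 1 / (real k + 2) < R k \<and> R k < 1 \<and> (\<forall>s. R k \<le> s \<longrightarrow> s < 1 \<longrightarrow> D s (R k) \<le> (1/4) ^ k)) \<and> R k \<le> R (Suc k)"
  proof (rule dependent_nat_choice)
    have ex: "\<exists>y. 1 - 1 / (real k + 2) < y \<and> y < 1 \<and> (\<forall>s. y \<le> s \<longrightarrow> s < 1 \<longrightarrow> D s y \<le> (1/4) ^ k) \<and> x \<le> y" if x: "x < 1" for x and k :: nat
    proof -
      obtain \<rho> where \<rho>: "0 < \<rho>" "\<rho> < 1" "\<And>r s. \<rho> < r \<Longrightarrow> r < 1 \<Longrightarrow> \<rho> < s \<Longrightarrow> s < 1 \<Longrightarrow> D r s \<le> (1/4) ^ k"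
        using small[of "(1/4)^k"] by auto
      obtain y where "max (max \<rho> x) (1 - 1 / (real k + 2)) < y" "y < 1"
        using dense[of "max (max \<rho> x) (1 - 1 / (real k + 2))" 1] \<rho> x by auto
      then show ?thesis using \<rho> by (intro exI[of _ y]) auto
    qed
    show "\<exists>x. 1 - 1 / (real 0 + 2) < x \<and> x < 1 \<and> (\<forall>s. x \<le> s \<longrightarrow> s < 1 \<longrightarrow> D s x \<le> (1/4) ^ 0)"
      using ex[of 0 0, OF zero_less_one] by blast
    fix x and n :: nat
    assume "1 - 1 / (real n + 2) < x \<and> x < 1 \<and> (\<forall>s. x \<le> s \<longrightarrow> s < 1 \<longrightarrow> D s x \<le> (1/4) ^ n)"
    then show "\<exists>y. (1 - 1 / (real (Suc n) + 2) < y \<and> y < 1 \<and> (\<forall>s. y \<le> s \<longrightarrow> s < 1 \<longrightarrow> D s y \<le> (1/4) ^ Suc n)) \<and> x \<le> y"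
      using ex[of x "Suc n"] by blast
  qed
  then obtain R where R1: "\<And>k. 1 - 1 / (real k + 2) < R k" and R2: "\<And>k. R k < 1"
    and R3: "\<And>k s. R k \<le> s \<Longrightarrow> s < 1 \<Longrightarrow> D s (R k) \<le> (1/4) ^ k" and R4: "\<And>k. R k \<le> R (Suc k)"
    by blast
  have R0: "0 < R k" for k
  proof -
    have "1 / (real k + 2) \<le> 1" by simp
    then show ?thesis using R1[of k] by linarith
  qed
  have Rlim: "R \<longlonglongrightarrow> 1"
  proof (rule tendsto_sandwich)
    from tendsto_diff[OF tendsto_const[of 1] inverse_add_2_tendsto]
    show "(\<lambda>k. 1 - 1 / (real k + 2)) \<longlonglongrightarrow> 1" by simp
    show "(\<lambda>_. 1) \<longlonglongrightarrow> (1::real)" by simp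
  qed (use R1 R2 in \<open>auto intro!: always_eventually less_imp_le\<close>)
  have cont: "continuous_on {0..2*pi} (\<lambda>t. F (of_real (R k) * cis t))" for k
    using R0[of k] R2[of k] by (intro sphere_continuous_circ[OF F]) auto
  have nR: "norm (of_real (R k) * cis t) < 1" for k t using R0[of k] R2[of k] by (simp add: norm_mult)
  have "AE t in circ. convergent (\<lambda>k. F (of_real (R k) * cis t))"
  proof (rule AE_convergent_of_summable_L1)
    show "integrable circ (\<lambda>t. F (of_real (R k) * cis t))" for k by (rule circ_integrable_cont[OF cont])
    show "summable (\<lambda>k. LINT t|circ. norm (F (of_real (R (Suc k)) * cis t) - F (of_real (R k) * cis t)))"
    proof (rule summable_comparison_test'[of "\<lambda>k. (2 * pi + 1) * (1/2) ^ k" 0])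
      fix k :: nat
      let ?d = "\<lambda>t. norm (F (of_real (R (Suc k)) * cis t) - F (of_real (R k) * cis t))"
      have "(LINT t|circ. ?d t) \<le> (LINT t|circ. (1/2) ^ k + 2 ^ k * (?d t)\<^sup>2)"
      proof (intro integral_mono circ_integrable_cont continuous_intros cont)
        fix t
        \<comment> \<open>The elementary \<open>x \<le> 1 + x\<^sup>2\<close>, scaled by
          \<open>2 ^ k\<close>, does the work of the Cauchy-Schwarz inequality between
          \<open>L2\<close> and \<open>L1\<close>.\<close>
        define x where "x = 2 ^ k * ?d t"
        have "0 \<le> (x - 1)\<^sup>2 + x\<^sup>2 + 1" by simp
        then have "x \<le> 1 + x\<^sup>2" by (simp add: power2_eq_square algebra_simps)
        then have "x / 2 ^ k \<le> (1 + x\<^sup>2) / 2 ^ k" by (intro divide_right_mono) auto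
        then show "?d t \<le> (1/2) ^ k + 2 ^ k * (?d t)\<^sup>2" 
          by (simp add: x_def power2_eq_square add_divide_distrib power_one_over mult_ac)
      qed
      also have "\<dots> = (LINT t|circ. (1/2) ^ k) + (LINT t|circ. 2 ^ k * (?d t)\<^sup>2)"
        by (intro Bochner_Integration.integral_add circ_integrable_cont continuous_intros cont)
      also have "\<dots> = 2 * pi * (1/2) ^ k + 2 ^ k * D (R (Suc k)) (R k)"
        using measure_circ by (simp add: D_def)
      also have "\<dots> \<le> 2 * pi * (1/2) ^ k + 2 ^ k * (1/4) ^ k"
        using R3[OF R4 R2, of k] by (intro add_left_mono mult_left_mono) auto
      also have "\<dots> = (2 * pi + 1) * (1/2) ^ k" by (simp add: algebra_simps flip: power_mult_distrib)
      finally show "norm (LINT t|circ. ?d t) \<le> (2 * pi + 1) * (1/2) ^ k" by simp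
    qed (intro summable_mult summable_geometric, simp)
  qed
  then have lim: "AE t in circ. (\<lambda>k. F (of_real (R k) * cis t)) \<longlonglongrightarrow> lim (\<lambda>k. F (of_real (R k) * cis t))"
    by eventually_elim (simp add: convergent_LIMSEQ_iff)
  define G where "G t = lim (\<lambda>k. F (of_real (R k) * cis t))" for t
  have [measurable]: "G \<in> borel_measurable circ"
    unfolding G_def by (intro borel_measurable_lim_metric circ_measurable_cont cont)
  have GC: "AE t in circ. norm (G t) \<le> C"
    using lim
  proof eventually_elim
    case (elim t)
    show ?case unfolding G_def
      by (rule tendsto_upperbound[OF tendsto_norm[OF elim]]) (use C nR in auto)
  qed
  have intG: "integrable circ G" by (rule circ_integrable_bounded[OF _ GC]) measurable
  have rep: "(LINT t|circ. poisson z t *\<^sub>R G t) = 2 * pi * F z" if z: "norm z < 1" for z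
  proof (rule LIMSEQ_unique)
    show "(\<lambda>k. LINT t|circ. poisson z t *\<^sub>R F (of_real (R k) * cis t)) \<longlonglongrightarrow> (LINT t|circ. poisson z t *\<^sub>R G t)"
    proof (rule integral_dominated_convergence)
      have [measurable]: "poisson z \<in> borel_measurable circ" using z by (intro circ_measurable_cont poisson_continuous)
      show "(\<lambda>t. poisson z t *\<^sub>R G t) \<in> borel_measurable circ" by measurable
      show "(\<lambda>t. poisson z t *\<^sub>R F (of_real (R k) * cis t)) \<in> borel_measurable circ" for k
        by (intro circ_measurable_cont continuous_intros poisson_continuous z cont)
      show "integrable circ (\<lambda>t. poisson z t * C)"
        by (intro circ_integrable_cont continuous_intros poisson_continuous z)
      show "AE t in circ. norm (poisson z t *\<^sub>R F (of_real (R k) * cis t)) \<le> poisson z t * C" for k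
        using C[OF nR] poisson_nonneg[OF z] by (intro AE_I2) (auto intro!: mult_left_mono)
      show "AE t in circ. (\<lambda>k. poisson z t *\<^sub>R F (of_real (R k) * cis t)) \<longlonglongrightarrow> poisson z t *\<^sub>R G t"
        using lim unfolding G_def by eventually_elim (intro tendsto_intros)
    qed
    have "(LINT t|circ. poisson z t *\<^sub>R F (of_real (R k) * cis t)) = 2 * pi * F (of_real (R k) * z)" for k
      using R0[of k] R2[of k] by (intro circle_Poisson[OF dilation_holomorphic[OF F] _ z]) auto
    moreover have "(\<lambda>k. 2 * pi * F (of_real (R k) * z)) \<longlonglongrightarrow> 2 * pi * F z"
      by (intro tendsto_mult_left dilation_tendsto F z Rlim)
    ultimately show "(\<lambda>k. LINT t|circ. poisson z t *\<^sub>R F (of_real (R k) * cis t)) \<longlonglongrightarrow> 2 * pi * F z"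
      by simp
  qed
  show ?thesis
    using Fatou_poisson[OF intG]
  proof eventually_elim
    case (elim \<theta>)
    have "((\<lambda>r. (1 / (2 * pi)) *\<^sub>R (LINT t|circ. poisson (of_real r * cis \<theta>) t *\<^sub>R G t)) \<longlongrightarrow> (1 / (2 * pi)) *\<^sub>R ((2 * pi) *\<^sub>R G \<theta>)) (at_left 1)"
      by (intro tendsto_intros elim)
    moreover have "\<forall>\<^sub>F r in at_left (1::real). (1 / (2 * pi)) *\<^sub>R (LINT t|circ. poisson (of_real r * cis \<theta>) t *\<^sub>R G t) = F (of_real r * cis \<theta>)"
    proof -
      have "\<forall>\<^sub>F r in at_left (1::real). r \<in> {0<..<1}" by (intro eventually_at_left_real) auto
      then show ?thesis by eventually_elim (subst rep, auto simp: norm_mult scaleR_conv_of_real)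
    qed
    ultimately have "((\<lambda>r. F (of_real r * cis \<theta>)) \<longlongrightarrow> (1 / (2 * pi)) *\<^sub>R ((2 * pi) *\<^sub>R G \<theta>)) (at_left 1)"
      by (rule Lim_transform_eventually)
    then show ?case unfolding has_radial_limit_def by blast
  qed
qed

section \<open>Outer functions\<close>

text \<open>The holomorphic function on the disk whose real part is the Poisson integral of
  \<open>v\<close> and which is real at the origin.\<close>

definition herglotz :: "(real \<Rightarrow> real) \<Rightarrow> complex \<Rightarrow> complex" where
  "herglotz v z = of_real (1 / (2 * pi)) * (LINT t|circ. (cis t + z) / (cis t - z) * of_real (v t))"

lemma cis_diff_ge: "1 - norm z \<le> norm (cis t - z)"
  using norm_triangle_ineq2[of "cis t" z] by simp

lemma cis_neq: "norm z < 1 \<Longrightarrow> cis t \<noteq> z"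
  by (metis less_irrefl norm_cis)

lemma integrable_circ_mult_cont:
  fixes k u :: "real \<Rightarrow> complex"
  assumes k: "continuous_on {0..2*pi} k" and u: "integrable circ u"
  shows "integrable circ (\<lambda>t. k t * u t)"
proof -
  obtain C where C: "\<And>t. t \<in> {0..2*pi} \<Longrightarrow> norm (k t) \<le> C"
    using compact_continuous_bound[OF compact_Icc k] by blast
  have [measurable]: "k \<in> borel_measurable circ" "u \<in> borel_measurable circ"
    using k u by (auto intro: circ_measurable_cont)
  show ?thesis
  proof (rule Bochner_Integration.integrable_bound)
    show "integrable circ (\<lambda>t. C * norm (u t))" using u by auto
    show "AE t in circ. norm (k t * u t) \<le> norm (C * norm (u t))"
    proof (intro AE_I2)
      fix t assume "t \<in> space circ"
      then have "norm (k t) \<le> C" using C by simp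
      then have "norm (k t) * norm (u t) \<le> C * norm (u t)" by (rule mult_right_mono) simp
      then show "norm (k t * u t) \<le> norm (C * norm (u t))"
        unfolding norm_mult[of "k t"] real_norm_def by linarith
    qed
  qed measurable
qed

text \<open>The remainder of the difference quotient is an integral with \<open>w - z\<close> in
  front and all factors of the denominator at least \<open>d\<close> in modulus; \<open>d\<close>,
  half the distance of \<open>z\<close> to the circle, works for every \<open>w\<close> closer to
  \<open>z\<close> than \<open>d\<close>.\<close>

lemma cauchy_transform_holomorphic:
  fixes u :: "real \<Rightarrow> complex"
  assumes u: "integrable circ u"
  shows "(\<lambda>z. LINT t|circ. u t / (cis t - z)) holomorphic_on ball 0 1"
proof (subst holomorphic_on_open, simp, intro ballI)
  fix z :: complex assume "z \<in> ball 0 1"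
  then have z: "norm z < 1" by simp
  define d where "d = (1 - norm z) / 2"
  have d: "0 < d" using z by (simp add: d_def)
  have c1: "continuous_on {0..2*pi} (\<lambda>t. 1 / (cis t - w) ^ n)" if "norm w < 1" for w n
    using cis_neq[OF that] by (intro continuous_intros) auto
  have i1: "integrable circ (\<lambda>t. u t / (cis t - w))" if "norm w < 1" for w
    using integrable_circ_mult_cont[OF c1[OF that, of 1] u] by simp
  have i2: "integrable circ (\<lambda>t. u t / (cis t - z)\<^sup>2)"
    using integrable_circ_mult_cont[OF c1[OF z, of 2] u] by simp
  let ?F = "\<lambda>z. LINT t|circ. u t / (cis t - z)"
  let ?D = "LINT t|circ. u t / (cis t - z)\<^sup>2"
  define A where "A = (LINT t|circ. norm (u t))"
  have bound: "norm ((?F w - ?F z) / (w - z) - ?D) \<le> norm (w - z) / d ^ 3 * A"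
    if w: "w \<noteq> z" "norm (w - z) < d" for w
  proof -
    have nw: "norm w < 1" using w norm_triangle_ineq2[of w z] z by (simp add: d_def)
    have dz: "d \<le> norm (cis t - z)" for t using cis_diff_ge[of z t] z by (simp add: d_def)
    have dw: "d \<le> norm (cis t - w)" for t
      using cis_diff_ge[of z t] w norm_triangle_ineq2[of "cis t - z" "w - z"] by (simp add: d_def)
    have "(?F w - ?F z) / (w - z) - ?D = (LINT t|circ. (u t / (cis t - w) - u t / (cis t - z)) / (w - z) - u t / (cis t - z)\<^sup>2)"
      using i1[OF nw] i1[OF z] i2 by simp
    also have "\<dots> = (LINT t|circ. (w - z) * u t / ((cis t - w) * (cis t - z)\<^sup>2))"
    proof (intro Bochner_Integration.integral_cong refl)
      fix t
      have "cis t - w \<noteq> 0" "cis t - z \<noteq> 0" "w - z \<noteq> 0" using cis_neq[OF nw] cis_neq[OF z] w by auto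
      then show "(u t / (cis t - w) - u t / (cis t - z)) / (w - z) - u t / (cis t - z)\<^sup>2 = (w - z) * u t / ((cis t - w) * (cis t - z)\<^sup>2)"
        by (simp add: divide_simps) (simp add: algebra_simps power2_eq_square)
    qed
    also have "norm \<dots> \<le> (LINT t|circ. norm (w - z) / d ^ 3 * norm (u t))"
    proof (rule Bochner_Integration.integral_norm_bound_integral)
      show "integrable circ (\<lambda>t. norm (w - z) / d ^ 3 * norm (u t))" using u by auto
      have "continuous_on {0..2*pi} (\<lambda>t. (w - z) / ((cis t - w) * (cis t - z)\<^sup>2))"
        using cis_neq[OF nw] cis_neq[OF z] by (intro continuous_intros) auto
      from integrable_circ_mult_cont[OF this u]
      show "integrable circ (\<lambda>t. (w - z) * u t / ((cis t - w) * (cis t - z)\<^sup>2))" by simp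
      fix t
      have "d ^ 3 \<le> norm (cis t - w) * (norm (cis t - z))\<^sup>2"
        using dz[of t] dw[of t] d mult_mono[OF dw[of t] power_mono[OF dz[of t], of 2]] by (simp add: power3_eq_cube power2_eq_square)
      then have "norm (w - z) * norm (u t) / (norm (cis t - w) * (norm (cis t - z))\<^sup>2) \<le> norm (w - z) * norm (u t) / d ^ 3"
        using d dz[of t] dw[of t] by (intro divide_left_mono mult_pos_pos) auto
      then show "norm ((w - z) * u t / ((cis t - w) * (cis t - z)\<^sup>2)) \<le> norm (w - z) / d ^ 3 * norm (u t)"
        by (simp add: norm_divide norm_mult norm_power)
    qed
    finally show ?thesis by (simp add: A_def)
  qed
  have "((\<lambda>w. (?F w - ?F z) / (w - z) - ?D) \<longlongrightarrow> 0) (at z)"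
  proof (rule Lim_null_comparison)
    show "\<forall>\<^sub>F w in at z. norm ((?F w - ?F z) / (w - z) - ?D) \<le> norm (w - z) / d ^ 3 * A"
      using d bound by (auto simp: eventually_at dist_norm)
    have "((\<lambda>w. norm (w - z) / d ^ 3 * A) \<longlongrightarrow> norm (z - z) / d ^ 3 * A) (at z)"
      using d by (intro tendsto_intros) auto
    then show "((\<lambda>w. norm (w - z) / d ^ 3 * A) \<longlongrightarrow> 0) (at z)" by simp
  qed
  then have "(?F has_field_derivative ?D) (at z)"
    by (simp add: has_field_derivative_iff LIM_zero_iff)
  then show "\<exists>f'. (?F has_field_derivative f') (at z)" by blast
qed

lemma herglotz_kernel_cont: "norm z < 1 \<Longrightarrow> continuous_on A (\<lambda>t. (cis t + z) / (cis t - z))"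
  using cis_neq by (intro continuous_intros) auto

lemma herglotz_integrable:
  assumes "integrable circ v" "norm z < 1"
  shows "integrable circ (\<lambda>t. (cis t + z) / (cis t - z) * of_real (v t))"
  using assms by (intro integrable_circ_mult_cont herglotz_kernel_cont) auto

text \<open>The Herglotz kernel is \<open>2 * cis t / (cis t - z) - 1\<close>, a Cauchy kernel up to
  a constant.\<close>

lemma herglotz_holomorphic:
  assumes v: "integrable circ v"
  shows "herglotz v holomorphic_on ball 0 1"
proof -
  have i: "integrable circ (\<lambda>t. 2 * cis t * complex_of_real (v t))"
    using v by (intro integrable_circ_mult_cont continuous_intros) auto
  have "(\<lambda>z. of_real (1 / (2 * pi)) * ((LINT t|circ. 2 * cis t * of_real (v t) / (cis t - z)) - (LINT t|circ. complex_of_real (v t)))) holomorphic_on ball 0 1"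
    by (intro holomorphic_intros cauchy_transform_holomorphic i)
  also have "?this \<longleftrightarrow> ?thesis"
  proof (rule holomorphic_cong[OF refl])
    fix z :: complex assume "z \<in> ball 0 1"
    then have z: "norm z < 1" by simp
    have "continuous_on {0..2*pi} (\<lambda>t. 2 * cis t / (cis t - z))"
      using cis_neq[OF z] by (intro continuous_intros) auto
    from integrable_circ_mult_cont[OF this, of "\<lambda>t. of_real (v t)"] v
    have i2: "integrable circ (\<lambda>t. 2 * cis t * of_real (v t) / (cis t - z))" by simp
    have "(LINT t|circ. 2 * cis t * of_real (v t) / (cis t - z)) - (LINT t|circ. complex_of_real (v t))
      = (LINT t|circ. 2 * cis t * of_real (v t) / (cis t - z) - complex_of_real (v t))"
      using i2 v by (subst Bochner_Integration.integral_diff) auto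
    also have "\<dots> = (LINT t|circ. (cis t + z) / (cis t - z) * of_real (v t))"
      using cis_neq[OF z] by (intro Bochner_Integration.integral_cong refl) (simp add: divide_simps, simp add: algebra_simps)
    finally show "of_real (1 / (2 * pi)) * ((LINT t|circ. 2 * cis t * of_real (v t) / (cis t - z)) - (LINT t|circ. complex_of_real (v t))) = herglotz v z"
      by (simp add: herglotz_def)
  qed
  finally show ?thesis .
qed

lemma Re_herglotz_eq:
  assumes v: "integrable circ v" and z: "norm z < 1"
  shows "Re (herglotz v z) = (LINT t|circ. poisson z t * v t) / (2 * pi)"
proof -
  have R: "Re (w * of_real x) = Re w * x" "Re (of_real x * w) = x * Re w" for w x by simp_all
  have "Re (herglotz v z) = 1 / (2 * pi) * Re (LINT t|circ. (cis t + z) / (cis t - z) * of_real (v t))"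
    unfolding herglotz_def by (rule R(2))
  also have "Re (LINT t|circ. (cis t + z) / (cis t - z) * of_real (v t)) = (LINT t|circ. Re ((cis t + z) / (cis t - z) * of_real (v t)))"
    using herglotz_integrable[OF assms] by (rule integral_Re[symmetric])
  also have "\<dots> = (LINT t|circ. poisson z t * v t)"
    unfolding R(1) Re_herglotz ..
  finally show ?thesis by simp
qed

lemma herglotz_radial_Re:
  assumes v: "integrable circ v"
  shows "AE t in circ. ((\<lambda>r. Re (herglotz v (of_real r * cis t))) \<longlongrightarrow> v t) (at_left 1)"
  using Fatou_poisson[OF v]
proof eventually_elim
  case (elim \<theta>)
  have "((\<lambda>r. (LINT t|circ. poisson (of_real r * cis \<theta>) t * v t) / (2 * pi)) \<longlongrightarrow> (2 * pi * v \<theta>) / (2 * pi)) (at_left 1)"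
    using elim by (intro tendsto_intros) auto
  moreover have "\<forall>\<^sub>F r in at_left (1::real). (LINT t|circ. poisson (of_real r * cis \<theta>) t * v t) / (2 * pi) = Re (herglotz v (of_real r * cis \<theta>))"
  proof -
    have "\<forall>\<^sub>F r in at_left (1::real). r \<in> {0<..<1}" by (intro eventually_at_left_real) auto
    then show ?thesis by eventually_elim (subst Re_herglotz_eq[OF v], auto simp: norm_mult)
  qed
  ultimately have "((\<lambda>r. Re (herglotz v (of_real r * cis \<theta>))) \<longlongrightarrow> (2 * pi * v \<theta>) / (2 * pi)) (at_left 1)"
    by (rule Lim_transform_eventually)
  then show ?case by simp
qed

text \<open>A nonnegative \<open>v\<close> gives the Herglotz integral a nonnegative real part and
  the exponential a bound 1; the modulus of the latter has radial limits because the real part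
  has.\<close>

lemma herglotz_exp_radial:
  assumes v: "integrable circ v" and v0: "\<And>t. 0 \<le> v t"
  shows "AE t in circ. \<exists>l. has_radial_limit (\<lambda>z. exp (- herglotz v z)) (cis t) l \<and> norm l = exp (- v t)"
proof -
  have lim: "AE t in circ. ((\<lambda>r. norm (exp (- herglotz v (of_real r * cis t)))) \<longlongrightarrow> exp (- v t)) (at_left 1)"
    using herglotz_radial_Re[OF v] by eventually_elim (auto intro!: tendsto_intros)
  have "AE t in circ. \<exists>l. has_radial_limit (\<lambda>z. exp (- herglotz v z)) (cis t) l"
  proof (rule Fatou_bounded[OF _ _ lim])
    show "(\<lambda>z. exp (- herglotz v z)) holomorphic_on ball 0 1"
      by (intro holomorphic_intros herglotz_holomorphic v)
    show "norm (exp (- herglotz v z)) \<le> 1" if "norm z < 1" for z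
    proof -
      have "0 \<le> (LINT t|circ. poisson z t * v t)"
        using v0 poisson_nonneg[OF that] by (intro Bochner_Integration.integral_nonneg) auto
      then have "0 \<le> Re (herglotz v z)" unfolding Re_herglotz_eq[OF v that] by simp
      then show ?thesis by simp
    qed
    have [measurable]: "v \<in> borel_measurable circ" using v by simp
    show "(\<lambda>t. exp (- v t)) \<in> borel_measurable circ" by measurable
  qed
  with lim show ?thesis
  proof eventually_elim
    case (elim t)
    then obtain l where l: "has_radial_limit (\<lambda>z. exp (- herglotz v z)) (cis t) l" by blast
    from tendsto_norm[OF l[unfolded has_radial_limit_def]] elim(1) have "norm l = exp (- v t)"
      by (intro tendsto_unique[where F = "at_left (1::real)"]) auto
    with l show ?case by blast
  qed
qed

text \<open>Positive and negative parts of \<open>v\<close> write \<open>g\<close> as a quotient of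
  two bounded functions; the limit of the denominator has modulus \<open>exp (- vp t)\<close> and
  cannot vanish.\<close>

theorem outer_radial_limit:
  fixes v :: "real \<Rightarrow> real"
  assumes v: "integrable circ v" and c: "norm c = 1"
    and g: "\<And>z. norm z < 1 \<Longrightarrow> g z = c * exp (herglotz v z)"
  shows "AE t in circ. \<exists>l. has_radial_limit g (cis t) l \<and> norm l = exp (v t)"
proof -
  define vp vn where "vp t = max (v t) 0" and "vn t = max (- v t) 0" for t
  have ip: "integrable circ vp" and "in": "integrable circ vn"
    unfolding vp_def vn_def using v by (auto intro!: integrable_max)
  have vd: "v t = vp t - vn t" for t by (simp add: vp_def vn_def)
  have "AE t in circ. \<exists>l. has_radial_limit (\<lambda>z. exp (- herglotz vp z)) (cis t) l \<and> norm l = exp (- vp t)"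
    by (rule herglotz_exp_radial[OF ip]) (simp add: vp_def)
  moreover have "AE t in circ. \<exists>l. has_radial_limit (\<lambda>z. exp (- herglotz vn z)) (cis t) l \<and> norm l = exp (- vn t)"
    by (rule herglotz_exp_radial[OF "in"]) (simp add: vn_def)
  ultimately show ?thesis
  proof eventually_elim
    case (elim t)
    obtain l1 where l1: "has_radial_limit (\<lambda>z. exp (- herglotz vp z)) (cis t) l1" "norm l1 = exp (- vp t)" using elim(1) by blast
    obtain l2 where l2: "has_radial_limit (\<lambda>z. exp (- herglotz vn z)) (cis t) l2" "norm l2 = exp (- vn t)" using elim(2) by blast
    have "l1 \<noteq> 0" using l1(2) by auto
    then have "((\<lambda>r. c * (exp (- herglotz vn (of_real r * cis t)) / exp (- herglotz vp (of_real r * cis t)))) \<longlongrightarrow> c * (l2 / l1)) (at_left 1)"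
      using l1(1) l2(1) unfolding has_radial_limit_def by (intro tendsto_intros)
    moreover have "\<forall>\<^sub>F r in at_left (1::real). c * (exp (- herglotz vn (of_real r * cis t)) / exp (- herglotz vp (of_real r * cis t))) = g (of_real r * cis t)"
    proof -
      have "\<forall>\<^sub>F r in at_left (1::real). r \<in> {0<..<1}" by (intro eventually_at_left_real) auto
      then show ?thesis
      proof eventually_elim
        case (elim r)
        then have z: "norm (of_real r * cis t) < 1" by (simp add: norm_mult)
        have "herglotz v (of_real r * cis t) = herglotz vp (of_real r * cis t) - herglotz vn (of_real r * cis t)"
          unfolding herglotz_def vd using herglotz_integrable[OF ip z] herglotz_integrable[OF "in" z]
          by (simp add: of_real_diff right_diff_distrib)
        moreover have "exp (- b) / exp (- a) = exp (a - b)" for a b :: complex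
          by (simp flip: exp_diff)
        ultimately show ?case using g[OF z] by simp
      qed
    qed
    ultimately have "has_radial_limit g (cis t) (c * (l2 / l1))"
      unfolding has_radial_limit_def by (rule Lim_transform_eventually)
    moreover have "norm (c * (l2 / l1)) = exp (v t)"
    proof -
      have "norm (c * (l2 / l1)) = exp (- vn t) / exp (- vp t)"
        by (simp only: norm_mult norm_divide c l1(2) l2(2) mult_1_left)
      then show ?thesis by (simp add: vd flip: exp_diff)
    qed
    ultimately show ?case by blast
  qed
qed

section \<open>Boundary values\<close>

text \<open>The offset 2 keeps every radius positive, \<open>rad 0\<close> being
  \<open>1 / 2\<close>.\<close>

definition rad :: "nat \<Rightarrow> real" where "rad n = 1 - 1 / (real n + 2)"

lemma rad_pos: "0 < rad n" and rad_less: "rad n < 1"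
  by (simp_all add: rad_def)

lemma norm_rad_cis: "norm (of_real (rad n) * cis t) = rad n"
  using rad_pos[of n] by (simp add: norm_mult)

lemma rad_tendsto: "rad \<longlonglongrightarrow> 1"
proof -
  from tendsto_diff[OF tendsto_const[of 1] inverse_add_2_tendsto]
  show ?thesis by (simp add: rad_def[abs_def])
qed

lemma rad_at_left: "filterlim rad (at_left 1) sequentially"
  using rad_tendsto rad_less by (auto simp: filterlim_at intro!: always_eventually) (metis less_irrefl)

text \<open>Taken along a fixed sequence of radii, so that it is measurable as a sequential limit of
  continuous functions; it agrees with the radial limit wherever that exists.\<close>

definition boundary_value :: "(complex \<Rightarrow> complex) \<Rightarrow> real \<Rightarrow> complex" where
  "boundary_value F t = lim (\<lambda>n. F (of_real (rad n) * cis t))"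

lemma radial_limit_seq:
  assumes "has_radial_limit F (cis t) l"
  shows "(\<lambda>n. F (of_real (rad n) * cis t)) \<longlonglongrightarrow> l"
  using filterlim_compose[OF assms[unfolded has_radial_limit_def] rad_at_left] .

lemma boundary_value_eq:
  assumes "has_radial_limit F (cis t) l"
  shows "boundary_value F t = l"
  unfolding boundary_value_def using radial_limit_seq[OF assms] by (rule limI)

lemma rad_continuous:
  fixes F :: "complex \<Rightarrow> complex"
  assumes F: "F holomorphic_on ball 0 1"
  shows "continuous_on A (\<lambda>t. F (of_real (rad n) * cis t))"
  using rad_pos[of n] rad_less[of n] by (intro sphere_continuous_circ[OF F]) auto

lemma boundary_value_measurable:
  assumes F: "F holomorphic_on ball 0 1"
  shows "boundary_value F \<in> borel_measurable circ"
  unfolding boundary_value_def by (intro borel_measurable_lim_metric circ_measurable_cont rad_continuous F)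

definition has_boundary_values :: "(complex \<Rightarrow> complex) \<Rightarrow> bool" where
  "has_boundary_values F \<longleftrightarrow> (AE t in circ. \<exists>l. has_radial_limit F (cis t) l)"

lemma has_boundary_values_lim:
  assumes "has_boundary_values F"
  shows "AE t in circ. has_radial_limit F (cis t) (boundary_value F t)"
  using assms unfolding has_boundary_values_def by eventually_elim (auto simp: boundary_value_eq)

section \<open>Poisson extensions: convergence in mean and Jensen's inequality\<close>

lemma circle_integral_herglotz:
  assumes W: "integrable circ W" and r: "0 < r" "r < 1"
  shows "(LINT t|circ. Re (herglotz W (of_real r * cis t))) = (LINT t|circ. W t)"
proof -
  from circle_mean[OF dilation_holomorphic[OF herglotz_holomorphic[OF W] r(1)]] r have "(LINT t|circ. herglotz W (of_real r * cis t)) = 2 * pi * herglotz W 0" by simp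
  also have "herglotz W 0 = of_real ((LINT t|circ. W t) / (2 * pi))"
    by (simp add: herglotz_def)
  finally have "(LINT t|circ. herglotz W (of_real r * cis t)) = of_real (LINT t|circ. W t)" by simp
  then have "Re (LINT t|circ. herglotz W (of_real r * cis t)) = (LINT t|circ. W t)" by simp
  then show ?thesis
    using r by (subst integral_Re) (auto intro!: circ_integrable_cont sphere_continuous_circ herglotz_holomorphic W)
qed

text \<open>Scheffe's lemma: the extensions are nonnegative, converge almost everywhere, and have
  the same integral on every circle by the mean value property.\<close>

lemma herglotz_L1_tendsto:
  assumes W: "integrable circ W" and W0: "\<And>t. 0 \<le> W t"
  shows "(\<lambda>n. LINT t|circ. \<bar>Re (herglotz W (of_real (rad n) * cis t)) - W t\<bar>) \<longlonglongrightarrow> 0"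
proof -
  let ?W = "\<lambda>n t. Re (herglotz W (of_real (rad n) * cis t))"
  have int: "integrable circ (?W n)" for n
    by (intro circ_integrable_cont continuous_intros rad_continuous herglotz_holomorphic W)
  have pos: "0 \<le> ?W n t" for n t
  proof -
    have z: "norm (of_real (rad n) * cis t) < 1" by (simp add: norm_rad_cis rad_less)
    show ?thesis unfolding Re_herglotz_eq[OF W z]
      using W0 poisson_nonneg[OF z] by (intro divide_nonneg_pos Bochner_Integration.integral_nonneg) auto
  qed
  have [measurable]: "W \<in> borel_measurable circ" "?W n \<in> borel_measurable circ" for n using W int by auto
  have "(\<lambda>n. \<integral>\<^sup>+t. norm (?W n t - W t) \<partial>circ) \<longlonglongrightarrow> 0"
  proof (rule Scheffe_lemma2)
    show "AE t in circ. (\<lambda>n. ?W n t) \<longlonglongrightarrow> W t"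
      using herglotz_radial_Re[OF W] by eventually_elim (rule filterlim_compose[OF _ rad_at_left])
    fix n
    have "(\<integral>\<^sup>+t. norm (?W n t) \<partial>circ) = ennreal (LINT t|circ. ?W n t)"
      using pos int by (subst nn_integral_eq_integral) auto
    also have "(LINT t|circ. ?W n t) = (LINT t|circ. W t)"
      by (rule circle_integral_herglotz[OF W rad_pos rad_less])
    also have "ennreal \<dots> = (\<integral>\<^sup>+t. norm (W t) \<partial>circ)"
      using W0 W by (subst nn_integral_eq_integral) auto
    finally show "(\<integral>\<^sup>+t. norm (?W n t) \<partial>circ) \<le> (\<integral>\<^sup>+t. norm (W t) \<partial>circ)" by simp
  qed (use W in auto)
  moreover have "(\<integral>\<^sup>+t. norm (?W n t - W t) \<partial>circ) = ennreal (LINT t|circ. \<bar>?W n t - W t\<bar>)" for n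
    using W int by (subst nn_integral_eq_integral) auto
  ultimately have "(\<lambda>n. ennreal (LINT t|circ. \<bar>?W n t - W t\<bar>)) \<longlonglongrightarrow> ennreal 0" by simp
  then show ?thesis by (subst (asm) tendsto_ennreal_iff) auto
qed

text \<open>Jensen's inequality for the probability density \<open>poisson z t / (2 * pi)\<close>,
  by integrating the tangent line of \<open>exp\<close> at the mean \<open>m\<close>.\<close>

lemma herglotz_jensen:
  assumes v: "integrable circ v" and W: "integrable circ (\<lambda>t. exp (v t))" and z: "norm z < 1"
  shows "exp (Re (herglotz v z)) \<le> Re (herglotz (\<lambda>t. exp (v t)) z)"
proof -
  define m where "m = Re (herglotz v z)"
  have m: "(LINT t|circ. poisson z t * v t) = 2 * pi * m" unfolding m_def Re_herglotz_eq[OF v z] by simp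
  have iP: "integrable circ (poisson z)" by (intro circ_integrable_cont poisson_continuous z)
  have iv: "integrable circ (\<lambda>t. poisson z t * v t)" using poisson_times_integrable[OF v z] by simp
  have "2 * pi * exp m = exp m * (1 - m) * (LINT t|circ. poisson z t) + exp m * (LINT t|circ. poisson z t * v t)"
    unfolding m poisson_integral_1[OF z] by (simp add: algebra_simps)
  also have "\<dots> = (LINT t|circ. exp m * (1 - m) * poisson z t + exp m * (poisson z t * v t))"
    using iP iv by simp
  also have "\<dots> \<le> (LINT t|circ. poisson z t * exp (v t))"
  proof (rule integral_mono)
    show "integrable circ (\<lambda>t. exp m * (1 - m) * poisson z t + exp m * (poisson z t * v t))" using iP iv by simp
    show "integrable circ (\<lambda>t. poisson z t * exp (v t))" using poisson_times_integrable[OF W z] by simp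
    fix t
    have "exp m * (1 + (v t - m)) \<le> exp m * exp (v t - m)"
      by (intro mult_left_mono exp_ge_add_one_self) auto
    also have "\<dots> = exp (v t)" by (simp flip: exp_add)
    finally have "poisson z t * (exp m * (1 + (v t - m))) \<le> poisson z t * exp (v t)"
      using poisson_nonneg[OF z] by (intro mult_left_mono) auto
    then show "exp m * (1 - m) * poisson z t + exp m * (poisson z t * v t) \<le> poisson z t * exp (v t)"
      by (simp add: algebra_simps)
  qed
  finally show ?thesis unfolding Re_herglotz_eq[OF W z] m_def[symmetric] by (simp add: field_simps)
qed

text \<open>According to which of \<open>y\<close> and \<open>x powr (p - 1)\<close> is smaller, the
  product is bounded by one of the two powers. The sharp factors \<open>1 / p\<close> and
  \<open>(p - 1) / p\<close> are replaced by 1.\<close>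

lemma young_crude:
  fixes x y p :: real
  assumes "1 < p" "0 \<le> x" "0 \<le> y"
  shows "x * y \<le> x powr p + y powr (p / (p - 1))"
proof (cases "x = 0 \<or> y = 0")
  case False
  then have pos: "0 < x" "0 < y" using assms by auto
  show ?thesis
  proof (cases "y \<le> x powr (p - 1)")
    case True
    then have "x * y \<le> x powr 1 * x powr (p - 1)" using pos by (auto intro: mult_left_mono)
    also have "\<dots> = x powr (1 + (p - 1))" by (rule powr_add[symmetric])
    also have "1 + (p - 1) = p" by simp
    finally show ?thesis by (smt (verit) powr_ge_zero)
  next
    case False
    then have "(x powr (p - 1)) powr (1 / (p - 1)) \<le> y powr (1 / (p - 1))"
      using assms by (intro powr_mono2) auto
    then have "x \<le> y powr (1 / (p - 1))" using assms pos by (simp add: powr_powr)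
    then have "x * y \<le> y powr (1 / (p - 1)) * y powr 1" using pos by (auto intro: mult_right_mono)
    also have "\<dots> = y powr (1 / (p - 1) + 1)" by (rule powr_add[symmetric])
    also have "1 / (p - 1) + 1 = p / (p - 1)" using assms by (simp add: field_simps)
    finally show ?thesis by (smt (verit) powr_ge_zero)
  qed
qed auto

lemma integral_mean_eq:
  assumes F: "F holomorphic_on ball 0 1" and r: "0 \<le> r" "r < 1" and p: "0 < p"
  shows "integrable circ (\<lambda>t. norm (F (of_real r * cis t)) powr p)"
    and "(LINT t|circ. norm (F (of_real r * cis t)) powr p) = 2 * pi * integral_mean p F r"
proof -
  show i: "integrable circ (\<lambda>t. norm (F (of_real r * cis t)) powr p)"
    using p r by (intro circ_integrable_cont continuous_on_powr' continuous_intros sphere_continuous_circ[OF F]) auto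
  show "(LINT t|circ. norm (F (of_real r * cis t)) powr p) = 2 * pi * integral_mean p F r"
    using lebesgue_integral_eq_integral[OF i] by (simp add: integral_mean_def)
qed

lemma circ_Fatou_L1:
  fixes f :: "nat \<Rightarrow> real \<Rightarrow> complex"
  assumes f: "\<And>n. integrable circ (f n)" and lim: "AE t in circ. (\<lambda>n. f n t) \<longlonglongrightarrow> h t"
    and h [measurable]: "h \<in> borel_measurable circ" and C: "\<And>n. (LINT t|circ. norm (f n t)) \<le> C"
  shows "integrable circ h" "(LINT t|circ. norm (h t)) \<le> C"
proof -
  have [measurable]: "f n \<in> borel_measurable circ" for n using f by auto
  have C0: "0 \<le> C" using C[of 0] by (rule order_trans[rotated]) simp
  have "(\<integral>\<^sup>+t. norm (h t) \<partial>circ) = (\<integral>\<^sup>+t. liminf (\<lambda>n. ennreal (norm (f n t))) \<partial>circ)"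
  proof (rule nn_integral_cong_AE)
    show "AE t in circ. ennreal (norm (h t)) = liminf (\<lambda>n. ennreal (norm (f n t)))"
      using lim
    proof eventually_elim
      case (elim t)
      then have "(\<lambda>n. ennreal (norm (f n t))) \<longlonglongrightarrow> ennreal (norm (h t))"
        by (intro tendsto_ennrealI tendsto_norm)
      then show ?case by (rule lim_imp_Liminf[OF trivial_limit_sequentially, symmetric])
    qed
  qed
  also have "\<dots> \<le> liminf (\<lambda>n. \<integral>\<^sup>+t. ennreal (norm (f n t)) \<partial>circ)"
    by (rule nn_integral_liminf) measurable
  also have "\<dots> \<le> liminf (\<lambda>n. ennreal C)"
  proof (rule Liminf_mono[OF always_eventually], rule allI)
    fix n
    have "(\<integral>\<^sup>+t. ennreal (norm (f n t)) \<partial>circ) = ennreal (LINT t|circ. norm (f n t))"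
      using f by (subst nn_integral_eq_integral) auto
    also have "\<dots> \<le> ennreal C" using C by (rule ennreal_leI)
    finally show "(\<integral>\<^sup>+t. ennreal (norm (f n t)) \<partial>circ) \<le> ennreal C" .
  qed
  finally have le: "(\<integral>\<^sup>+t. norm (h t) \<partial>circ) \<le> ennreal C" by (simp add: Liminf_const)
  then have "(\<integral>\<^sup>+t. norm (h t) \<partial>circ) < \<infinity>" using le_less_trans ennreal_less_top by fastforce
  with h show i: "integrable circ h" by (intro integrableI_bounded)
  then have "ennreal (LINT t|circ. norm (h t)) \<le> ennreal C"
    using le by (subst (asm) nn_integral_eq_integral) auto
  then show "(LINT t|circ. norm (h t)) \<le> C" using C0 by (simp add: ennreal_le_iff)
qed

section \<open>Convergence to the boundary values in mean\<close>

text \<open>The weight \<open>|g|\<^sup>p\<close> enters only through \<open>W = |g|\<^sup>-\<^sup>q\<close> on the circle, where \<open>q = p / (p - 1)\<close>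
  and \<open>v = ln |g|\<close> there.\<close>

locale outer_weight =
  fixes p :: real and g :: "complex \<Rightarrow> complex" and c :: complex and v :: "real \<Rightarrow> real"
  assumes p: "1 < p" and g_holomorphic: "g holomorphic_on ball 0 1"
    and v: "integrable circ v" and norm_c: "norm c = 1"
    and g_eq: "\<And>z. norm z < 1 \<Longrightarrow> g z = c * exp (herglotz v z)"
    and W: "integrable circ (\<lambda>t. exp (- (p / (p - 1)) * v t))"
begin

definition W where "W t = exp (- (p / (p - 1)) * v t)"

text \<open>A bound by any \<open>N\<close> in place of the norm: \<open>N\<close> can then be taken
  strictly positive and be divided by.\<close>

definition hardy_bound :: "real \<Rightarrow> (complex \<Rightarrow> complex) \<Rightarrow> bool" where
  "hardy_bound N F \<longleftrightarrow> F holomorphic_on ball 0 1 \<and>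
     (\<forall>r\<in>{0..<1}. integral_mean p (\<lambda>z. F z * g z) r \<le> N powr p)"

text \<open>Bounds the passage to boundary values in \<open>L1\<close>: for \<open>N = 1\<close> the
  two terms of Young's inequality integrate to at most \<open>2 * pi\<close> and to the integral of
  \<open>W\<close>.\<close>

definition L1_const :: real where "L1_const = 2 * pi + (LINT t|circ. W t)"

lemma W_integrable: "integrable circ W"
  using W by (simp add: W_def[abs_def])

lemma W_nonneg: "0 \<le> W t"
  by (simp add: W_def)

lemma L1_const_pos: "0 < L1_const"
proof -
  have "0 \<le> (LINT t|circ. W t)" by (intro Bochner_Integration.integral_nonneg W_nonneg)
  then show ?thesis using pi_gt_zero unfolding L1_const_def by linarith
qed

lemma g_nonzero: "norm z < 1 \<Longrightarrow> g z \<noteq> 0"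
  using g_eq norm_c by auto

text \<open>Inside the disk the left-hand side is the exponential of the Poisson integral of
  \<open>- (p / (p - 1)) * v\<close>, so Jensen's inequality compares it with the Poisson extension
  of \<open>W\<close>.\<close>

lemma inverse_g_le:
  assumes z: "norm z < 1"
  shows "(1 / norm (g z)) powr (p / (p - 1)) \<le> Re (herglotz W z)"
proof -
  let ?q = "p / (p - 1)"
  have i: "integrable circ (\<lambda>t. - ?q * v t)" using v by simp
  have "1 / norm (g z) = exp (- Re (herglotz v z))"
    using g_eq[OF z] norm_c by (simp add: norm_mult exp_minus divide_inverse)
  then have "(1 / norm (g z)) powr ?q = exp (- ?q * Re (herglotz v z))"
    by (simp add: powr_def)
  also have "- ?q * Re (herglotz v z) = Re (herglotz (\<lambda>t. - ?q * v t) z)"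
    unfolding Re_herglotz_eq[OF v z] Re_herglotz_eq[OF i z]
    by (simp add: mult.left_commute[of "poisson z _"])
  also have "exp \<dots> \<le> Re (herglotz (\<lambda>t. exp (- ?q * v t)) z)"
    by (rule herglotz_jensen[OF i W z])
  finally show ?thesis by (simp add: W_def[abs_def])
qed

text \<open>Young's inequality for \<open>(e * norm (F z * g z)) * (1 / (e * norm (g z)))\<close>.
  The parameter \<open>e\<close> makes the first term small in mean on all circles at once, at the
  cost of a large multiple of an extension that converges in \<open>L1\<close>.\<close>

lemma norm_split:
  assumes z: "norm z < 1" and e: "0 < e"
  shows "norm (F z) \<le> e powr p * norm (F z * g z) powr p + (1 / e) powr (p / (p - 1)) * Re (herglotz W z)"
proof -
  let ?q = "p / (p - 1)"
  have g: "0 < norm (g z)" using g_nonzero[OF z] by simp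
  have "norm (F z) = (e * norm (F z * g z)) * (1 / (e * norm (g z)))"
    using g e by (simp add: norm_mult)
  also have "\<dots> \<le> (e * norm (F z * g z)) powr p + (1 / (e * norm (g z))) powr ?q"
    using p e by (intro young_crude) auto
  also have "(e * norm (F z * g z)) powr p = e powr p * norm (F z * g z) powr p"
    by (rule powr_mult)
  also have "1 / (e * norm (g z)) = (1 / e) * (1 / norm (g z))" by simp
  also have "((1 / e) * (1 / norm (g z))) powr ?q = (1 / e) powr ?q * (1 / norm (g z)) powr ?q"
    by (rule powr_mult)
  also have "e powr p * norm (F z * g z) powr p + (1 / e) powr ?q * (1 / norm (g z)) powr ?q
     \<le> e powr p * norm (F z * g z) powr p + (1 / e) powr ?q * Re (herglotz W z)"
    by (intro add_left_mono mult_left_mono inverse_g_le z) auto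
  finally show ?thesis .
qed

lemma herglotz_W_integrable: "integrable circ (\<lambda>t. Re (herglotz W (of_real (rad n) * cis t)))"
  by (intro circ_integrable_cont continuous_intros rad_continuous herglotz_holomorphic W_integrable)

lemma hardy_bound_integral:
  assumes F: "hardy_bound N F"
  shows "integrable circ (\<lambda>t. norm (F (of_real (rad n) * cis t) * g (of_real (rad n) * cis t)) powr p)"
    and "(LINT t|circ. norm (F (of_real (rad n) * cis t) * g (of_real (rad n) * cis t)) powr p) \<le> 2 * pi * N powr p"
proof -
  have Fg: "(\<lambda>z. F z * g z) holomorphic_on ball 0 1"
    using F g_holomorphic by (auto simp: hardy_bound_def intro!: holomorphic_intros)
  show "integrable circ (\<lambda>t. norm (F (of_real (rad n) * cis t) * g (of_real (rad n) * cis t)) powr p)"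
    using integral_mean_eq(1)[OF Fg, of "rad n" p] rad_pos[of n] rad_less[of n] p by simp
  have "integral_mean p (\<lambda>z. F z * g z) (rad n) \<le> N powr p"
    using F rad_pos[of n] rad_less[of n] by (auto simp: hardy_bound_def)
  then have "2 * pi * integral_mean p (\<lambda>z. F z * g z) (rad n) \<le> 2 * pi * N powr p"
    by (intro mult_left_mono) auto
  then show "(LINT t|circ. norm (F (of_real (rad n) * cis t) * g (of_real (rad n) * cis t)) powr p) \<le> 2 * pi * N powr p"
    using integral_mean_eq(2)[OF Fg, of "rad n" p] rad_pos[of n] rad_less[of n] p by simp
qed

text \<open>The splitting with \<open>e = 1\<close> is applied to \<open>F / N\<close> and
  multiplied back, which makes the bound linear in \<open>N\<close>; Fatou's lemma carries it to the
  circle.\<close>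

lemma hardy_bound_L1:
  assumes F: "hardy_bound N F" and N: "0 < N" and bv: "has_boundary_values F"
  shows "integrable circ (boundary_value F)"
    and "(LINT t|circ. norm (boundary_value F t)) \<le> L1_const * N"
proof -
  have hol: "F holomorphic_on ball 0 1" using F by (simp add: hardy_bound_def)
  have int: "integrable circ (\<lambda>t. F (of_real (rad n) * cis t))" for n
    by (intro circ_integrable_cont rad_continuous hol)
  have lim: "AE t in circ. (\<lambda>n. F (of_real (rad n) * cis t)) \<longlonglongrightarrow> boundary_value F t"
    using has_boundary_values_lim[OF bv] by eventually_elim (rule radial_limit_seq)
  have le: "(LINT t|circ. norm (F (of_real (rad n) * cis t))) \<le> L1_const * N" for n
  proof -
    let ?A = "\<lambda>t. norm (F (of_real (rad n) * cis t) * g (of_real (rad n) * cis t)) powr p"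
    let ?H = "\<lambda>t. Re (herglotz W (of_real (rad n) * cis t))"
    note A = hardy_bound_integral[OF F, of n]
    have "norm (F z) \<le> N * ((1 / N) powr p * norm (F z * g z) powr p + Re (herglotz W z))" if z: "norm z < 1" for z
    proof -
      have "norm (F z / of_real N) \<le> 1 powr p * norm (F z / of_real N * g z) powr p + (1 / 1) powr (p / (p - 1)) * Re (herglotz W z)"
        by (rule norm_split[where F="\<lambda>z. F z / of_real N", OF z]) simp
      also have "norm (F z / of_real N * g z) powr p = (1 / N) powr p * norm (F z * g z) powr p"
        using N by (subst powr_mult[symmetric]) (auto simp: norm_mult norm_divide)
      finally show ?thesis using N by (simp add: norm_divide divide_le_eq mult.commute)
    qed
    then have "(LINT t|circ. norm (F (of_real (rad n) * cis t))) \<le> (LINT t|circ. N * ((1 / N) powr p * ?A t + ?H t))"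
      using A(1) herglotz_W_integrable[of n] rad_less[of n]
      by (intro integral_mono integrable_norm int) (auto simp: norm_rad_cis)
    also have "\<dots> = N * ((1 / N) powr p * (LINT t|circ. ?A t) + (LINT t|circ. W t))"
      using A(1) herglotz_W_integrable[of n] circle_integral_herglotz[OF W_integrable rad_pos rad_less, of n]
      by simp
    also have "\<dots> \<le> N * ((1 / N) powr p * (2 * pi * N powr p) + (LINT t|circ. W t))"
      using A(2) N by (intro mult_left_mono add_right_mono) auto
    also have "(1 / N) powr p * (2 * pi * N powr p) = 2 * pi"
      using N by (simp add: powr_divide)
    finally show ?thesis by (simp add: L1_const_def algebra_simps)
  qed
  show "integrable circ (boundary_value F)" "(LINT t|circ. norm (boundary_value F t)) \<le> L1_const * N"
    by (rule circ_Fatou_L1[OF int lim boundary_value_measurable[OF hol] le])+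
qed

text \<open>Uniform integrability: what \<open>?D\<close> has in excess of the fixed integrable
  function \<open>k * W t + norm (?f t)\<close> is at most \<open>e powr p * ?A\<close> plus
  \<open>k\<close> times the distance of \<open>?H\<close> from \<open>W\<close>. The first is small
  in mean by the choice of \<open>e\<close>, the second tends to 0 in mean, and the truncated
  \<open>?m\<close> tends to 0 by dominated convergence.\<close>

lemma hardy_bound_L1_tendsto:
  assumes F: "hardy_bound N F" and N: "0 < N" and bv: "has_boundary_values F"
  shows "(\<lambda>n. LINT t|circ. norm (F (of_real (rad n) * cis t) - boundary_value F t)) \<longlonglongrightarrow> 0"
proof (rule tendstoI)
  fix \<epsilon> :: real assume \<epsilon>: "0 < \<epsilon>"
  have hol: "F holomorphic_on ball 0 1" using F by (simp add: hardy_bound_def)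
  define e where "e = (\<epsilon> / (2 * (2 * pi * N powr p))) powr (1 / p)"
  have q0: "0 < 2 * pi * N powr p" using N by simp
  have e: "0 < e" using \<epsilon> N unfolding e_def by (intro powr_gt_zero[THEN iffD2]) simp
  have ep: "e powr p * (2 * pi * N powr p) = \<epsilon> / 2"
    using p \<epsilon> N by (simp add: e_def powr_powr)
  define k where "k = (1 / e) powr (p / (p - 1))"
  have k: "0 \<le> k" by (simp add: k_def)
  let ?f = "boundary_value F"
  let ?F = "\<lambda>n t. F (of_real (rad n) * cis t)"
  let ?A = "\<lambda>n t. norm (?F n t * g (of_real (rad n) * cis t)) powr p"
  let ?H = "\<lambda>n t. Re (herglotz W (of_real (rad n) * cis t))"
  let ?D = "\<lambda>n t. norm (?F n t - ?f t)"
  let ?m = "\<lambda>n t. min (?D n t) (k * W t + norm (?f t))"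
  have fi: "integrable circ ?f" by (rule hardy_bound_L1[OF F N bv])
  have Fi: "integrable circ (?F n)" for n
    by (intro circ_integrable_cont rad_continuous hol)
  note Ai = hardy_bound_integral(1)[OF F] and Ab = hardy_bound_integral(2)[OF F]
  note Hi = herglotz_W_integrable
  have dom: "integrable circ (\<lambda>t. k * W t + norm (?f t))" using W_integrable fi by auto
  have mi: "integrable circ (?m n)" for n using Fi[of n] fi dom by (intro integrable_min) auto
  have [measurable]: "?f \<in> borel_measurable circ" "?F n \<in> borel_measurable circ" "W \<in> borel_measurable circ" for n
    using fi Fi W_integrable by auto
  have mlim: "(\<lambda>n. LINT t|circ. ?m n t) \<longlonglongrightarrow> (LINT t|circ. 0)"
  proof (rule integral_dominated_convergence[OF _ _ dom])
    show "AE t in circ. (\<lambda>n. ?m n t) \<longlonglongrightarrow> 0"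
      using has_boundary_values_lim[OF bv]
    proof eventually_elim
      case (elim t)
      have "(\<lambda>n. ?m n t) \<longlonglongrightarrow> min (norm (?f t - ?f t)) (k * W t + norm (?f t))"
        by (intro tendsto_intros radial_limit_seq[OF elim])
      then show ?case using k W_nonneg[of t] by (simp add: min_absorb1)
    qed
    show "AE t in circ. norm (?m n t) \<le> k * W t + norm (?f t)" for n
      using k W_nonneg by (intro AE_I2) (auto simp: min_def)
  qed measurable
  have bound: "(LINT t|circ. ?D n t) \<le> \<epsilon> / 2 + ((LINT t|circ. ?m n t) + k * (LINT t|circ. \<bar>?H n t - W t\<bar>))" for n
  proof -
    have i: "integrable circ (\<lambda>t. e powr p * ?A n t + (?m n t + k * \<bar>?H n t - W t\<bar>))"
      using Ai[of n] mi[of n] Hi[of n] W_integrable by auto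
    have "(LINT t|circ. ?D n t) \<le> (LINT t|circ. e powr p * ?A n t + (?m n t + k * \<bar>?H n t - W t\<bar>))"
    proof (rule integral_mono[OF _ i])
      show "integrable circ (?D n)" using Fi fi by auto
      fix t
      have z: "norm (of_real (rad n) * cis t) < 1" by (simp add: norm_rad_cis rad_less)
      have "?D n t \<le> norm (?F n t) + norm (?f t)" by (rule norm_triangle_ineq4)
      moreover have "norm (?F n t) \<le> e powr p * ?A n t + k * ?H n t"
        using norm_split[OF z e, of F] by (simp add: k_def)
      moreover have "k * ?H n t - k * W t \<le> k * \<bar>?H n t - W t\<bar>"
        using k by (simp add: mult_left_mono flip: right_diff_distrib)
      moreover have "0 \<le> e powr p * ?A n t" "0 \<le> k * \<bar>?H n t - W t\<bar>" using k by auto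
      ultimately show "?D n t \<le> e powr p * ?A n t + (?m n t + k * \<bar>?H n t - W t\<bar>)"
        by (simp add: min_def)
    qed
    also have "\<dots> = e powr p * (LINT t|circ. ?A n t) + ((LINT t|circ. ?m n t) + k * (LINT t|circ. \<bar>?H n t - W t\<bar>))"
      using Ai[of n] mi[of n] Hi[of n] W_integrable by simp
    also have "e powr p * (LINT t|circ. ?A n t) \<le> e powr p * (2 * pi * N powr p)"
      using Ab by (intro mult_left_mono) auto
    finally show ?thesis unfolding ep by simp
  qed
  have "(\<lambda>n. (LINT t|circ. ?m n t) + k * (LINT t|circ. \<bar>?H n t - W t\<bar>)) \<longlonglongrightarrow> (LINT t|circ. (0::real)) + k * 0"
    by (intro tendsto_intros mlim herglotz_L1_tendsto W_integrable W_nonneg)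
  then have "(\<lambda>n. (LINT t|circ. ?m n t) + k * (LINT t|circ. \<bar>?H n t - W t\<bar>)) \<longlonglongrightarrow> 0" by simp
  then have "\<forall>\<^sub>F n in sequentially. (LINT t|circ. ?m n t) + k * (LINT t|circ. \<bar>?H n t - W t\<bar>) < \<epsilon> / 2"
    using \<epsilon> by (intro order_tendstoD) auto
  then show "\<forall>\<^sub>F n in sequentially. dist (LINT t|circ. ?D n t) 0 < \<epsilon>"
  proof eventually_elim
    case (elim n)
    have "0 \<le> (LINT t|circ. ?D n t)" by simp
    then show ?case using bound[of n] elim by simp
  qed
qed

lemma hardy_bound_integral_tendsto:
  assumes F: "hardy_bound N F" and N: "0 < N" and bv: "has_boundary_values F"
    and k: "continuous_on {0..2*pi} k"
  shows "(\<lambda>n. LINT t|circ. F (of_real (rad n) * cis t) * k t) \<longlonglongrightarrow> (LINT t|circ. boundary_value F t * k t)"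
proof -
  have hol: "F holomorphic_on ball 0 1" using F by (simp add: hardy_bound_def)
  have fi: "integrable circ (boundary_value F)" by (rule hardy_bound_L1[OF F N bv])
  have fki: "integrable circ (\<lambda>t. boundary_value F t * k t)"
    using integrable_circ_mult_cont[OF k fi] by (simp add: mult.commute)
  have Fki: "integrable circ (\<lambda>t. F (of_real (rad n) * cis t) * k t)" for n
    by (intro circ_integrable_cont continuous_intros rad_continuous hol k)
  obtain C where C: "\<And>t. t \<in> {0..2*pi} \<Longrightarrow> norm (k t) \<le> C"
    using compact_continuous_bound[OF compact_Icc k] by blast
  have "(\<lambda>n. (LINT t|circ. F (of_real (rad n) * cis t) * k t) - (LINT t|circ. boundary_value F t * k t)) \<longlonglongrightarrow> 0"
  proof (rule Lim_null_comparison[OF always_eventually])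
    show "(\<lambda>n. C * (LINT t|circ. norm (F (of_real (rad n) * cis t) - boundary_value F t))) \<longlonglongrightarrow> 0"
      using tendsto_mult_left[OF hardy_bound_L1_tendsto[OF F N bv], of C] by simp
    show "\<forall>n. norm ((LINT t|circ. F (of_real (rad n) * cis t) * k t) - (LINT t|circ. boundary_value F t * k t))
      \<le> C * (LINT t|circ. norm (F (of_real (rad n) * cis t) - boundary_value F t))"
    proof
      fix n
      have Di: "integrable circ (\<lambda>t. C * norm (F (of_real (rad n) * cis t) - boundary_value F t))"
        using fi circ_integrable_cont[OF rad_continuous[OF hol, of _ n]] by auto
      have "(LINT t|circ. F (of_real (rad n) * cis t) * k t) - (LINT t|circ. boundary_value F t * k t)
        = (LINT t|circ. F (of_real (rad n) * cis t) * k t - boundary_value F t * k t)"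
        by (rule Bochner_Integration.integral_diff[symmetric, OF Fki fki])
      also have "norm \<dots> \<le> (LINT t|circ. C * norm (F (of_real (rad n) * cis t) - boundary_value F t))"
      proof (rule Bochner_Integration.integral_norm_bound_integral[OF _ Di])
        show "integrable circ (\<lambda>t. F (of_real (rad n) * cis t) * k t - boundary_value F t * k t)"
          by (rule Bochner_Integration.integrable_diff[OF Fki fki])
        fix t assume "t \<in> space circ"
        then have "norm (k t) \<le> C" using C by simp
        then show "norm (F (of_real (rad n) * cis t) * k t - boundary_value F t * k t) \<le> C * norm (F (of_real (rad n) * cis t) - boundary_value F t)"
          unfolding left_diff_distrib[symmetric] norm_mult by (metis mult.commute mult_right_mono norm_ge_zero)
      qed
      finally show "norm ((LINT t|circ. F (of_real (rad n) * cis t) * k t) - (LINT t|circ. boundary_value F t * k t))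
      \<le> C * (LINT t|circ. norm (F (of_real (rad n) * cis t) - boundary_value F t))" by simp
    qed
  qed
  then show ?thesis by (simp add: LIM_zero_iff)
qed

section \<open>Cauchy's formula and orthogonality for boundary values\<close>

lemma hardy_Cauchy:
  fixes F :: "complex \<Rightarrow> complex"
  assumes F: "hardy_bound N F" and N: "0 < N" and bv: "has_boundary_values F" and z: "norm z < 1"
  shows "(LINT t|circ. boundary_value F t * (cis t / (cis t - z))) = 2 * pi * F z"
proof (rule LIMSEQ_unique)
  have hol: "F holomorphic_on ball 0 1" using F by (simp add: hardy_bound_def)
  show "(\<lambda>n. LINT t|circ. F (of_real (rad n) * cis t) * (cis t / (cis t - z))) \<longlonglongrightarrow> (LINT t|circ. boundary_value F t * (cis t / (cis t - z)))"
    using cis_neq[OF z] by (intro hardy_bound_integral_tendsto[OF F N bv] continuous_intros) auto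
  have "(LINT t|circ. F (of_real (rad n) * cis t) * (cis t / (cis t - z))) = 2 * pi * F (of_real (rad n) * z)" for n
    using circle_Cauchy[OF dilation_holomorphic[OF hol rad_pos[of n]] _ z] rad_pos[of n] rad_less[of n] by simp
  moreover have "(\<lambda>n. 2 * pi * F (of_real (rad n) * z)) \<longlonglongrightarrow> 2 * pi * F z"
    by (intro tendsto_mult_left dilation_tendsto hol z rad_tendsto)
  ultimately show "(\<lambda>n. LINT t|circ. F (of_real (rad n) * cis t) * (cis t / (cis t - z))) \<longlonglongrightarrow> 2 * pi * F z"
    by simp
qed

text \<open>The kernel \<open>u / (1 - w * u)\<close> is holomorphic in the disk and zero at
  \<open>u = 0\<close>, so its product with each dilate has mean zero. It is needed for
  \<open>w = cnj z\<close>.\<close>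

lemma hardy_orthogonal:
  fixes F :: "complex \<Rightarrow> complex"
  assumes F: "hardy_bound N F" and N: "0 < N" and bv: "has_boundary_values F" and w: "norm w < 1"
  shows "(LINT t|circ. boundary_value F t * (cis t / (1 - w * cis t))) = 0"
proof (rule LIMSEQ_unique)
  have hol: "F holomorphic_on ball 0 1" using F by (simp add: hardy_bound_def)
  have ne: "1 - w * u \<noteq> 0" if "norm (w * u) < 1" for u using that by auto
  show "(\<lambda>n. LINT t|circ. F (of_real (rad n) * cis t) * (cis t / (1 - w * cis t))) \<longlonglongrightarrow> (LINT t|circ. boundary_value F t * (cis t / (1 - w * cis t)))"
    using w by (intro hardy_bound_integral_tendsto[OF F N bv] continuous_intros ballI ne) (auto simp: norm_mult)
  have "(LINT t|circ. F (of_real (rad n) * cis t) * (cis t / (1 - w * cis t))) = 0" for n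
  proof -
    define R where "R = (if w = 0 then 1 / rad n else min (1 / rad n) (1 / norm w))"
    have "1 < R" using w rad_pos[of n] rad_less[of n] by (auto simp: R_def)
    moreover have "(\<lambda>u. F (of_real (rad n) * u) * (u / (1 - w * u))) holomorphic_on ball 0 R"
      by (intro holomorphic_intros holomorphic_on_subset[OF dilation_holomorphic[OF hol rad_pos[of n]]] ne)
        (auto simp: R_def norm_mult field_simps split: if_splits)
    ultimately show ?thesis using circle_mean[of "\<lambda>u. F (of_real (rad n) * u) * (u / (1 - w * u))" R] by simp
  qed
  then show "(\<lambda>n. LINT t|circ. F (of_real (rad n) * cis t) * (cis t / (1 - w * cis t))) \<longlonglongrightarrow> 0" by simp
qed

end

section \<open>Continuation of inner functions across the circle\<close>

text \<open>A bounded derivative on a convex set makes the primitive Lipschitz, hence uniformly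
  continuous, hence extendable to the closure, even where \<open>f\<close> itself has no
  limit.\<close>

lemma primitive_extends_closure:
  fixes f :: "complex \<Rightarrow> complex"
  assumes S: "open S" "convex S" and f: "f holomorphic_on S" and C: "\<And>z. z \<in> S \<Longrightarrow> norm (f z) \<le> C"
  obtains B where "continuous_on (closure S) B" "\<And>z. z \<in> S \<Longrightarrow> (B has_field_derivative f z) (at z)"
proof -
  obtain A where A: "\<And>z. z \<in> S \<Longrightarrow> (A has_field_derivative f z) (at z within S)"
    by (rule holomorphic_convex_primitive'[OF S(2,1) f]) (rule that)
  \<comment> \<open>\<open>\<bar>C\<bar> + 1\<close> is positive whatever \<open>C\<close> is and
    can be divided by below.\<close>
  have lip: "norm (A x - A y) \<le> (\<bar>C\<bar> + 1) * norm (x - y)" if "x \<in> S" "y \<in> S" for x y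
  proof -
    have "norm (A x - A y) \<le> C * norm (x - y)"
      by (rule field_differentiable_bound[OF S(2) A C that])
    also have "\<dots> \<le> (\<bar>C\<bar> + 1) * norm (x - y)"
      by (intro mult_right_mono) auto
    finally show ?thesis .
  qed
  have "uniformly_continuous_on S A"
    unfolding uniformly_continuous_on_def
  proof (intro allI impI)
    fix e :: real assume "0 < e"
    show "\<exists>d>0. \<forall>x\<in>S. \<forall>x'\<in>S. dist x' x < d \<longrightarrow> dist (A x') (A x) < e"
    proof (intro exI[of _ "e / (\<bar>C\<bar> + 1)"] conjI ballI impI)
      show "0 < e / (\<bar>C\<bar> + 1)" using \<open>0 < e\<close> by simp
      fix x x' assume x: "x \<in> S" "x' \<in> S" "dist x' x < e / (\<bar>C\<bar> + 1)"
      then have "(\<bar>C\<bar> + 1) * norm (x' - x) < e" by (simp add: dist_norm pos_less_divide_eq mult.commute)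
      with lip[OF x(2,1)] show "dist (A x') (A x) < e" by (simp add: dist_norm)
    qed
  qed
  then obtain B where B: "uniformly_continuous_on (closure S) B" "\<And>x. x \<in> S \<Longrightarrow> A x = B x"
    by (rule uniformly_continuous_on_extension_on_closure) (rule that)
  show ?thesis
  proof (rule that)
    show "continuous_on (closure S) B" using B(1) by (rule uniformly_continuous_imp_continuous)
    fix z assume z: "z \<in> S"
    have "(A has_field_derivative f z) (at z)" using A[OF z] unfolding at_within_open[OF z S(1)] .
    then show "(B has_field_derivative f z) (at z)"
      by (rule has_field_derivative_transform_within_open[OF _ S(1) z B(2)])
  qed
qed

text \<open>The increment is computed on vertical segments inside \<open>S\<close> by the
  fundamental theorem of calculus, and the segments move to the axis; bounded convergence copes with
  limits of \<open>f\<close> that exist only almost everywhere.\<close>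

lemma primitive_vertical_increment:
  fixes f B :: "complex \<Rightarrow> complex"
  assumes B: "continuous_on (closure S) B" "\<And>z. z \<in> S \<Longrightarrow> (B has_field_derivative f z) (at z)"
    and S: "open S" and fhol: "f holomorphic_on S" and C: "\<And>z. z \<in> S \<Longrightarrow> norm (f z) \<le> C"
    and x: "x \<longlonglongrightarrow> 0" "\<And>n y. y \<in> {y1..y2} \<Longrightarrow> Complex (x n) y \<in> S"
    and y: "y1 \<le> y2" "Complex 0 y1 \<in> closure S" "Complex 0 y2 \<in> closure S"
    and lim: "AE y in lebesgue_on {y1..y2}. (\<lambda>n. f (Complex (x n) y)) \<longlonglongrightarrow> h y"
    and h: "h \<in> borel_measurable (lebesgue_on {y1..y2})"
  shows "B (Complex 0 y2) - B (Complex 0 y1) = \<i> * (LINT y|lebesgue_on {y1..y2}. h y)"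
proof (rule LIMSEQ_unique)
  let ?M = "lebesgue_on {y1..y2}"
  have cont: "continuous_on {y1..y2} (\<lambda>y. f (Complex (x n) y))" for n
    by (rule continuous_on_compose2[OF holomorphic_on_imp_continuous_on[OF fhol]])
      (use x(2) in \<open>auto intro!: continuous_intros simp: Complex_eq\<close>)
  have finM: "finite_measure ?M" by (rule finite_measure_lebesgue_on) simp
  have int: "integrable ?M (\<lambda>y. f (Complex (x n) y))" for n
    by (rule finite_measure.integrable_const_bound[OF finM, of _ C])
      (use C x(2) cont in \<open>auto intro!: AE_I2 continuous_imp_measurable_on_sets_lebesgue\<close>)
  have eq: "B (Complex (x n) y2) - B (Complex (x n) y1) = \<i> * (LINT y|?M. f (Complex (x n) y))" for n
  proof -
    have "((\<lambda>y. \<i> * f (Complex (x n) y)) has_integral (B (Complex (x n) y2) - B (Complex (x n) y1))) {y1..y2}"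
    proof (rule fundamental_theorem_of_calculus[OF y(1)])
      fix y assume y: "y \<in> {y1..y2}"
      have "((\<lambda>y. Complex (x n) y) has_vector_derivative \<i>) (at y within {y1..y2})"
        unfolding Complex_eq by (auto intro!: derivative_eq_intros has_vector_derivative_real_field)
      from field_vector_diff_chain_within[OF this, of B "f (Complex (x n) y)"] B(2)[OF x(2)[OF y]]
      show "((\<lambda>y. B (Complex (x n) y)) has_vector_derivative \<i> * f (Complex (x n) y)) (at y within {y1..y2})"
        by (simp add: o_def has_field_derivative_at_within)
    qed
    moreover have "((\<lambda>y. \<i> * f (Complex (x n) y)) has_integral (\<i> * (LINT y|?M. f (Complex (x n) y)))) {y1..y2}"
      by (intro has_integral_mult_right has_integral_integral_lebesgue_on int) auto
    ultimately show ?thesis by (rule has_integral_unique)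
  qed
  have "(\<lambda>n. B (Complex (x n) b)) \<longlonglongrightarrow> B (Complex 0 b)" if "b \<in> {y1..y2}" "Complex 0 b \<in> closure S" for b
  proof (rule continuous_on_tendsto_compose[OF B(1) _ that(2)])
    show "(\<lambda>n. Complex (x n) b) \<longlonglongrightarrow> Complex 0 b"
      unfolding Complex_eq by (intro tendsto_intros x(1)[THEN tendsto_of_real])
    show "\<forall>\<^sub>F n in sequentially. Complex (x n) b \<in> closure S"
      using x(2)[OF that(1)] closure_subset by (intro always_eventually) blast
  qed
  then have "(\<lambda>n. B (Complex (x n) y2) - B (Complex (x n) y1)) \<longlonglongrightarrow> B (Complex 0 y2) - B (Complex 0 y1)"
    using y by (intro tendsto_diff) auto
  then show "(\<lambda>n. \<i> * (LINT y|?M. f (Complex (x n) y))) \<longlonglongrightarrow> B (Complex 0 y2) - B (Complex 0 y1)"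
    unfolding eq .
  have "(\<lambda>n. LINT y|?M. f (Complex (x n) y)) \<longlonglongrightarrow> (LINT y|?M. h y)"
  proof (rule integral_dominated_convergence[OF h _ _ lim])
    show "integrable ?M (\<lambda>_. C)" using finM by (simp add: finite_measure.integrable_const)
    show "(\<lambda>y. f (Complex (x n) y)) \<in> borel_measurable ?M" for n using int by auto
    show "AE y in ?M. norm (f (Complex (x n) y)) \<le> C" for n
      using C x(2) by (intro AE_I2) auto
  qed
  then show "(\<lambda>n. \<i> * (LINT y|?M. f (Complex (x n) y))) \<longlonglongrightarrow> \<i> * (LINT y|?M. h y)"
    by (intro tendsto_intros)
qed

lemma closure_half_ball:
  fixes a :: complex
  assumes "a \<noteq> 0"
  shows "ball 0 s \<inter> {z. a \<bullet> z \<le> 0} \<subseteq> closure (ball 0 s \<inter> {z. a \<bullet> z < 0})"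
  using open_Int_closure_subset[of "ball 0 s" "{z. a \<bullet> z < 0}"] assms by simp

text \<open>Both functions are differentiated primitives, and the primitives are Lipschitz: so they extend
  continuously to the imaginary axis, where they agree up to a constant.\<close>

lemma bounded_paste_across_axis:
  fixes f1 f2 :: "complex \<Rightarrow> complex"
  assumes f1: "f1 holomorphic_on (ball 0 s \<inter> {z. Re z < 0})"
    and f2: "f2 holomorphic_on (ball 0 s \<inter> {z. Re z > 0})"
    and C1: "\<And>z. \<lbrakk>norm z < s; Re z < 0\<rbrakk> \<Longrightarrow> norm (f1 z) \<le> C"
    and C2: "\<And>z. \<lbrakk>norm z < s; Re z > 0\<rbrakk> \<Longrightarrow> norm (f2 z) \<le> C"
    and lim: "AE y in lebesgue. \<bar>y\<bar> < s \<longrightarrow>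
        (\<exists>l. ((\<lambda>x. f1 (Complex x y)) \<longlongrightarrow> l) (at_left 0) \<and> ((\<lambda>x. f2 (Complex x y)) \<longlongrightarrow> l) (at_right 0))"
    and s: "0 < s"
  obtains K where "K holomorphic_on ball 0 s" "\<And>z. \<lbrakk>norm z < s; Re z < 0\<rbrakk> \<Longrightarrow> K z = f1 z"
proof -
  define S1 where "S1 = ball 0 s \<inter> {z. Re z < 0}"
  define S2 where "S2 = ball 0 s \<inter> {z. Re z > 0}"
  have half: "{z. Re z < 0} = {z. 1 \<bullet> z < 0}" "{z. Re z > 0} = {z. (-1) \<bullet> z < 0}"
    by (auto simp: inner_complex_def)
  have S: "open S1" "convex S1" "open S2" "convex S2"
    unfolding S1_def S2_def
    by (intro open_Int convex_Int open_ball convex_ball open_halfspace_Re_lt convex_halfspace_Re_lt open_halfspace_Re_gt convex_halfspace_Re_gt)+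
  have cl: "z \<in> closure S1" if "norm z < s" "Re z \<le> 0" for z
    using closure_half_ball[of 1 s] that unfolding S1_def half by (auto simp: inner_complex_def)
  have cr: "z \<in> closure S2" if "norm z < s" "0 \<le> Re z" for z
    using closure_half_ball[of "-1" s] that unfolding S2_def half by (auto simp: inner_complex_def)
  obtain B1 where B1: "continuous_on (closure S1) B1" "\<And>z. z \<in> S1 \<Longrightarrow> (B1 has_field_derivative f1 z) (at z)"
    by (rule primitive_extends_closure[OF S(1,2), of f1 C]) (use f1 C1 in \<open>auto simp: S1_def\<close>)
  obtain B2 where B2: "continuous_on (closure S2) B2" "\<And>z. z \<in> S2 \<Longrightarrow> (B2 has_field_derivative f2 z) (at z)"
    by (rule primitive_extends_closure[OF S(3,4), of f2 C]) (use f2 C2 in \<open>auto simp: S2_def\<close>)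
  \<comment> \<open>Both increments along the axis are \<open>\<i>\<close> times the integral of the
    same boundary function, so the two primitives differ there by a constant.\<close>
  have incr: "B1 (Complex 0 y2) - B1 (Complex 0 y1) = B2 (Complex 0 y2) - B2 (Complex 0 y1)"
    if y: "y1 \<le> y2" "\<bar>y1\<bar> < s" "\<bar>y2\<bar> < s" for y1 y2
  proof -
    let ?M = "lebesgue_on {y1..y2}"
    define d where "d = s - max \<bar>y1\<bar> \<bar>y2\<bar>"
    have d: "0 < d" using y by (simp add: d_def)
    define x where "x n = d / (real n + 2)" for n
    have x0: "0 < x n" "x n < d" for n using d by (auto simp: x_def divide_less_eq)
    have xlim: "x \<longlonglongrightarrow> 0"
      using tendsto_mult_left[OF inverse_add_2_tendsto, of d] by (simp add: x_def[abs_def])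
    have nrm: "norm (Complex u b) < s" if "\<bar>u\<bar> < d" "b \<in> {y1..y2}" for u b
    proof -
      have "norm (Complex u b) \<le> \<bar>u\<bar> + \<bar>b\<bar>" using cmod_le[of "Complex u b"] by simp
      also have "\<bar>b\<bar> \<le> max \<bar>y1\<bar> \<bar>y2\<bar>" using that(2) by auto
      finally show ?thesis using that(1) by (simp add: d_def)
    qed
    have in1: "Complex (- x n) b \<in> S1" if "b \<in> {y1..y2}" for n b
      using nrm[of "- x n" b] x0[of n] that by (simp add: S1_def)
    have in2: "Complex (x n) b \<in> S2" if "b \<in> {y1..y2}" for n b
      using nrm[of "x n" b] x0[of n] that by (simp add: S2_def)
    have xl: "filterlim (\<lambda>n. - x n) (at_left 0) sequentially" and xr: "filterlim x (at_right 0) sequentially"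
      using tendsto_minus[OF xlim] xlim x0 by (auto simp: filterlim_at intro!: always_eventually) (metis less_irrefl)+
    have AEM: "AE y in ?M. \<exists>l. (\<lambda>n. f1 (Complex (- x n) y)) \<longlonglongrightarrow> l \<and> (\<lambda>n. f2 (Complex (x n) y)) \<longlonglongrightarrow> l"
    proof -
      have "AE y in lebesgue. y \<in> {y1..y2} \<longrightarrow> (\<exists>l. (\<lambda>n. f1 (Complex (- x n) y)) \<longlonglongrightarrow> l \<and> (\<lambda>n. f2 (Complex (x n) y)) \<longlonglongrightarrow> l)"
        using lim
      proof eventually_elim
        case (elim b)
        show ?case
        proof
          assume b: "b \<in> {y1..y2}"
          then have "\<bar>b\<bar> < s" using y by auto
          with elim obtain l where l: "((\<lambda>x. f1 (Complex x b)) \<longlongrightarrow> l) (at_left 0)" "((\<lambda>x. f2 (Complex x b)) \<longlongrightarrow> l) (at_right 0)"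
            by blast
          show "\<exists>l. (\<lambda>n. f1 (Complex (- x n) b)) \<longlonglongrightarrow> l \<and> (\<lambda>n. f2 (Complex (x n) b)) \<longlonglongrightarrow> l"
            using filterlim_compose[OF l(1) xl] filterlim_compose[OF l(2) xr] by blast
        qed
      qed
      then show ?thesis by (subst AE_restrict_space_iff) auto
    qed
    define h where "h b = lim (\<lambda>n. f1 (Complex (- x n) b))" for b
    have hm: "h \<in> borel_measurable ?M"
      unfolding h_def
    proof (intro borel_measurable_lim_metric continuous_imp_measurable_on_sets_lebesgue)
      show "continuous_on {y1..y2} (\<lambda>b. f1 (Complex (- x n) b))" for n
        by (rule continuous_on_compose2[OF holomorphic_on_imp_continuous_on[OF f1[folded S1_def]]])
          (use in1 in \<open>auto intro!: continuous_intros simp: Complex_eq\<close>)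
    qed auto
    have lim1: "AE y in ?M. (\<lambda>n. f1 (Complex (- x n) y)) \<longlonglongrightarrow> h y"
      using AEM by eventually_elim (auto simp: h_def limI)
    have lim2: "AE y in ?M. (\<lambda>n. f2 (Complex (x n) y)) \<longlonglongrightarrow> h y"
      using AEM by eventually_elim (auto simp: h_def limI)
    have n12: "norm (Complex 0 y1) < s" "norm (Complex 0 y2) < s" using y by (auto simp: complex_norm)
    have "B1 (Complex 0 y2) - B1 (Complex 0 y1) = \<i> * (LINT y|?M. h y)"
    proof (rule primitive_vertical_increment[OF B1 S(1) f1[folded S1_def] _ _ in1 y(1) _ _ lim1 hm])
      show "(\<lambda>n. - x n) \<longlonglongrightarrow> 0" using tendsto_minus[OF xlim] by simp
    qed (use n12 cl C1 in \<open>auto simp: S1_def\<close>)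
    moreover have "B2 (Complex 0 y2) - B2 (Complex 0 y1) = \<i> * (LINT y|?M. h y)"
      by (rule primitive_vertical_increment[OF B2 S(3) f2[folded S2_def] _ xlim in2 y(1) _ _ lim2 hm])
        (use n12 cr C2 in \<open>auto simp: S2_def\<close>)
    ultimately show ?thesis by simp
  qed
  \<comment> \<open>Subtracting the values at 0 makes the primitives agree on the axis. The glued
    function is continuous, and holomorphic off the axis, hence holomorphic; its derivative is the
    required \<open>K\<close>.\<close>
  define K0 where "K0 z = (if Re z \<le> 0 then B1 z - B1 0 else B2 z - B2 0)" for z
  have c0: "(0::complex) = Complex 0 0" by (simp add: complex_eq_iff)
  have "K0 holomorphic_on ball 0 s"
  proof (rule holomorphic_on_paste_across_line[where d = 1 and k = 0])
    show "K0 holomorphic_on ball 0 s \<inter> {z. 1 \<bullet> z < 0}"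
    proof -
      have "(\<lambda>z. B1 z - B1 0) holomorphic_on S1"
        using B1(2) S(1) by (intro holomorphic_intros) (auto simp: holomorphic_on_open)
      then have "K0 holomorphic_on S1"
        by (rule holomorphic_transform) (auto simp: K0_def S1_def)
      then show ?thesis unfolding S1_def half .
    qed
    show "K0 holomorphic_on ball 0 s \<inter> {z. 0 < 1 \<bullet> z}"
    proof -
      have "(\<lambda>z. B2 z - B2 0) holomorphic_on S2"
        using B2(2) S(3) by (intro holomorphic_intros) (auto simp: holomorphic_on_open)
      then have "K0 holomorphic_on S2"
        by (rule holomorphic_transform) (auto simp: K0_def S2_def)
      then show ?thesis unfolding S2_def by (simp add: inner_complex_def)
    qed
    show "continuous_on (ball 0 s) K0"
      unfolding K0_def
    proof (rule continuous_on_cases_le)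
      show "continuous_on {x \<in> ball 0 s. Re x \<le> 0} (\<lambda>z. B1 z - B1 0)"
        by (intro continuous_intros continuous_on_subset[OF B1(1)]) (auto intro: cl)
      show "continuous_on {x \<in> ball 0 s. 0 \<le> Re x} (\<lambda>z. B2 z - B2 0)"
        by (intro continuous_intros continuous_on_subset[OF B2(1)]) (auto intro: cr)
      fix z assume z: "z \<in> ball 0 s" "Re z = 0"
      then have zc: "z = Complex 0 (Im z)" by (simp add: complex_eq_iff)
      then have "\<bar>Im z\<bar> < s" using z(1) abs_Im_le_cmod[of z] by simp
      then show "B1 z - B1 0 = B2 z - B2 0"
        using incr[of 0 "Im z"] incr[of "Im z" 0] s zc c0 by (cases "0 \<le> Im z") (auto simp: algebra_simps)
    qed (intro continuous_intros)
  qed auto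
  then have "deriv K0 holomorphic_on ball 0 s" by (rule holomorphic_deriv) simp
  moreover have "deriv K0 z = f1 z" if "norm z < s" "Re z < 0" for z
  proof (rule DERIV_imp_deriv)
    have z: "z \<in> S1" using that by (simp add: S1_def)
    have "((\<lambda>z. B1 z - B1 0) has_field_derivative f1 z) (at z)"
      using DERIV_diff[OF B1(2)[OF z] DERIV_const[of "B1 0"]] by simp
    then show "(K0 has_field_derivative f1 z) (at z)"
      by (rule has_field_derivative_transform_within_open[OF _ S(1) z]) (auto simp: K0_def S1_def)
  qed
  ultimately show ?thesis by (rule that)
qed

text \<open>Every angle reduces to \<open>{0..2 * pi}\<close> by a multiple of
  \<open>2 * pi\<close>, and countably many translates of a null set are null.\<close>

lemma AE_circ_rotate:
  assumes "AE t in circ. P (cis t)"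
  shows "AE y in lebesgue. P (cis (a + y))"
proof -
  obtain N where N: "N \<in> null_sets lebesgue" "\<And>t. t \<in> space lebesgue - N \<Longrightarrow> 0 \<le> t \<and> t \<le> 2 * pi \<longrightarrow> P (cis t)"
    using assms unfolding AE_circ_iff by (rule AE_E3) (rule that)
  have "negligible (\<Union>k::int. (+) (of_int k * (2 * pi) - a) ` N)"
    using N(1) by (intro negligible_countable_Union) (auto simp: negligible_iff_null_sets[symmetric] intro!: negligible_translation)
  then have "AE y in lebesgue. y \<notin> (\<Union>k::int. (+) (of_int k * (2 * pi) - a) ` N)"
    by (intro AE_not_in) (simp add: negligible_iff_null_sets)
  then show ?thesis
  proof (rule eventually_mono)
    fix y assume y: "y \<notin> (\<Union>k::int. (+) (of_int k * (2 * pi) - a) ` N)"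
    define k where "k = \<lfloor>(a + y) / (2 * pi)\<rfloor>"
    define t where "t = (a + y) - of_int k * (2 * pi)"
    have "of_int k \<le> (a + y) / (2 * pi)" "(a + y) / (2 * pi) < of_int k + 1"
      unfolding k_def by linarith+
    then have t: "0 \<le> t" "t \<le> 2 * pi" unfolding t_def by (simp_all add: field_simps)
    have "t \<notin> N"
    proof
      assume "t \<in> N"
      then have "of_int k * (2 * pi) - a + t \<in> (+) (of_int k * (2 * pi) - a) ` N" by blast
      moreover have "of_int k * (2 * pi) - a + t = y" by (simp add: t_def)
      ultimately show False using y by (metis UNIV_I UN_iff)
    qed
    then have "P (cis t)" using N(2)[of t] t by simp
    moreover have "cis t = cis (a + y)"
    proof -
      have "cis (of_int k * (2 * pi)) = 1"
        using cis_multiple_2pi[of "of_int k"] by (simp add: mult.commute)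
      then show ?thesis unfolding t_def cis_divide[symmetric] by simp
    qed
    ultimately show "P (cis (a + y))" by simp
  qed
qed

text \<open>In the coordinate \<open>w = ln (z / a)\<close> the circle is the imaginary axis, and the reflected function is
  \<open>1 / cnj (I (1 / cnj z))\<close>.\<close>

lemma inner_extends_across_arc:
  assumes I: "inner_function I" and a: "norm a = 1"
    and \<eta>: "0 < \<eta>" and \<delta>: "0 < \<delta>" "\<And>z. \<lbrakk>norm z < 1; norm (z - a) < \<eta>\<rbrakk> \<Longrightarrow> \<delta> \<le> norm (I z)"
  obtains J R where "0 < R" "J holomorphic_on ball a R" "\<And>z. \<lbrakk>z \<in> ball a R; norm z < 1\<rbrakk> \<Longrightarrow> J z = I z"
proof -
  have hol: "I holomorphic_on ball 0 1" using I by (simp add: inner_function_def)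
  obtain C where C: "\<And>z. norm z < 1 \<Longrightarrow> norm (I z) \<le> C"
    using I unfolding inner_function_def bounded_iff ball_simps(9) by (metis mem_ball_0)
  have a0: "a \<noteq> 0" using a by auto
  have "((\<lambda>w. a * exp w) \<longlongrightarrow> a * exp 0) (at 0)" by (intro tendsto_intros)
  then have "\<forall>\<^sub>F w in at 0. dist (a * exp w) a < \<eta>" using \<eta> by (auto dest: tendstoD)
  \<comment> \<open>\<open>s\<close> is so small that \<open>a * exp w\<close> stays where
    \<open>I\<close> is bounded away from 0; the reflected function is then bounded by
    \<open>1 / \<delta>\<close>.\<close>
  then obtain s where s: "0 < s" "\<And>w. norm w < s \<Longrightarrow> norm (a * exp w - a) < \<eta>"
    using \<eta> by (auto simp: eventually_at dist_norm) (metis exp_zero mult.right_neutral diff_self norm_zero)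
  define G where "G w = I (a * exp w)" for w
  have nG: "norm (a * exp w) < 1" if "Re w < 0" for w using that a by (simp add: norm_mult)
  have Ghol: "G holomorphic_on {w. Re w < 0}"
  proof -
    have "I \<circ> (\<lambda>w. a * exp w) holomorphic_on {w. Re w < 0}"
      by (intro holomorphic_on_compose_gen[OF _ hol] holomorphic_intros) (auto simp: nG[simplified])
    then show ?thesis by (simp add: G_def[abs_def] o_def)
  qed
  have G\<delta>: "\<delta> \<le> norm (G w)" if "norm w < s" "Re w < 0" for w
    unfolding G_def by (rule \<delta>(2)[OF nG[OF that(2)] s(2)[OF that(1)]])
  define f2 where "f2 w = 1 / cnj (G (- cnj w))" for w
  obtain K where K: "K holomorphic_on ball 0 s" "\<And>z. \<lbrakk>norm z < s; Re z < 0\<rbrakk> \<Longrightarrow> K z = G z"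
  proof (rule bounded_paste_across_axis[of G s f2 "max C (1 / \<delta>)"])
    show "G holomorphic_on ball 0 s \<inter> {z. Re z < 0}"
      by (rule holomorphic_on_subset[OF Ghol]) auto
    show "f2 holomorphic_on ball 0 s \<inter> {z. 0 < Re z}"
    proof -
      have op: "open (ball 0 s \<inter> {z. 0 < Re z})" by (intro open_Int open_ball open_halfspace_Re_gt)
      have "\<exists>f'. ((\<lambda>w. cnj (G (- cnj w))) has_field_derivative f') (at w)" if "w \<in> ball 0 s \<inter> {z. 0 < Re z}" for w
      proof -
        have "open {w. Re w < 0}" by (rule open_halfspace_Re_lt)
        then have "(G has_field_derivative deriv G (- cnj w)) (at (- cnj w))"
          using holomorphic_derivI[OF Ghol] that by auto
        moreover have "((\<lambda>u. - u) has_field_derivative - 1) (at (cnj w))" by (auto intro!: derivative_eq_intros)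
        ultimately have "((\<lambda>u. G (- u)) has_field_derivative deriv G (- cnj w) * - 1) (at (cnj w))"
          by (rule DERIV_chain2)
        from has_field_derivative_cnj_cnj[OF this] show ?thesis by (auto simp: o_def)
      qed
      then have "(\<lambda>w. cnj (G (- cnj w))) holomorphic_on ball 0 s \<inter> {z. 0 < Re z}"
        using op by (simp add: holomorphic_on_open)
      then show ?thesis unfolding f2_def
      proof (intro holomorphic_intros)
        fix w assume "w \<in> ball 0 s \<inter> {z. 0 < Re z}"
        then have "\<delta> \<le> norm (G (- cnj w))" by (intro G\<delta>) auto
        then show "cnj (G (- cnj w)) \<noteq> 0" using \<delta>(1) by auto
      qed
    qed
    show "norm (G z) \<le> max C (1 / \<delta>)" if "norm z < s" "Re z < 0" for z
      using C[OF nG[OF that(2)]] by (simp add: G_def)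
    show "norm (f2 z) \<le> max C (1 / \<delta>)" if "norm z < s" "0 < Re z" for z
    proof -
      have "\<delta> \<le> norm (G (- cnj z))" using that by (intro G\<delta>) auto
      then have "1 / norm (G (- cnj z)) \<le> 1 / \<delta>" using \<delta>(1) by (intro divide_left_mono mult_pos_pos) auto
      then show ?thesis by (simp add: f2_def norm_divide)
    qed
    show "AE y in lebesgue. \<bar>y\<bar> < s \<longrightarrow> (\<exists>l. ((\<lambda>x. G (Complex x y)) \<longlongrightarrow> l) (at_left 0) \<and> ((\<lambda>x. f2 (Complex x y)) \<longlongrightarrow> l) (at_right 0))"
    proof -
      have "AE t in circ. \<exists>l. has_radial_limit I (cis t) l \<and> norm l = 1"
        using I by (simp add: inner_function_def)
      from AE_circ_rotate[OF this, of "Arg a"] show ?thesis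
      proof eventually_elim
        case (elim y)
        then obtain l where l: "has_radial_limit I (cis (Arg a + y)) l" "norm l = 1" by blast
        have cis: "a * cis y = cis (Arg a + y)"
          using a cis_Arg[OF a0] by (simp add: sgn_div_norm flip: cis_mult)
        have Geq: "G (Complex x y) = I (of_real (exp x) * cis (Arg a + y))" for x
        proof -
          have "exp (Complex x y) = of_real (exp x) * cis y" by (simp add: Complex_eq exp_add cis_conv_exp exp_of_real)
          then show ?thesis unfolding G_def cis[symmetric] by (simp add: mult_ac)
        qed
        have e: "filterlim exp (at_left 1) (at_left (0::real))"
          unfolding filterlim_at
        proof
          show "\<forall>\<^sub>F x in at_left (0::real). exp x \<in> {..<1} \<and> exp x \<noteq> 1"
            by (auto simp: eventually_at_filter)
          have "(exp \<longlongrightarrow> exp 0) (at_left (0::real))" by (intro tendsto_intros)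
          then show "(exp \<longlongrightarrow> 1) (at_left (0::real))" by simp
        qed
        have lim1: "((\<lambda>x. G (Complex x y)) \<longlongrightarrow> l) (at_left 0)"
          unfolding Geq using filterlim_compose[OF l(1)[unfolded has_radial_limit_def] e] by (simp add: mult_ac)
        have m: "filterlim uminus (at_left 0) (at_right (0::real))"
          by (simp add: at_left_minus filterlim_def)
        have "l \<noteq> 0" using l(2) by auto
        have "((\<lambda>x. 1 / cnj (G (Complex (- x) y))) \<longlongrightarrow> 1 / cnj l) (at_right 0)"
          using filterlim_compose[OF lim1 m] \<open>l \<noteq> 0\<close> by (intro tendsto_intros) auto
        \<comment> \<open>A unimodular limit is its own reflection, so the limits from both sides of
          the axis agree.\<close>
        moreover have "1 / cnj l = l"
          using l(2) \<open>l \<noteq> 0\<close> complex_norm_square[of l] by (simp add: field_simps)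
        moreover have "- cnj (Complex x y) = Complex (- x) y" for x by (simp add: complex_eq_iff)
        ultimately have "((\<lambda>x. f2 (Complex x y)) \<longlongrightarrow> l) (at_right 0)" unfolding f2_def by simp
        with lim1 show ?case by blast
      qed
    qed
  qed (use s in auto)
  have "((\<lambda>z. Ln (z / a)) \<longlongrightarrow> Ln (a / a)) (at a)"
    using a0 by (intro tendsto_intros) auto
  then have "\<forall>\<^sub>F z in at a. dist (Ln (z / a)) 0 < s" using s(1) a0 by (auto dest: tendstoD)
  then obtain R0 where R0: "0 < R0" "\<And>z. \<lbrakk>z \<noteq> a; dist z a < R0\<rbrakk> \<Longrightarrow> norm (Ln (z / a)) < s"
    by (auto simp: eventually_at)
  \<comment> \<open>A radius of at most 1 keeps \<open>z / a\<close> at distance less than 1 from 1,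
    where the principal logarithm is holomorphic.\<close>
  define R where "R = min R0 1"
  have RL: "norm (Ln (z / a)) < s" if "z \<in> ball a R" for z
    using R0(2)[of z] that s(1) a0 by (cases "z = a") (auto simp: R_def dist_commute)
  have za: "z / a \<notin> \<real>\<^sub>\<le>\<^sub>0" if "z \<in> ball a R" for z
  proof -
    have "norm (z / a - 1) < 1"
    proof -
      have "z / a - 1 = (z - a) / a" using a0 by (simp add: field_simps)
      then show ?thesis using that a by (simp add: norm_divide R_def dist_norm norm_minus_commute)
    qed
    then have "\<bar>Re (z / a - 1)\<bar> < 1" using abs_Re_le_cmod[of "z / a - 1"] by linarith
    then have "0 < Re (z / a)" by simp
    then show ?thesis by (auto simp: complex_nonpos_Reals_iff)
  qed
  have z0: "z \<noteq> 0" if "z \<in> ball a R" for z using za[OF that] by auto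
  show ?thesis
  proof (rule that)
    show "0 < R" using R0 by (simp add: R_def)
    have "K \<circ> (\<lambda>z. Ln (z / a)) holomorphic_on ball a R"
      using a0 za RL by (intro holomorphic_on_compose_gen[OF _ K(1)] holomorphic_intros) auto
    then show "(\<lambda>z. K (Ln (z / a))) holomorphic_on ball a R" by (simp add: o_def)
    fix z assume z: "z \<in> ball a R" "norm z < 1"
    have "Re (Ln (z / a)) = ln (norm z)" using z0[OF z(1)] a0 a by (simp add: norm_divide)
    also have "\<dots> < 0" using z0[OF z(1)] z(2) by simp
    finally have "K (Ln (z / a)) = G (Ln (z / a))" by (intro K(2) RL[OF z(1)])
    also have "\<dots> = I z" using z0[OF z(1)] a0 by (simp add: G_def)
    finally show "K (Ln (z / a)) = I z" .
  qed
qed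

lemma radial_limit_of_extension:
  assumes J: "J holomorphic_on ball a R" "\<And>z. \<lbrakk>z \<in> ball a R; norm z < 1\<rbrakk> \<Longrightarrow> J z = I z"
    and t: "cis t \<in> ball a R"
  shows "has_radial_limit I (cis t) (J (cis t))"
  unfolding has_radial_limit_def
proof (rule Lim_transform_eventually)
  have lim: "((\<lambda>r. of_real r * cis t) \<longlongrightarrow> of_real 1 * cis t) (at_left (1::real))"
    by (intro tendsto_intros)
  have "isCont J (of_real 1 * cis t)"
    using holomorphic_on_imp_continuous_on[OF J(1)] t by (simp add: continuous_on_eq_continuous_at)
  from isCont_tendsto_compose[OF this lim]
  show "((\<lambda>r. J (of_real r * cis t)) \<longlongrightarrow> J (cis t)) (at_left 1)" by simp
  have "\<forall>\<^sub>F r in at_left (1::real). of_real r * cis t \<in> ball a R"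
    by (rule topological_tendstoD[OF lim]) (use t in auto)
  moreover have "\<forall>\<^sub>F r in at_left (1::real). r \<in> {0<..<1}" by (intro eventually_at_left_real) auto
  ultimately show "\<forall>\<^sub>F r in at_left (1::real). J (of_real r * cis t) = I (of_real r * cis t)"
    by eventually_elim (rule J(2), auto simp: norm_mult)
qed

lemma not_inner_spectrum_lower_bound:
  assumes a: "norm a \<le> 1" "a \<notin> inner_spectrum I"
  obtains \<eta> \<delta> where "0 < \<eta>" "0 < \<delta>" "\<And>z. \<lbrakk>norm z < 1; z \<noteq> a; norm (z - a) < \<eta>\<rbrakk> \<Longrightarrow> \<delta> \<le> norm (I z)"
proof -
  let ?L = "Liminf (at a within ball 0 1) (\<lambda>z. ereal (norm (I z)))"
  have "a \<in> closure (ball 0 1)" using a(1) by simp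
  then have "?L \<noteq> 0" using a(2) by (simp add: inner_spectrum_def)
  moreover have "0 \<le> ?L" by (intro Liminf_bounded always_eventually) auto
  ultimately have "0 < ?L" by auto
  then obtain d where d: "0 < ereal d" "ereal d < ?L" using ereal_dense2 by blast
  then have "\<forall>\<^sub>F z in at a within ball 0 1. ereal d < ereal (norm (I z))"
    by (intro less_LiminfD)
  then obtain \<eta> where "0 < \<eta>" "\<And>z. \<lbrakk>z \<in> ball 0 1; z \<noteq> a; dist z a < \<eta>\<rbrakk> \<Longrightarrow> d < norm (I z)"
    by (auto simp: eventually_at)
  then show ?thesis using d(1) by (intro that[of \<eta> d]) (auto simp: dist_norm intro: less_imp_le)
qed

text \<open>Puts interior points, where \<open>J = I\<close>, and boundary points off the spectrum,
  where \<open>J\<close> is the reflection, on the same footing. Halving the radius makes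
  \<open>J\<close> bounded by compactness.\<close>

lemma inner_local_extension:
  assumes I: "inner_function I" and a: "norm a < 1 \<or> norm a = 1 \<and> a \<notin> inner_spectrum I"
  obtains J R M where "0 < R" "J holomorphic_on ball a R" "\<And>z. z \<in> ball a R \<Longrightarrow> norm (J z) \<le> M"
    "\<And>z. \<lbrakk>z \<in> ball a R; norm z < 1\<rbrakk> \<Longrightarrow> J z = I z"
    "\<And>t. cis t \<in> ball a R \<Longrightarrow> has_radial_limit I (cis t) (J (cis t))"
proof -
  obtain J R where JR: "0 < R" "J holomorphic_on ball a R" "\<And>z. \<lbrakk>z \<in> ball a R; norm z < 1\<rbrakk> \<Longrightarrow> J z = I z"
  proof (cases "norm a < 1")
    case True
    have "ball a (1 - norm a) \<subseteq> ball 0 1"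
      by (auto simp: dist_norm) (metis add_diff_cancel diff_add_cancel less_diff_eq norm_minus_commute norm_triangle_sub order_le_less_trans add.commute)
    then show ?thesis
      using True I by (intro that[of "1 - norm a" I]) (auto simp: inner_function_def intro: holomorphic_on_subset)
  next
    case False
    with a have a: "norm a = 1" "a \<notin> inner_spectrum I" by auto
    then obtain \<eta> \<delta> where "0 < \<eta>" "0 < \<delta>" "\<And>z. \<lbrakk>norm z < 1; z \<noteq> a; norm (z - a) < \<eta>\<rbrakk> \<Longrightarrow> \<delta> \<le> norm (I z)"
      using not_inner_spectrum_lower_bound[of a I] by auto
    then show ?thesis
      using inner_extends_across_arc[OF I a(1), of \<eta> \<delta>] that a(1) by (metis less_irrefl)
  qed
  have cJ: "continuous_on (cball a (R/2)) J"
    using JR(1) by (intro holomorphic_on_imp_continuous_on holomorphic_on_subset[OF JR(2)]) auto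
  obtain M where M: "\<And>z. z \<in> cball a (R/2) \<Longrightarrow> norm (J z) \<le> M"
    using compact_continuous_bound[OF compact_cball cJ] by blast
  have sub: "ball a (R/2) \<subseteq> ball a R" using JR(1) by auto
  show ?thesis
  proof (rule that[of "R/2" J M])
    show "J holomorphic_on ball a (R/2)" by (rule holomorphic_on_subset[OF JR(2) sub])
    show "has_radial_limit I (cis t) (J (cis t))" if "cis t \<in> ball a (R/2)" for t
      using radial_limit_of_extension[OF JR(2,3)] that sub by blast
  qed (use JR M sub in auto)
qed

section \<open>The reproducing kernel\<close>

text \<open>On the circle of radius \<open>3 * R / 4\<close> the distance to \<open>\<zeta>\<close>
  is at least \<open>R / 4\<close>, so the quotient is at most \<open>2 * M / (R / 4)\<close>; the
  maximum principle carries this inwards across the removable singularity.\<close>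

lemma divided_difference_bound:
  assumes J: "J holomorphic_on ball a R" "\<And>z. z \<in> ball a R \<Longrightarrow> norm (J z) \<le> M" and R: "0 < R"
    and \<zeta>: "\<zeta> \<in> ball a (R/2)"
  obtains D where "D holomorphic_on ball a R" "\<And>z. z \<noteq> \<zeta> \<Longrightarrow> D z = (J z - J \<zeta>) / (z - \<zeta>)"
    "\<And>z. z \<in> ball a (R/4) \<Longrightarrow> norm (D z) \<le> 8 * M / R"
proof -
  define D where "D z = (if z = \<zeta> then deriv J \<zeta> else (J z - J \<zeta>) / (z - \<zeta>))" for z
  have \<zeta>R: "\<zeta> \<in> ball a R" using \<zeta> R by auto
  have Dhol: "D holomorphic_on ball a R"
    unfolding D_def[abs_def] using \<zeta>R by (intro pole_lemma J) (simp add: interior_open)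
  have sub: "cball a (3 * R / 4) \<subseteq> ball a R" using R by auto
  have "norm (D z) \<le> 8 * M / R" if z: "z \<in> ball a (R/4)" for z
  proof (rule maximum_modulus_frontier[of D "cball a (3 * R / 4)"])
    show "D holomorphic_on interior (cball a (3 * R / 4))"
      by (rule holomorphic_on_subset[OF Dhol]) (use sub interior_subset in blast)
    show "continuous_on (closure (cball a (3 * R / 4))) D"
      using sub by (intro holomorphic_on_imp_continuous_on holomorphic_on_subset[OF Dhol]) simp
    show "z \<in> cball a (3 * R / 4)" using z R by auto
    fix u assume "u \<in> frontier (cball a (3 * R / 4))"
    then have u: "dist a u = 3 * R / 4" using R by simp
    then have uR: "u \<in> ball a R" using R by simp
    have d: "R / 4 \<le> norm (u - \<zeta>)"
      using u \<zeta> dist_triangle[of a u \<zeta>] by (simp add: dist_norm norm_minus_commute)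
    then have "u \<noteq> \<zeta>" using R by auto
    then have "norm (D u) = norm (J u - J \<zeta>) / norm (u - \<zeta>)" by (simp add: D_def norm_divide)
    also have "\<dots> \<le> (M + M) / (R / 4)"
      using J(2)[OF uR] J(2)[OF \<zeta>R] norm_triangle_ineq4[of "J u" "J \<zeta>"] d R
        order_trans[OF norm_ge_zero J(2)[OF uR]] by (intro frac_le) auto
    also have "\<dots> = 8 * M / R" by simp
    finally show "norm (D u) \<le> 8 * M / R" .
  qed simp
  moreover have "D z = (J z - J \<zeta>) / (z - \<zeta>)" if "z \<noteq> \<zeta>" for z using that by (simp add: D_def)
  ultimately show ?thesis by (intro that[OF Dhol])
qed

text \<open>The conjugate of the reproducing kernel at \<open>z\<close>; \<open>b\<close> stands for the boundary value of the inner
  function at \<open>\<zeta>\<close>. The singularity at \<open>z = \<zeta>\<close> is removable.\<close>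

lemma model_kernel_extends:
  assumes J: "J holomorphic_on ball a R" "\<And>z. z \<in> ball a R \<Longrightarrow> norm (J z) \<le> M" and R: "0 < R"
    and \<zeta>: "norm \<zeta> = 1" and b: "norm b = 1" "\<zeta> \<in> ball a R \<Longrightarrow> b = J \<zeta>"
  obtains H where "H holomorphic_on ball a (R/4)" "\<And>z. z \<in> ball a (R/4) \<Longrightarrow> norm (H z) \<le> 8 * (1 + M) / R"
    "\<And>z. \<lbrakk>z \<in> ball a (R/4); norm z < 1\<rbrakk> \<Longrightarrow> H z = (1 - J z * cnj b) / (1 - z * cnj \<zeta>)"
proof -
  have M: "0 \<le> M" using order_trans[OF norm_ge_zero J(2)[of a]] R by simp
  have sub: "ball a (R/4) \<subseteq> ball a R" using R by auto
  have \<zeta>\<zeta>: "\<zeta> * cnj \<zeta> = 1" and bb: "b * cnj b = 1"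
    using \<zeta> b(1) complex_norm_square[of \<zeta>] complex_norm_square[of b] by simp_all
  have den: "1 - z * cnj \<zeta> = cnj \<zeta> * (\<zeta> - z)" for z
    using \<zeta>\<zeta> by (simp add: right_diff_distrib mult.commute)
  show ?thesis
  \<comment> \<open>For \<open>\<zeta>\<close> close to \<open>a\<close>,
    \<open>b = J \<zeta>\<close> and unimodularity turn the kernel into a divided difference of
    \<open>J\<close>; otherwise its denominator is at least \<open>R / 4\<close>.\<close>
  proof (cases "\<zeta> \<in> ball a (R/2)")
    case True
    then have bJ: "b = J \<zeta>" using b(2) R by auto
    obtain D where D: "D holomorphic_on ball a R" "\<And>z. z \<noteq> \<zeta> \<Longrightarrow> D z = (J z - J \<zeta>) / (z - \<zeta>)"
      "\<And>z. z \<in> ball a (R/4) \<Longrightarrow> norm (D z) \<le> 8 * M / R"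
      by (rule divided_difference_bound[OF J R True]) (assumption | rule that)+
    show ?thesis
    proof (rule that[of "\<lambda>z. cnj b * \<zeta> * D z"])
      show "(\<lambda>z. cnj b * \<zeta> * D z) holomorphic_on ball a (R/4)"
        by (intro holomorphic_intros holomorphic_on_subset[OF D(1) sub])
      fix z assume z: "z \<in> ball a (R/4)"
      have "norm (cnj b * \<zeta> * D z) \<le> 8 * M / R" using D(3)[OF z] \<zeta> b(1) by (simp add: norm_mult)
      also have "\<dots> \<le> 8 * (1 + M) / R" using R by (intro divide_right_mono) auto
      finally show "norm (cnj b * \<zeta> * D z) \<le> 8 * (1 + M) / R" .
      assume "norm z < 1"
      then have ne: "z \<noteq> \<zeta>" using \<zeta> by auto
      have num: "1 - J z * cnj b = cnj b * (b - J z)" using bb by (simp add: algebra_simps)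
      have "(1 - J z * cnj b) / (1 - z * cnj \<zeta>) = (\<zeta> * cnj b * (b - J z)) / (\<zeta> * cnj \<zeta> * (\<zeta> - z))"
        unfolding num den using \<zeta> by (auto simp: mult.assoc)
      also have "\<dots> = cnj b * \<zeta> * D z"
        unfolding \<zeta>\<zeta> D(2)[OF ne] bJ using ne by (simp add: divide_simps) (simp add: algebra_simps)
      finally show "cnj b * \<zeta> * D z = (1 - J z * cnj b) / (1 - z * cnj \<zeta>)" ..
    qed
  next
    case False
    have far: "R / 4 \<le> norm (1 - z * cnj \<zeta>)" if z: "z \<in> ball a (R/4)" for z
    proof -
      have "R / 4 \<le> norm (\<zeta> - z)" using z False dist_triangle[of a \<zeta> z] R by (simp add: dist_norm norm_minus_commute)
      then show ?thesis unfolding den using \<zeta> by (simp add: norm_mult)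
    qed
    show ?thesis
    proof (rule that[of "\<lambda>z. (1 - J z * cnj b) / (1 - z * cnj \<zeta>)"])
      show "(\<lambda>z. (1 - J z * cnj b) / (1 - z * cnj \<zeta>)) holomorphic_on ball a (R/4)"
      proof (intro holomorphic_intros holomorphic_on_subset[OF J(1) sub])
        fix z assume "z \<in> ball a (R/4)"
        from far[OF this] R show "1 - z * cnj \<zeta> \<noteq> 0" by auto
      qed
      fix z assume z: "z \<in> ball a (R/4)"
      have "norm (1 - J z * cnj b) \<le> 1 + M"
        using norm_triangle_ineq4[of 1 "J z * cnj b"] J(2)[of z] z sub b(1) by (auto simp: norm_mult)
      then have "norm ((1 - J z * cnj b) / (1 - z * cnj \<zeta>)) \<le> (1 + M) / (R / 4)"
        unfolding norm_divide using far[OF z] R M by (intro frac_le) auto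
      also have "\<dots> \<le> 8 * (1 + M) / R" using R M by (simp add: field_simps)
      finally show "norm ((1 - J z * cnj b) / (1 - z * cnj \<zeta>)) \<le> 8 * (1 + M) / R" .
    qed auto
  qed
qed

text \<open>Cauchy's inequality on disks of radius \<open>s / 2\<close> around points of
  \<open>ball a s\<close>, which stay inside \<open>ball a (2 * s)\<close>.\<close>

lemma holomorphic_bounded_lipschitz:
  assumes H: "H holomorphic_on ball a (2 * s)" "\<And>z. z \<in> ball a (2 * s) \<Longrightarrow> norm (H z) \<le> C" and s: "0 < s"
    and z: "z \<in> ball a s" "w \<in> ball a s"
  shows "norm (H z - H w) \<le> 2 * C / s * norm (z - w)"
proof (rule field_differentiable_bound[of "ball a s" H "deriv H"])
  fix u assume u: "u \<in> ball a s"
  have sub: "cball u (s/2) \<subseteq> ball a (2 * s)"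
  proof
    fix x assume "x \<in> cball u (s/2)"
    then show "x \<in> ball a (2 * s)" using u dist_triangle[of a x u] s by simp
  qed
  show "(H has_field_derivative deriv H u) (at u within ball a s)"
    using u s by (intro has_field_derivative_at_within[OF holomorphic_derivI[OF H(1) open_ball]]) simp
  have "norm ((deriv ^^ 1) H u) \<le> fact 1 * C / (s/2) ^ 1"
  proof (rule Cauchy_inequality)
    show "H holomorphic_on ball u (s/2)" by (rule holomorphic_on_subset[OF H(1) order_trans[OF ball_subset_cball sub]])
    show "continuous_on (cball u (s/2)) H" by (intro holomorphic_on_imp_continuous_on holomorphic_on_subset[OF H(1)] sub)
    show "norm (H x) \<le> C" if "norm (u - x) = s/2" for x
    proof (rule H(2), rule subsetD[OF sub])
      show "x \<in> cball u (s/2)" using that by (simp add: dist_norm)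
    qed
  qed (use s in simp)
  then show "norm (deriv H u) \<le> 2 * C / s" by (simp add: mult.commute)
qed (use z in simp_all)

section \<open>Conjugate pairs and the reproducing formula\<close>

context outer_weight
begin

text \<open>\<open>hs\<close> is the boundary conjugate of \<open>h\<close>. The quantitative bound
  \<open>N\<close> is that of \<open>h\<close>; some bound for \<open>hs\<close> is what the Cauchy
  formulas ask of it.\<close>

definition model_pair :: "(complex \<Rightarrow> complex) \<Rightarrow> real \<Rightarrow> (complex \<Rightarrow> complex) \<Rightarrow> (complex \<Rightarrow> complex) \<Rightarrow> bool" where
  "model_pair I N h hs \<longleftrightarrow> 0 < N \<and> hardy_bound N h \<and> (\<exists>N'>0. hardy_bound N' hs) \<and>
     has_boundary_values h \<and> has_boundary_values hs \<and>
     (AE t in circ. boundary_value hs t = boundary_value I t * cnj (cis t) * cnj (boundary_value h t))"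

lemma inner_AE_norm:
  fixes I :: "complex \<Rightarrow> complex"
  assumes "inner_function I"
  shows "AE t in circ. norm (boundary_value I t) = 1"
proof -
  have "AE t in circ. \<exists>l. has_radial_limit I (cis t) l \<and> norm l = 1"
    using assms by (simp add: inner_function_def)
  then show ?thesis
  proof eventually_elim
    case (elim t)
    then obtain l where "has_radial_limit I (cis t) l" "norm l = 1" by blast
    then show ?case by (simp add: boundary_value_eq)
  qed
qed

lemma integral_norm_bound_AE:
  fixes f :: "real \<Rightarrow> complex"
  assumes "integrable M f" "integrable M u" "AE t in M. norm (f t) \<le> u t"
  shows "norm (LINT t|M. f t) \<le> (LINT t|M. u t)"
  by (rule order_trans[OF integral_norm_bound integral_mono_AE]) (use assms in auto)

text \<open>\<open>1 / (1 - z * cnj (cis t))\<close> is the Cauchy kernel and reproduces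
  \<open>h z\<close>. In the remaining term, the conjugate of \<open>I\<close> times
  \<open>h\<close> is by the pairing the conjugate of \<open>cis t * boundary_value hs t\<close>,
  whose integral against \<open>1 / (1 - cnj z * cis t)\<close> vanishes.\<close>

lemma model_kernel_integral:
  fixes I h hs :: "complex \<Rightarrow> complex"
  assumes I: "inner_function I" and h: "model_pair I N h hs" and z: "norm z < 1"
  defines "k \<equiv> \<lambda>t. boundary_value h t * ((1 - I z * cnj (boundary_value I t)) / (1 - z * cnj (cis t)))"
  shows "integrable circ k" "(LINT t|circ. k t) = 2 * pi * h z"
proof -
  obtain N' where hs: "hardy_bound N' hs" "0 < N'" "has_boundary_values hs"
    using h by (auto simp: model_pair_def)
  have hh: "hardy_bound N h" "0 < N" "has_boundary_values h" using h by (auto simp: model_pair_def)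
  have rel: "AE t in circ. boundary_value hs t = boundary_value I t * cnj (cis t) * cnj (boundary_value h t)"
    using h by (auto simp: model_pair_def)
  have cz: "norm (cnj z) < 1" using z by simp
  have cc: "cis t * cnj (cis t) = 1" for t by (simp add: cis_cnj cis_mult)
  have k1: "1 / (1 - z * cnj (cis t)) = cis t / (cis t - z)" for t
  proof -
    have "cis t - z = cis t * (1 - z * cnj (cis t))" using cc[of t] by (simp add: algebra_simps)
    then show ?thesis by simp
  qed
  let ?u = "\<lambda>t. boundary_value h t * (cis t / (cis t - z))"
  let ?v = "\<lambda>t. cnj (boundary_value hs t * (cis t / (1 - cnj z * cis t)))"
  have i1: "integrable circ ?u"
    using integrable_circ_mult_cont[of "\<lambda>t. cis t / (cis t - z)", OF _ hardy_bound_L1(1)[OF hh]] cis_neq[OF z]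
    by (simp add: mult.commute continuous_intros)
  have ne: "1 - cnj z * cis t \<noteq> 0" for t
    using cz by (metis eq_iff_diff_eq_0 less_irrefl norm_cis norm_mult norm_one mult.right_neutral)
  have "integrable circ (\<lambda>t. boundary_value hs t * (cis t / (1 - cnj z * cis t)))"
    using integrable_circ_mult_cont[of "\<lambda>t. cis t / (1 - cnj z * cis t)", OF _ hardy_bound_L1(1)[OF hs]] ne
    by (simp add: mult.commute continuous_intros)
  from integrable_bounded_linear[OF bounded_linear_cnj this] have i2: "integrable circ ?v" .
  have [measurable]: "boundary_value h \<in> borel_measurable circ" "boundary_value I \<in> borel_measurable circ"
    using hh I by (auto intro!: boundary_value_measurable simp: hardy_bound_def inner_function_def)
  have km: "k \<in> borel_measurable circ" unfolding k_def
  proof (intro borel_measurable_times borel_measurable_divide borel_measurable_diff)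
    show "(\<lambda>t. cnj (boundary_value I t)) \<in> borel_measurable circ" "(\<lambda>t. cnj (cis t)) \<in> borel_measurable circ"
      by (auto intro!: borel_measurable_continuous_on[where f=cnj] continuous_intros)
  qed auto
  have eq: "AE t in circ. k t = ?u t - I z * ?v t"
    using rel
  proof eventually_elim
    case (elim t)
    have "?v t = cnj (boundary_value I t) * boundary_value h t * (cis t * cnj (cis t)) / (1 - z * cnj (cis t))"
      unfolding elim by (simp add: mult_ac)
    then have v: "?v t = cnj (boundary_value I t) * boundary_value h t * (1 / (1 - z * cnj (cis t)))"
      unfolding cc by simp
    show ?case unfolding k_def v k1[symmetric] by (simp add: divide_inverse algebra_simps)
  qed
  have i3: "integrable circ (\<lambda>t. ?u t - I z * ?v t)"
    using i1 i2 by (intro Bochner_Integration.integrable_diff integrable_mult_right) auto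
  have "(\<lambda>t. ?u t - I z * ?v t) \<in> borel_measurable circ" using i3 by auto
  then show "integrable circ k" using integrable_cong_AE[OF km _ eq] i3 by auto
  have "(LINT t|circ. k t) = (LINT t|circ. ?u t - I z * ?v t)"
    using km i3 eq by (intro integral_cong_AE) auto
  also have "\<dots> = (LINT t|circ. ?u t) - I z * (LINT t|circ. ?v t)"
    by (subst Bochner_Integration.integral_diff[OF i1 integrable_mult_right[OF i2]]) (simp only: integral_mult_right_zero)
  also have "(LINT t|circ. ?v t) = cnj (LINT t|circ. boundary_value hs t * (cis t / (1 - cnj z * cis t)))"
    by (rule Bochner_Integration.integral_cnj)
  also have "\<dots> = 0" unfolding hardy_orthogonal[OF hs cz] by simp
  finally show "(LINT t|circ. k t) = 2 * pi * h z" using hardy_Cauchy[OF hh z] by simp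
qed

text \<open>Bounds on the kernel that are uniform over the circle are integrated against boundary
  values of \<open>L1\<close> norm at most \<open>L1_const * N\<close>. The constants do not depend
  on the pair, as a lower bound for the operator requires.\<close>

lemma model_pair_local_bounds:
  fixes I :: "complex \<Rightarrow> complex" and a :: complex
  assumes I: "inner_function I" and a: "norm a < 1 \<or> norm a = 1 \<and> a \<notin> inner_spectrum I"
  obtains \<rho> C where "0 < \<rho>" "0 < C"
    "\<And>N h hs z. \<lbrakk>model_pair I N h hs; z \<in> ball a \<rho>; norm z < 1\<rbrakk> \<Longrightarrow> norm (h z) \<le> C * N"
    "\<And>N h hs z w. \<lbrakk>model_pair I N h hs; z \<in> ball a \<rho>; norm z < 1; w \<in> ball a \<rho>; norm w < 1\<rbrakk> \<Longrightarrow>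
        norm (h z - h w) \<le> C * N * norm (z - w)"
proof -
  obtain J R M where R: "0 < R" and J: "J holomorphic_on ball a R" "\<And>z. z \<in> ball a R \<Longrightarrow> norm (J z) \<le> M"
    and JI: "\<And>z. \<lbrakk>z \<in> ball a R; norm z < 1\<rbrakk> \<Longrightarrow> J z = I z"
    and Jb: "\<And>t. cis t \<in> ball a R \<Longrightarrow> has_radial_limit I (cis t) (J (cis t))"
    by (rule inner_local_extension[OF I a]) (rule that)
  \<comment> \<open>\<open>2 * s\<close> is \<open>R / 4\<close>, the radius to which the kernels
    extend, which leaves room for the Lipschitz estimate on \<open>ball a s\<close>.\<close>
  define s where "s = R / 8"
  have s: "0 < s" using R by (simp add: s_def)
  have M: "0 \<le> M" using order_trans[OF norm_ge_zero J(2)[of a]] R by simp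
  define C0 where "C0 = 8 * (1 + M) / R"
  have C0: "0 < C0" using R M by (simp add: C0_def)
  define C where "C = (C0 + 2 * C0 / s) * L1_const"
  have Cpos: "0 < C" using C0 s L1_const_pos by (simp add: C_def add_pos_pos)
  let ?k = "\<lambda>z t. (1 - I z * cnj (boundary_value I t)) / (1 - z * cnj (cis t))"
  have k: "AE t in circ. (\<forall>z. z \<in> ball a s \<longrightarrow> norm z < 1 \<longrightarrow> norm (?k z t) \<le> C0) \<and>
     (\<forall>z w. z \<in> ball a s \<longrightarrow> norm z < 1 \<longrightarrow> w \<in> ball a s \<longrightarrow> norm w < 1 \<longrightarrow> norm (?k z t - ?k w t) \<le> 2 * C0 / s * norm (z - w))"
    using inner_AE_norm[OF I]
  proof eventually_elim
    case (elim t)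
    have bI: "cis t \<in> ball a R \<Longrightarrow> boundary_value I t = J (cis t)" by (rule boundary_value_eq[OF Jb])
    obtain H where H: "H holomorphic_on ball a (R/4)" "\<And>z. z \<in> ball a (R/4) \<Longrightarrow> norm (H z) \<le> 8 * (1 + M) / R"
      "\<And>z. \<lbrakk>z \<in> ball a (R/4); norm z < 1\<rbrakk> \<Longrightarrow> H z = (1 - J z * cnj (boundary_value I t)) / (1 - z * cnj (cis t))"
      by (rule model_kernel_extends[OF J R norm_cis elim, of t]) (assumption | erule bI | rule that)+
    have Hk: "?k z t = H z" if "z \<in> ball a s" "norm z < 1" for z
    proof -
      have "z \<in> ball a (R/4)" "z \<in> ball a R" using that R by (auto simp: s_def)
      then show ?thesis using H(3)[of z] JI[of z] that by simp
    qed
    have R4: "R / 4 = 2 * s" by (simp add: s_def)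
    have b1: "norm (H z) \<le> C0" if "z \<in> ball a s" for z
      unfolding C0_def by (rule H(2)) (use that R in \<open>auto simp: s_def\<close>)
    have b2: "norm (H z - H w) \<le> 2 * C0 / s * norm (z - w)" if "z \<in> ball a s" "w \<in> ball a s" for z w
      by (rule holomorphic_bounded_lipschitz[OF H(1)[unfolded R4] _ s that]) (use H(2) in \<open>simp add: R4 C0_def\<close>)
    show ?case
    proof (intro conjI allI impI)
      show "norm (?k z t) \<le> C0" if "z \<in> ball a s" "norm z < 1" for z
        unfolding Hk[OF that] by (rule b1[OF that(1)])
      show "norm (?k z t - ?k w t) \<le> 2 * C0 / s * norm (z - w)"
        if "z \<in> ball a s" "norm z < 1" "w \<in> ball a s" "norm w < 1" for z w
        unfolding Hk[OF that(1,2)] Hk[OF that(3,4)] by (rule b2[OF that(1,3)])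
    qed
  qed
  show ?thesis
  proof (rule that[OF s Cpos])
    fix N h hs z assume h: "model_pair I N h hs" and z: "z \<in> ball a s" "norm z < 1"
    have hh: "hardy_bound N h" "0 < N" "has_boundary_values h" using h by (auto simp: model_pair_def)
    note bL = hardy_bound_L1[OF hh]
    note kz = model_kernel_integral[OF I h z(2)]
    have "1 * norm (h z) \<le> 2 * pi * norm (h z)" using pi_gt3 by (intro mult_right_mono) auto
    then have "norm (h z) \<le> norm (LINT t|circ. boundary_value h t * ?k z t)"
      unfolding kz(2) by (simp add: norm_mult)
    also have "\<dots> \<le> (LINT t|circ. C0 * norm (boundary_value h t))"
    proof (rule integral_norm_bound_AE[OF kz(1)])
      show "AE t in circ. norm (boundary_value h t * ?k z t) \<le> C0 * norm (boundary_value h t)"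
        using k
      proof eventually_elim
        case (elim t)
        then have "norm (?k z t) \<le> C0" using z by blast
        then show ?case unfolding norm_mult[of "boundary_value h t"] by (metis mult.commute mult_right_mono norm_ge_zero)
      qed
    qed (use bL(1) in auto)
    also have "\<dots> = C0 * (LINT t|circ. norm (boundary_value h t))" by simp
    also have "\<dots> \<le> (C0 + 2 * C0 / s) * (L1_const * N)"
      using bL(2) C0 s by (intro mult_mono) auto
    finally show "norm (h z) \<le> C * N" by (simp add: C_def mult.assoc)
  next
    fix N h hs z w assume h: "model_pair I N h hs" and z: "z \<in> ball a s" "norm z < 1" and w: "w \<in> ball a s" "norm w < 1"
    have hh: "hardy_bound N h" "0 < N" "has_boundary_values h" using h by (auto simp: model_pair_def)
    note bL = hardy_bound_L1[OF hh]
    note kz = model_kernel_integral[OF I h z(2)] and kw = model_kernel_integral[OF I h w(2)]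
    have "1 * norm (h z - h w) \<le> 2 * pi * norm (h z - h w)" using pi_gt3 by (intro mult_right_mono) auto
    also have "\<dots> = norm (2 * pi * h z - 2 * pi * h w)"
      by (simp add: norm_mult flip: right_diff_distrib)
    also have "2 * pi * h z - 2 * pi * h w = (LINT t|circ. boundary_value h t * ?k z t - boundary_value h t * ?k w t)"
      using kz kw by simp
    also have "norm \<dots> \<le> (LINT t|circ. 2 * C0 / s * norm (z - w) * norm (boundary_value h t))"
    proof (rule integral_norm_bound_AE[OF Bochner_Integration.integrable_diff[OF kz(1) kw(1)]])
      show "AE t in circ. norm (boundary_value h t * ?k z t - boundary_value h t * ?k w t) \<le> 2 * C0 / s * norm (z - w) * norm (boundary_value h t)"
        using k
      proof eventually_elim
        case (elim t)
        then have "norm (?k z t - ?k w t) \<le> 2 * C0 / s * norm (z - w)" using z w by blast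
        then show ?case unfolding right_diff_distrib[symmetric] norm_mult[of "boundary_value h t"]
          by (metis mult.commute mult_right_mono norm_ge_zero)
      qed
    qed (use bL(1) in auto)
    also have "\<dots> = 2 * C0 / s * norm (z - w) * (LINT t|circ. norm (boundary_value h t))" by simp
    also have "\<dots> \<le> ((C0 + 2 * C0 / s) * norm (z - w)) * (L1_const * N)"
      using bL(2) C0 s by (intro mult_mono mult_right_mono) auto
    finally show "norm (h z - h w) \<le> C * N * norm (z - w)" by (simp add: C_def mult_ac)
  qed
qed

lemma hardy_point_bound:
  fixes F :: "complex \<Rightarrow> complex"
  assumes F: "hardy_bound N F" and N: "0 < N" and bv: "has_boundary_values F" and z: "norm z < 1"
  shows "norm (F z) \<le> (LINT t|circ. norm (boundary_value F t)) / (1 - norm z)"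
proof -
  note bL = hardy_bound_L1(1)[OF F N bv]
  have "1 * norm (F z) \<le> 2 * pi * norm (F z)" using pi_gt3 by (intro mult_right_mono) auto
  then have "norm (F z) \<le> norm (LINT t|circ. boundary_value F t * (cis t / (cis t - z)))"
    unfolding hardy_Cauchy[OF F N bv z] by (simp add: norm_mult)
  also have "\<dots> \<le> (LINT t|circ. norm (boundary_value F t) / (1 - norm z))"
  proof (rule integral_norm_bound_AE)
    show "integrable circ (\<lambda>t. boundary_value F t * (cis t / (cis t - z)))"
      using integrable_circ_mult_cont[of "\<lambda>t. cis t / (cis t - z)", OF _ bL] cis_neq[OF z]
      by (simp add: mult.commute continuous_intros)
    show "AE t in circ. norm (boundary_value F t * (cis t / (cis t - z))) \<le> norm (boundary_value F t) / (1 - norm z)"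
    proof (intro AE_I2)
      fix t
      have "norm (boundary_value F t) / norm (cis t - z) \<le> norm (boundary_value F t) / (1 - norm z)"
        using cis_diff_ge[of z t] z by (intro divide_left_mono mult_pos_pos) auto
      then show "norm (boundary_value F t * (cis t / (cis t - z))) \<le> norm (boundary_value F t) / (1 - norm z)"
        by (simp add: norm_mult norm_divide)
    qed
  qed (use bL in auto)
  finally show ?thesis by simp
qed

text \<open>The bound \<open>N\<close> of \<open>h\<close> serves for \<open>hs\<close> because \<open>|hs| = |h|\<close> on the circle.\<close>

lemma model_pair_conjugate_bound:
  fixes I :: "complex \<Rightarrow> complex"
  assumes I: "inner_function I" and h: "model_pair I N h hs" and z: "norm z < 1"
  shows "norm (hs z) \<le> L1_const * N / (1 - norm z)"
proof -
  obtain N' where hs: "hardy_bound N' hs" "0 < N'" "has_boundary_values hs"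
    using h by (auto simp: model_pair_def)
  have hh: "hardy_bound N h" "0 < N" "has_boundary_values h" using h by (auto simp: model_pair_def)
  have rel: "AE t in circ. boundary_value hs t = boundary_value I t * cnj (cis t) * cnj (boundary_value h t)"
    using h by (auto simp: model_pair_def)
  have "AE t in circ. norm (boundary_value hs t) = norm (boundary_value h t)"
    using rel inner_AE_norm[OF I] by eventually_elim (simp add: norm_mult)
  then have "(LINT t|circ. norm (boundary_value hs t)) = (LINT t|circ. norm (boundary_value h t))"
    using hardy_bound_L1(1)[OF hs] hardy_bound_L1(1)[OF hh] by (intro integral_cong_AE) auto
  also have "\<dots> \<le> L1_const * N" by (rule hardy_bound_L1(2)[OF hh])
  finally show ?thesis
    using z by (intro order_trans[OF hardy_point_bound[OF hs z]] divide_right_mono) auto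
qed

end

section \<open>Lower bounds for the shifted operator\<close>

context outer_weight
begin

text \<open>With \<open>a = 1 / \<mu>\<close>, the function \<open>f 0 - z * h z = f z * (1 - \<mu> * z)\<close> vanishes at \<open>a\<close> (in the limit
  if \<open>a\<close> is on the circle) because \<open>f\<close> is bounded near \<open>a\<close>.\<close>

lemma resolvent_bound_outside:
  fixes I :: "complex \<Rightarrow> complex" and \<mu> :: complex
  assumes I: "inner_function I" and \<mu>: "1 \<le> norm \<mu>" "norm \<mu> = 1 \<Longrightarrow> cnj \<mu> \<notin> inner_spectrum I"
  obtains K where "0 < K"
    "\<And>f fs h hs N Nf (z::complex). \<lbrakk>f holomorphic_on ball 0 1; model_pair I Nf f fs; model_pair I N h hs;
       \<forall>z. norm z < 1 \<longrightarrow> f z * (1 - \<mu> * z) = f 0 - z * h z; norm z < 1\<rbrakk> \<Longrightarrow> norm (f z) \<le> K * (N + norm (h z))"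
proof -
  define a where "a = 1 / \<mu>"
  have \<mu>0: "\<mu> \<noteq> 0" using \<mu>(1) by auto
  then have \<mu>a: "\<mu> * a = 1" by (simp add: a_def)
  have na: "norm a = 1 / norm \<mu>" by (simp add: a_def norm_divide)
  have na1: "norm a \<le> 1" using \<mu>(1) by (simp add: na divide_le_eq)
  have aI: "norm a < 1 \<or> norm a = 1 \<and> a \<notin> inner_spectrum I"
  proof (cases "norm \<mu> = 1")
    case True
    then have "\<mu> * cnj \<mu> = 1" using complex_norm_square[of \<mu>] by simp
    then have "a = cnj \<mu>" using \<mu>0 by (simp add: a_def field_simps)
    then show ?thesis using \<mu>(2)[OF True] na True by simp
  next
    case False
    then have "1 < norm \<mu>" using \<mu>(1) by simp
    then show ?thesis unfolding na by (simp add: divide_less_eq)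
  qed
  obtain \<rho> C where \<rho>: "0 < \<rho>" and C: "0 < C"
    and Cb: "\<And>N h hs z. \<lbrakk>model_pair I N h hs; z \<in> ball a \<rho>; norm z < 1\<rbrakk> \<Longrightarrow> norm (h z) \<le> C * N"
    and Cl: "\<And>N h hs z w. \<lbrakk>model_pair I N h hs; z \<in> ball a \<rho>; norm z < 1; w \<in> ball a \<rho>; norm w < 1\<rbrakk> \<Longrightarrow>
        norm (h z - h w) \<le> C * N * norm (z - w)"
    by (rule model_pair_local_bounds[OF I aI]) (rule that)
  \<comment> \<open>\<open>2 * C\<close> is the bound near \<open>a\<close>;
    \<open>(C + 1) / \<rho>\<close> is the bound elsewhere, where
    \<open>norm (1 - \<mu> * z) \<ge> \<rho>\<close>.\<close>
  define K where "K = 2 * C + (C + 1) / \<rho>"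
  have K: "0 < K" using C \<rho> by (simp add: K_def add_pos_pos)
  show ?thesis
  proof (rule that[OF K])
    fix f fs h hs :: "complex \<Rightarrow> complex" and N Nf :: real and z :: complex
    assume fhol: "f holomorphic_on ball 0 1" and fp: "model_pair I Nf f fs" and hp: "model_pair I N h hs"
      and feq': "\<forall>z. norm z < 1 \<longrightarrow> f z * (1 - \<mu> * z) = f 0 - z * h z" and z: "norm z < (1::real)"
    note feq = feq'[rule_format]
    have N: "0 < N" using hp by (simp add: model_pair_def)
    \<comment> \<open>These points stay in the disk even if \<open>a\<close> is on the circle, and
      they never equal \<open>a\<close>.\<close>
    define w where "w n = of_real (rad n) * a" for n
    have nw: "norm (w n) < 1" for n
    proof -
      have "norm (w n) = rad n * norm a" using rad_pos[of n] by (simp add: w_def norm_mult)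
      also have "\<dots> \<le> rad n * 1" using rad_pos[of n] na1 by (intro mult_left_mono) auto
      finally show ?thesis using rad_less[of n] by simp
    qed
    have wlim: "w \<longlonglongrightarrow> a"
    proof -
      have "w \<longlonglongrightarrow> of_real 1 * a" unfolding w_def by (intro tendsto_intros rad_tendsto)
      then show ?thesis by simp
    qed
    have wball: "\<forall>\<^sub>F n in sequentially. w n \<in> ball a \<rho>"
      by (rule topological_tendstoD[OF wlim]) (use \<rho> in auto)
    have wa: "w n \<noteq> a" for n
    proof
      assume "w n = a"
      then have "\<mu> * (of_real (rad n) * a) = 1" unfolding w_def by (simp only: \<mu>a)
      then have "of_real (rad n) * (\<mu> * a) = 1" by (simp only: mult_ac)
      then have "of_real (rad n) = (1::complex)" unfolding \<mu>a by simp
      then show False using rad_less[of n] by simp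
    qed
    define G where "G z = f 0 - z * h z" for z
    have Gf: "G u = f u * (1 - \<mu> * u)" if "norm u < 1" for u using feq[OF that] by (simp add: G_def)
    have fac: "1 - \<mu> * u = \<mu> * (a - u)" for u using \<mu>a by (simp add: right_diff_distrib)
    have Gw: "(\<lambda>n. G (w n)) \<longlonglongrightarrow> 0"
    proof (rule Lim_null_comparison)
      show "\<forall>\<^sub>F n in sequentially. norm (G (w n)) \<le> C * Nf * norm (1 - \<mu> * w n)"
        using wball
      proof eventually_elim
        case (elim n)
        have "norm (f (w n)) * norm (1 - \<mu> * w n) \<le> C * Nf * norm (1 - \<mu> * w n)"
          by (intro mult_right_mono Cb[OF fp elim nw]) simp
        then show ?case unfolding Gf[OF nw] norm_mult by simp
      qed
      have "(\<lambda>n. C * Nf * norm (1 - \<mu> * w n)) \<longlonglongrightarrow> C * Nf * norm (1 - \<mu> * a)"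
        by (intro tendsto_intros wlim)
      then show "(\<lambda>n. C * Nf * norm (1 - \<mu> * w n)) \<longlonglongrightarrow> 0" by (simp add: \<mu>a)
    qed
    \<comment> \<open>\<open>f 0\<close> is \<open>G (w n) + w n * h (w n)\<close>, where the first
      term tends to 0 and the second is at most \<open>C * N\<close>: the uncontrolled bound
      \<open>Nf\<close> of \<open>f\<close> has disappeared.\<close>
    have f0: "norm (f 0) \<le> C * N"
    proof (rule tendsto_lowerbound)
      have "(\<lambda>n. norm (G (w n)) + C * N) \<longlonglongrightarrow> 0 + C * N"
        using tendsto_norm[OF Gw] by (intro tendsto_intros) simp
      then show "(\<lambda>n. norm (G (w n)) + C * N) \<longlonglongrightarrow> C * N" by simp
      show "\<forall>\<^sub>F n in sequentially. norm (f 0) \<le> norm (G (w n)) + C * N"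
        using wball
      proof eventually_elim
        case (elim n)
        have "norm (f 0) = norm (G (w n) + w n * h (w n))" by (simp add: G_def)
        also have "\<dots> \<le> norm (G (w n)) + norm (w n) * norm (h (w n))"
          using norm_triangle_ineq[of "G (w n)" "w n * h (w n)"] by (simp add: norm_mult)
        also have "norm (w n) * norm (h (w n)) \<le> 1 * (C * N)"
          using nw[of n] Cb[OF hp elim nw] by (intro mult_mono) auto
        finally show ?case by simp
      qed
    qed simp
    have Gz: "norm (G u) \<le> 2 * C * N * norm (u - a)" if u: "u \<in> ball a \<rho>" "norm u < 1" for u
    proof (rule tendsto_lowerbound)
      have "(\<lambda>n. norm (G (w n)) + 2 * C * N * norm (u - w n)) \<longlonglongrightarrow> norm (0::complex) + 2 * C * N * norm (u - a)"
        by (intro tendsto_intros Gw wlim)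
      then show "(\<lambda>n. norm (G (w n)) + 2 * C * N * norm (u - w n)) \<longlonglongrightarrow> 2 * C * N * norm (u - a)" by simp
      show "\<forall>\<^sub>F n in sequentially. norm (G u) \<le> norm (G (w n)) + 2 * C * N * norm (u - w n)"
        using wball
      proof eventually_elim
        case (elim n)
        have "G u = G (w n) - ((u - w n) * h u + w n * (h u - h (w n)))"
          by (simp add: G_def algebra_simps)
        then have "norm (G u) \<le> norm (G (w n)) + norm ((u - w n) * h u + w n * (h u - h (w n)))"
          by (simp add: norm_triangle_ineq4)
        also have "norm ((u - w n) * h u + w n * (h u - h (w n))) \<le> norm (u - w n) * norm (h u) + norm (w n) * norm (h u - h (w n))"
          using norm_triangle_ineq[of "(u - w n) * h u" "w n * (h u - h (w n))"] by (simp add: norm_mult)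
        also have "norm (u - w n) * norm (h u) \<le> norm (u - w n) * (C * N)"
          by (intro mult_left_mono Cb[OF hp u]) simp
        also have "norm (w n) * norm (h u - h (w n)) \<le> 1 * (C * N * norm (u - w n))"
          using nw[of n] Cl[OF hp u elim nw] by (intro mult_mono) auto
        finally show ?case by (simp add: algebra_simps)
      qed
    qed simp
    \<comment> \<open>The factor \<open>norm (u - a)\<close> cancels between
      \<open>G u = f u * (\<mu> * (a - u))\<close> and the Lipschitz estimate for
      \<open>G\<close>.\<close>
    have near: "norm (f u) \<le> 2 * C * N" if u: "u \<in> ball a \<rho>" "norm u < 1" "u \<noteq> a" for u
    proof -
      have "norm (f u) * (norm \<mu> * norm (u - a)) \<le> 2 * C * N * norm (u - a)"
        using Gz[OF u(1,2)] unfolding Gf[OF u(2)] fac norm_mult by (simp add: norm_minus_commute)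
      then have "norm (f u) * norm \<mu> \<le> 2 * C * N" using u(3) by (simp flip: mult.assoc)
      moreover have "norm (f u) * 1 \<le> norm (f u) * norm \<mu>" using \<mu>(1) by (intro mult_left_mono) auto
      ultimately show ?thesis by simp
    qed
    have near': "norm (f u) \<le> 2 * C * N" if u: "u \<in> ball a \<rho>" "norm u < 1" for u
    proof (cases "u = a")
      case True
      show ?thesis
      proof (rule tendsto_upperbound)
        have "isCont f a"
          using holomorphic_on_imp_continuous_on[OF fhol] u True by (simp add: continuous_on_eq_continuous_at)
        from isCont_tendsto_compose[OF this wlim] True
        show "(\<lambda>n. norm (f (w n))) \<longlonglongrightarrow> norm (f u)" by (intro tendsto_norm) simp
        show "\<forall>\<^sub>F n in sequentially. norm (f (w n)) \<le> 2 * C * N"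
          using wball by eventually_elim (rule near[OF _ nw wa])
      qed simp
    qed (use near u in blast)
    show "norm (f z) \<le> K * (N + norm (h z))"
    proof (cases "z \<in> ball a \<rho>")
      case True
      have "norm (f z) \<le> 2 * C * N" by (rule near'[OF True z])
      also have "\<dots> \<le> K * (N + norm (h z))"
        using C \<rho> N unfolding K_def by (intro mult_mono) auto
      finally show ?thesis .
    next
      case False
      then have far: "\<rho> \<le> norm (1 - \<mu> * z)"
      proof -
        have "1 * norm (a - z) \<le> norm \<mu> * norm (a - z)" using \<mu>(1) by (intro mult_right_mono) auto
        then show ?thesis unfolding fac norm_mult using False by (simp add: dist_norm)
      qed
      have "norm (f z) * \<rho> \<le> norm (f z) * norm (1 - \<mu> * z)" using far by (intro mult_left_mono) auto
      also have "\<dots> = norm (f 0 - z * h z)" using feq[OF z] by (simp flip: norm_mult)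
      also have "\<dots> \<le> norm (f 0) + norm z * norm (h z)" by (metis norm_mult norm_triangle_ineq4)
      also have "\<dots> \<le> C * N + 1 * norm (h z)" using z by (intro add_mono f0 mult_right_mono) auto
      also have "\<dots> \<le> (C + 1) * (N + norm (h z))" using C N by (simp add: algebra_simps)
      finally have "norm (f z) \<le> (C + 1) / \<rho> * (N + norm (h z))" using \<rho> by (simp add: field_simps)
      also have "\<dots> \<le> K * (N + norm (h z))" using C N unfolding K_def by (intro mult_right_mono) auto
      finally show ?thesis .
    qed
  qed
qed

text \<open>The value of the conjugate at \<open>cnj \<mu>\<close> bounds \<open>f 0\<close> by a
  multiple of \<open>N\<close>, and \<open>1 - \<mu> * z\<close> is at least
  \<open>1 - norm \<mu>\<close> in modulus on the whole disk.\<close>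

lemma resolvent_bound_inside:
  fixes I :: "complex \<Rightarrow> complex" and \<mu> :: complex
  assumes I: "inner_function I" and \<mu>: "norm \<mu> < 1" "I (cnj \<mu>) \<noteq> 0"
  obtains K where "0 < K"
    "\<And>f h hs N (z::complex). \<lbrakk>model_pair I N h hs; \<forall>z. norm z < 1 \<longrightarrow> f z * (1 - \<mu> * z) = f 0 - z * h z;
       hs (cnj \<mu>) = cnj (f 0) * I (cnj \<mu>); norm z < 1\<rbrakk> \<Longrightarrow> norm (f z) \<le> K * (N + norm (h z))"
proof -
  define A where "A = L1_const / (1 - norm \<mu>) / norm (I (cnj \<mu>))"
  have A: "0 < A" using L1_const_pos \<mu> by (simp add: A_def)
  define K where "K = (A + 1) / (1 - norm \<mu>)"
  have K: "0 < K" using A \<mu> by (simp add: K_def)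
  show ?thesis
  proof (rule that[OF K])
    fix f h hs :: "complex \<Rightarrow> complex" and N :: real and z :: complex
    assume hp: "model_pair I N h hs" and feq': "\<forall>z. norm z < 1 \<longrightarrow> f z * (1 - \<mu> * z) = f 0 - z * h z"
      and hs: "hs (cnj \<mu>) = cnj (f 0) * I (cnj \<mu>)" and z: "norm z < (1::real)"
    note feq = feq'[rule_format]
    have N: "0 < N" using hp by (simp add: model_pair_def)
    have "norm (hs (cnj \<mu>)) \<le> L1_const * N / (1 - norm (cnj \<mu>))"
      by (rule model_pair_conjugate_bound[OF I hp]) (use \<mu> in simp)
    then have f0: "norm (f 0) \<le> A * N"
      using \<mu> unfolding hs by (simp add: A_def norm_mult field_simps)
    have "norm (\<mu> * z) \<le> norm \<mu> * 1" unfolding norm_mult using z by (intro mult_left_mono) auto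
    then have far: "1 - norm \<mu> \<le> norm (1 - \<mu> * z)" using norm_triangle_ineq2[of 1 "\<mu> * z"] by simp
    have "norm (f z) * (1 - norm \<mu>) \<le> norm (f z) * norm (1 - \<mu> * z)" using far by (intro mult_left_mono) auto
    also have "\<dots> = norm (f 0 - z * h z)" using feq[OF z] by (simp flip: norm_mult)
    also have "\<dots> \<le> norm (f 0) + norm z * norm (h z)" by (metis norm_mult norm_triangle_ineq4)
    also have "\<dots> \<le> A * N + 1 * norm (h z)" using z by (intro add_mono f0 mult_right_mono) auto
    also have "\<dots> \<le> (A + 1) * (N + norm (h z))" using A N by (simp add: algebra_simps)
    finally show "norm (f z) \<le> K * (N + norm (h z))" using \<mu> by (simp add: K_def field_simps)
  qed
qed

end

section \<open>The weighted Hardy space\<close>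

lemma integral_mean_nonneg:
  assumes "F holomorphic_on ball 0 1" "0 \<le> r" "r < 1" "0 < p"
  shows "0 \<le> integral_mean p F r"
proof -
  have "0 \<le> (LINT t|circ. norm (F (of_real r * cis t)) powr p)" by simp
  then show ?thesis unfolding integral_mean_eq(2)[OF assms] using pi_gt_zero by (auto simp: zero_le_mult_iff)
qed

lemma hardy_norm_leI:
  assumes "F holomorphic_on ball 0 1" "0 < p" "0 \<le> N" "\<And>r. r \<in> {0..<1} \<Longrightarrow> integral_mean p F r \<le> N powr p"
  shows "hardy_norm p F \<le> N"
proof -
  have le: "(SUP r\<in>{0..<1}. integral_mean p F r) \<le> N powr p"
    using assms(4) by (intro cSUP_least) auto
  have "bdd_above (integral_mean p F ` {0..<1})" using assms(4) by (auto intro!: bdd_aboveI[of _ "N powr p"])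
  then have "integral_mean p F 0 \<le> (SUP r\<in>{0..<1}. integral_mean p F r)" by (intro cSUP_upper) auto
  then have "0 \<le> (SUP r\<in>{0..<1}. integral_mean p F r)"
    using integral_mean_nonneg[OF assms(1), of 0 p] assms(2) by simp
  then have "hardy_norm p F \<le> (N powr p) powr (1 / p)"
    unfolding hardy_norm_def using le assms(2) by (intro powr_mono2) auto
  then show ?thesis using assms by (simp add: powr_powr)
qed

lemma integral_mean_le_hardy_norm:
  assumes "F \<in> hardy_space p" "0 < p" "r \<in> {0..<1}"
  shows "integral_mean p F r \<le> hardy_norm p F powr p"
proof -
  have bdd: "bdd_above (integral_mean p F ` {0..<1})" and hol: "F holomorphic_on ball 0 1"
    using assms(1) by (auto simp: hardy_space_def)
  have le: "integral_mean p F r \<le> (SUP r\<in>{0..<1}. integral_mean p F r)"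
    using assms(3) bdd by (rule cSUP_upper)
  then have "0 \<le> (SUP r\<in>{0..<1}. integral_mean p F r)"
    using integral_mean_nonneg[OF hol, of r p] assms by simp
  then show ?thesis using le assms(2) by (simp add: hardy_norm_def powr_powr)
qed

lemma norm_at_0_le_hardy_norm:
  assumes "F \<in> hardy_space p" "0 < p"
  shows "norm (F 0) \<le> hardy_norm p F"
proof -
  have "integral_mean p F 0 = norm (F 0) powr p" by (simp add: integral_mean_def)
  then have "norm (F 0) powr p \<le> hardy_norm p F powr p"
    using integral_mean_le_hardy_norm[OF assms, of 0] by simp
  moreover have "0 \<le> hardy_norm p F" by (simp add: hardy_norm_def)
  ultimately show ?thesis using assms(2) by (metis linorder_not_le powr_less_mono2 norm_ge_zero)
qed

text \<open>For \<open>w = 0\<close> this is the backward shift; for \<open>F = I\<close> and other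
  \<open>w\<close> it is the boundary conjugate of the reproducing kernel at
  \<open>w\<close>.\<close>

definition divided_difference :: "(complex \<Rightarrow> complex) \<Rightarrow> complex \<Rightarrow> complex \<Rightarrow> complex" where
  "divided_difference F w z = (if z = w then deriv F w else (F z - F w) / (z - w))"

lemma backward_shift_divided_difference: "backward_shift F = divided_difference F 0"
  by (rule ext) (simp add: backward_shift_def divided_difference_def)

lemma divided_difference_holomorphic:
  assumes "F holomorphic_on ball 0 1" "norm w < 1"
  shows "divided_difference F w holomorphic_on ball 0 1"
  unfolding divided_difference_def[abs_def] using assms by (intro pole_lemma) auto

text \<open>Near \<open>w\<close> the quotient is bounded by compactness, elsewhere by its numerator
  over a fixed distance. The 1 is written as a norm to match domination by two members of the
  weighted space, \<open>F\<close> and the constant function.\<close>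

lemma divided_difference_growth:
  assumes F: "F holomorphic_on ball 0 1" and w: "norm w < 1"
  obtains K where "0 < K" "\<And>z. norm z < 1 \<Longrightarrow> norm (divided_difference F w z) \<le> K * (norm (F z) + norm (1::complex))"
proof -
  let ?D = "divided_difference F w"
  define d where "d = (1 - norm w) / 2"
  have d: "0 < d" using w by (simp add: d_def)
  have sub: "cball w d \<subseteq> ball 0 1"
  proof
    fix z assume "z \<in> cball w d"
    then show "z \<in> ball 0 1" using norm_triangle_ineq2[of z w] w by (simp add: d_def dist_norm norm_minus_commute)
  qed
  obtain C where C: "\<And>z. z \<in> cball w d \<Longrightarrow> norm (?D z) \<le> C"
    by (rule compact_continuous_bound[OF compact_cball holomorphic_on_imp_continuous_on[OF
        holomorphic_on_subset[OF divided_difference_holomorphic[OF F w] sub]]]) (rule that)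
  have C0: "0 \<le> C" using order_trans[OF norm_ge_zero C[of w]] d by simp
  define K where "K = C + (1 + norm (F w)) / d"
  have "0 < 1 + norm (F w)" by (rule add_pos_nonneg) simp_all
  then have K: "0 < K" unfolding K_def by (rule add_nonneg_pos[OF C0 divide_pos_pos[OF _ d]])
  have "norm (?D z) \<le> K * (norm (F z) + norm (1::complex))" if z: "norm z < 1" for z
  proof (cases "z \<in> cball w d")
    case True
    have "norm (?D z) \<le> C * 1" using C[OF True] by simp
    also have "\<dots> \<le> K * (norm (F z) + norm (1::complex))"
      using C0 d unfolding K_def by (intro mult_mono) auto
    finally show ?thesis .
  next
    case False
    then have zd: "d \<le> norm (z - w)" "z \<noteq> w" using d by (auto simp: dist_norm norm_minus_commute)
    have "norm (?D z) = norm (F z - F w) / norm (z - w)" using zd by (simp add: divided_difference_def norm_divide)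
    also have "\<dots> \<le> (norm (F z) + norm (F w)) / d"
      using zd d by (intro frac_le norm_triangle_ineq4) auto
    also have "\<dots> \<le> ((1 + norm (F w)) * (norm (F z) + 1)) / d"
      using d by (intro divide_right_mono) (auto simp: algebra_simps)
    also have "\<dots> = (1 + norm (F w)) / d * (norm (F z) + norm (1::complex))" by simp
    also have "\<dots> \<le> K * (norm (F z) + norm (1::complex))"
      using C0 unfolding K_def by (intro mult_right_mono) auto
    finally show ?thesis .
  qed
  with K show ?thesis by (rule that)
qed

lemma divided_difference_radial_limit:
  assumes F: "has_radial_limit F \<zeta> l" and \<zeta>: "norm \<zeta> = 1" and w: "norm w < 1"
  shows "has_radial_limit (divided_difference F w) \<zeta> ((l - F w) / (\<zeta> - w))"
  unfolding has_radial_limit_def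
proof (rule Lim_transform_eventually)
  have ne: "\<zeta> \<noteq> w" using \<zeta> w by auto
  have lim: "((\<lambda>r. of_real r * \<zeta>) \<longlongrightarrow> of_real 1 * \<zeta>) (at_left (1::real))"
    by (intro tendsto_intros)
  then have lim: "((\<lambda>r. of_real r * \<zeta>) \<longlongrightarrow> \<zeta>) (at_left (1::real))" by simp
  show "((\<lambda>r. (F (of_real r * \<zeta>) - F w) / (of_real r * \<zeta> - w)) \<longlongrightarrow> (l - F w) / (\<zeta> - w)) (at_left 1)"
    using F lim ne unfolding has_radial_limit_def by (intro tendsto_intros) auto
  have "\<forall>\<^sub>F r in at_left (1::real). of_real r * \<zeta> \<in> - {w}"
    by (rule topological_tendstoD[OF lim]) (use ne in auto)
  then show "\<forall>\<^sub>F r in at_left (1::real). (F (of_real r * \<zeta>) - F w) / (of_real r * \<zeta> - w) = divided_difference F w (of_real r * \<zeta>)"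
    by eventually_elim (simp add: divided_difference_def)
qed

lemma radial_limit_intros:
  assumes "has_radial_limit F \<zeta> a" "has_radial_limit G \<zeta> b"
  shows "has_radial_limit (\<lambda>z. F z + G z) \<zeta> (a + b)" "has_radial_limit (\<lambda>z. F z - G z) \<zeta> (a - b)"
    "has_radial_limit (\<lambda>z. F z * G z) \<zeta> (a * b)" "b \<noteq> 0 \<Longrightarrow> has_radial_limit (\<lambda>z. F z / G z) \<zeta> (a / b)"
  using assms unfolding has_radial_limit_def by (auto intro!: tendsto_intros)

lemma radial_limit_const: "has_radial_limit (\<lambda>z. c) \<zeta> c"
  by (simp add: has_radial_limit_def)

lemma radial_limit_ident: "has_radial_limit (\<lambda>z. z) \<zeta> \<zeta>"
proof -
  have "((\<lambda>r. of_real r * \<zeta>) \<longlongrightarrow> of_real 1 * \<zeta>) (at_left (1::real))" by (intro tendsto_intros)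
  then show ?thesis by (simp add: has_radial_limit_def)
qed

section \<open>The weighted space under pointwise domination\<close>

locale model_setup = outer_weight p g c v for p g c v +
  fixes I :: "complex \<Rightarrow> complex"
  assumes g_hardy: "g \<in> hardy_space p" and I: "inner_function I"
begin

abbreviation "H \<equiv> weighted_hardy_space p g"

lemma p_pos: "0 < p"
  using p by simp

lemma H_iff: "F \<in> H \<longleftrightarrow> F holomorphic_on ball 0 1 \<and> (\<lambda>z. F z * g z) \<in> hardy_space p"
  by (simp add: weighted_hardy_space_def)

lemma mult_g_holomorphic: "F holomorphic_on ball 0 1 \<Longrightarrow> (\<lambda>z. F z * g z) holomorphic_on ball 0 1"
  by (intro holomorphic_intros g_holomorphic)

text \<open>The crude \<open>(x + y) powr p \<le> 2 powr p * (x powr p + y powr p)\<close> takes the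
  place of Minkowski's inequality.\<close>

lemma integral_mean_dominated:
  assumes F: "F holomorphic_on ball 0 1" and F1: "F1 holomorphic_on ball 0 1" and F2: "F2 holomorphic_on ball 0 1"
    and K: "0 \<le> K" "\<And>z. norm z < 1 \<Longrightarrow> norm (F z) \<le> K * (norm (F1 z) + norm (F2 z))" and r: "0 \<le> r" "r < 1"
  shows "integral_mean p (\<lambda>z. F z * g z) r \<le>
     (2 * K) powr p * (integral_mean p (\<lambda>z. F1 z * g z) r + integral_mean p (\<lambda>z. F2 z * g z) r)"
proof -
  note e = integral_mean_eq[OF mult_g_holomorphic r p_pos]
  let ?f = "\<lambda>F t. norm (F (of_real r * cis t) * g (of_real r * cis t)) powr p"
  have pt: "?f F t \<le> (2 * K) powr p * (?f F1 t + ?f F2 t)" for t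
  proof -
    let ?z = "of_real r * cis t"
    let ?a = "norm (F1 ?z * g ?z)" and ?b = "norm (F2 ?z * g ?z)"
    have z: "norm ?z < 1" using r by (simp add: norm_mult)
    have "norm (F ?z) * norm (g ?z) \<le> K * (norm (F1 ?z) + norm (F2 ?z)) * norm (g ?z)"
      by (intro mult_right_mono K(2) z) simp
    then have "norm (F ?z * g ?z) \<le> K * (?a + ?b)" by (simp add: norm_mult algebra_simps)
    also have "\<dots> \<le> K * (2 * max ?a ?b)" using K(1) by (intro mult_left_mono) auto
    finally have "?f F t \<le> (2 * K * max ?a ?b) powr p" using p_pos by (intro powr_mono2) (auto simp: mult_ac)
    also have "\<dots> = (2 * K) powr p * max ?a ?b powr p" by (rule powr_mult)
    also have "max ?a ?b powr p \<le> ?a powr p + ?b powr p"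
      by (smt (verit) max_def powr_ge_zero)
    finally show ?thesis by (simp add: mult_left_mono)
  qed
  have "2 * pi * integral_mean p (\<lambda>z. F z * g z) r \<le> (LINT t|circ. (2 * K) powr p * (?f F1 t + ?f F2 t))"
    unfolding e(2)[OF F, symmetric] using pt e(1)[OF F] e(1)[OF F1] e(1)[OF F2] by (intro integral_mono) auto
  also have "\<dots> = (2 * K) powr p * (2 * pi * integral_mean p (\<lambda>z. F1 z * g z) r + 2 * pi * integral_mean p (\<lambda>z. F2 z * g z) r)"
    unfolding e(2)[OF F1, symmetric] e(2)[OF F2, symmetric] using e(1)[OF F1] e(1)[OF F2] by simp
  also have "\<dots> = 2 * pi * ((2 * K) powr p * (integral_mean p (\<lambda>z. F1 z * g z) r + integral_mean p (\<lambda>z. F2 z * g z) r))"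
    by (simp add: algebra_simps)
  finally show ?thesis by simp
qed

lemma H_mean_le:
  assumes "F \<in> H" "r \<in> {0..<1}"
  shows "integral_mean p (\<lambda>z. F z * g z) r \<le> weighted_hardy_norm p g F powr p"
  unfolding weighted_hardy_norm_def using assms p_pos
  by (intro integral_mean_le_hardy_norm) (auto simp: H_iff)

text \<open>The source of closure under differences, bounded multipliers and divided differences,
  and of the norm estimates in both inclusions.\<close>

lemma H_dominated:
  assumes F: "F holomorphic_on ball 0 1" and F1: "F1 \<in> H" and F2: "F2 \<in> H"
    and K: "0 \<le> K" "\<And>z. norm z < 1 \<Longrightarrow> norm (F z) \<le> K * (norm (F1 z) + norm (F2 z))"
  shows "F \<in> H"
    and "weighted_hardy_norm p g F \<le>
      ((2 * K) powr p * (weighted_hardy_norm p g F1 powr p + weighted_hardy_norm p g F2 powr p)) powr (1 / p)"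
proof -
  let ?B = "(2 * K) powr p * (weighted_hardy_norm p g F1 powr p + weighted_hardy_norm p g F2 powr p)"
  have le: "integral_mean p (\<lambda>z. F z * g z) r \<le> ?B" if r: "r \<in> {0..<1}" for r
  proof -
    have "integral_mean p (\<lambda>z. F z * g z) r \<le>
      (2 * K) powr p * (integral_mean p (\<lambda>z. F1 z * g z) r + integral_mean p (\<lambda>z. F2 z * g z) r)"
      using F1 F2 r by (intro integral_mean_dominated[OF F _ _ K]) (auto simp: H_iff)
    also have "\<dots> \<le> ?B"
      by (intro mult_left_mono add_mono H_mean_le F1 F2 r) simp
    finally show ?thesis .
  qed
  then show "F \<in> H"
    unfolding H_iff hardy_space_def using F mult_g_holomorphic[OF F] by (auto intro!: bdd_aboveI[of _ ?B])
  have "0 \<le> ?B" by simp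
  then have "(?B powr (1 / p)) powr p = ?B" using p_pos by (simp add: powr_powr)
  then show "weighted_hardy_norm p g F \<le> ?B powr (1 / p)"
    unfolding weighted_hardy_norm_def[of p g F] using le
    by (intro hardy_norm_leI mult_g_holomorphic F p_pos) auto
qed

lemma H_one: "(\<lambda>z. 1) \<in> H"
  using g_hardy by (simp add: H_iff)

lemma H_hardy_bound:
  assumes F: "F \<in> H" and N: "weighted_hardy_norm p g F \<le> N"
  shows "hardy_bound N F"
proof -
  have "0 \<le> weighted_hardy_norm p g F" by (simp add: weighted_hardy_norm_def hardy_norm_def)
  then have "weighted_hardy_norm p g F powr p \<le> N powr p"
    using N p_pos by (intro powr_mono2) auto
  then have "integral_mean p (\<lambda>z. F z * g z) r \<le> N powr p" if "r \<in> {0..<1}" for r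
    using H_mean_le[OF F that] by linarith
  then show ?thesis using F by (simp add: hardy_bound_def H_iff)
qed

lemma H_ex_hardy_bound:
  assumes F: "F \<in> H"
  shows "\<exists>N>0. hardy_bound N F"
proof (intro exI conjI)
  show "hardy_bound (max 1 (weighted_hardy_norm p g F)) F" by (rule H_hardy_bound[OF F]) simp
qed simp

lemma I_bounded:
  obtains C where "0 < C" "\<And>z. norm z < 1 \<Longrightarrow> norm (I z) \<le> C"
proof -
  have "bounded (I ` ball 0 1)" using I by (simp add: inner_function_def)
  then obtain C where "0 < C" "\<forall>x\<in>I ` ball 0 1. norm x \<le> C" using bounded_pos by blast
  then show ?thesis by (intro that[of C]) auto
qed

lemma I_holomorphic: "I holomorphic_on ball 0 1"
  using I by (simp add: inner_function_def)

lemma divided_difference_H: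
  assumes F: "F \<in> H" and w: "norm w < 1"
  shows "divided_difference F w \<in> H"
proof -
  have hol: "F holomorphic_on ball 0 1" using F by (simp add: H_iff)
  obtain K where "0 < K" "\<And>z. norm z < 1 \<Longrightarrow> norm (divided_difference F w z) \<le> K * (norm (F z) + norm (1::complex))"
    by (rule divided_difference_growth[OF hol w]) (rule that)
  then show ?thesis
    by (intro H_dominated(1)[OF divided_difference_holomorphic[OF hol w] F H_one, of K]) auto
qed

lemma H_bounded_mult:
  assumes F: "F \<in> H" and b: "b holomorphic_on ball 0 1" "0 \<le> K" "\<And>z. norm z < 1 \<Longrightarrow> norm (b z) \<le> K"
  shows "(\<lambda>z. b z * F z) \<in> H"
proof (rule H_dominated(1)[OF _ F F, of _ K])
  show "(\<lambda>z. b z * F z) holomorphic_on ball 0 1" using F b by (intro holomorphic_intros) (auto simp: H_iff)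
  show "norm (b z * F z) \<le> K * (norm (F z) + norm (F z))" if "norm z < 1" for z
  proof -
    have "norm (b z) * norm (F z) \<le> K * norm (F z)" by (intro mult_right_mono b(3) that) simp
    also have "\<dots> \<le> K * (norm (F z) + norm (F z))" using b(2) by (intro mult_left_mono) auto
    finally show ?thesis by (simp add: norm_mult)
  qed
qed (rule b(2))

lemma H_diff:
  assumes "F1 \<in> H" "F2 \<in> H" shows "(\<lambda>z. F1 z - F2 z) \<in> H"
proof (rule H_dominated(1)[OF _ assms, of _ 1])
  show "(\<lambda>z. F1 z - F2 z) holomorphic_on ball 0 1" using assms by (intro holomorphic_intros) (auto simp: H_iff)
  show "norm (F1 z - F2 z) \<le> 1 * (norm (F1 z) + norm (F2 z))" for z using norm_triangle_ineq4[of "F1 z" "F2 z"] by simp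
qed simp

lemma H_cmult: "F \<in> H \<Longrightarrow> (\<lambda>z. k * F z) \<in> H"
  by (rule H_bounded_mult[of _ "\<lambda>_. k" "norm k"]) (auto intro: holomorphic_intros)

lemma I_H: "I \<in> H"
proof -
  obtain C where "0 < C" "\<And>z. norm z < 1 \<Longrightarrow> norm (I z) \<le> C" by (rule I_bounded) (rule that)
  then show ?thesis using H_bounded_mult[OF H_one I_holomorphic, of C] by simp
qed

section \<open>The model space and the lower bound for the residual\<close>

abbreviation "X \<equiv> model_space p g I"
abbreviation "nrm \<equiv> weighted_hardy_norm p g"

abbreviation residual :: "complex \<Rightarrow> (complex \<Rightarrow> complex) \<Rightarrow> complex \<Rightarrow> complex" where
  "residual \<mu> f \<equiv> (\<lambda>z. \<mu> * f z - backward_shift f z)"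

lemma residual_eq: "f z * (1 - \<mu> * z) = f 0 - z * residual \<mu> f z"
  by (cases "z = 0") (simp_all add: backward_shift_def field_simps)

lemma residual_H: "f \<in> H \<Longrightarrow> residual \<mu> f \<in> H"
  unfolding backward_shift_divided_difference by (intro H_diff H_cmult divided_difference_H) auto

text \<open>The partner of \<open>f\<close> is \<open>I * cnj (z * f)\<close> on the circle, which extends to the disk as
  \<open>\<psi> / z\<close> for the witness \<open>\<psi>\<close> of \<^prop>\<open>f \<in> model_space p g I\<close>.\<close>

lemma model_space_pairs:
  assumes f: "f \<in> X"
  obtains fs hs Nf where "f holomorphic_on ball 0 1" "model_pair I Nf f fs"
    "\<And>N. \<lbrakk>0 < N; nrm (residual \<mu> f) \<le> N\<rbrakk> \<Longrightarrow>
       model_pair I N (residual \<mu> f) hs"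
    "hs (cnj \<mu>) = cnj (f 0) * I (cnj \<mu>)"
proof -
  have fH: "f \<in> H" using f by (simp add: model_space_def)
  obtain \<psi> where \<psi>: "\<psi> \<in> H" "\<psi> 0 = 0" and rel: "AE t in circ. \<exists>a b c.
          has_radial_limit f (cis t) a \<and> has_radial_limit I (cis t) b \<and>
          has_radial_limit \<psi> (cis t) c \<and> a = b * cnj c"
    using f by (auto simp: model_space_def weighted_hardy_space0_def)
  define fs where "fs = divided_difference \<psi> 0"
  define h where "h z = \<mu> * f z - backward_shift f z" for z
  \<comment> \<open>On the circle \<open>I * cnj (\<zeta> * h)\<close> with
    \<open>h = \<mu> * f - (f - f 0) * cnj \<zeta>\<close> expands to
    \<open>cnj \<mu> * fs - \<zeta> * fs + cnj (f 0) * I\<close>, as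
    \<open>\<zeta> * fs = I * cnj f\<close>. At \<open>cnj \<mu>\<close> only the last term
    survives.\<close>
  define hs where "hs z = cnj (f 0) * I z - (z - cnj \<mu>) * fs z" for z
  have hol: "f holomorphic_on ball 0 1" using fH by (simp add: H_iff)
  have fsH: "fs \<in> H" unfolding fs_def using \<psi> by (intro divided_difference_H) auto
  have hH: "h \<in> H" using residual_H[OF fH, of \<mu>] by (simp add: h_def[abs_def])
  have hsH: "hs \<in> H" unfolding hs_def
  proof (intro H_diff H_cmult I_H H_bounded_mult[OF fsH, of _ "1 + norm \<mu>"])
    show "norm (z - cnj \<mu>) \<le> 1 + norm \<mu>" if "norm z < 1" for z
      using norm_triangle_ineq4[of z "cnj \<mu>"] that by simp
  qed (auto intro: holomorphic_intros)
  have bd: "AE t in circ. (\<exists>a. has_radial_limit f (cis t) a) \<and> (\<exists>a. has_radial_limit fs (cis t) a) \<and>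
      (\<exists>a. has_radial_limit h (cis t) a) \<and> (\<exists>a. has_radial_limit hs (cis t) a) \<and>
      boundary_value fs t = boundary_value I t * cnj (cis t) * cnj (boundary_value f t) \<and>
      boundary_value hs t = boundary_value I t * cnj (cis t) * cnj (boundary_value h t)"
    using rel inner_AE_norm[OF I]
  proof eventually_elim
    case (elim t)
    then obtain a b c where l: "has_radial_limit f (cis t) a" "has_radial_limit I (cis t) b"
      "has_radial_limit \<psi> (cis t) c" "a = b * cnj c" by blast
    let ?\<zeta> = "cis t"
    have nb: "norm b = 1" using elim(2) boundary_value_eq[OF l(2)] by simp
    have bb: "b * cnj b = 1" using nb complex_norm_square[of b] by simp
    have cc: "cis t * cnj (cis t) = 1" by (simp add: cis_cnj cis_mult)
    have inv: "x / cis t = x * cnj (cis t)" for x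
      by (simp add: divide_inverse cis_cnj flip: cis_inverse)
    have lfs: "has_radial_limit fs ?\<zeta> (c * cnj ?\<zeta>)"
      using divided_difference_radial_limit[OF l(3), of 0] \<psi>(2) unfolding fs_def by (simp add: inv)
    have lB: "has_radial_limit (backward_shift f) ?\<zeta> ((a - f 0) * cnj ?\<zeta>)"
      using divided_difference_radial_limit[OF l(1), of 0] unfolding backward_shift_divided_difference by (simp add: inv)
    have lh: "has_radial_limit h ?\<zeta> (\<mu> * a - (a - f 0) * cnj ?\<zeta>)"
      unfolding h_def by (intro radial_limit_intros radial_limit_const l lB)
    have lhs: "has_radial_limit hs ?\<zeta> (cnj (f 0) * b - (?\<zeta> - cnj \<mu>) * (c * cnj ?\<zeta>))"
      unfolding hs_def by (intro radial_limit_intros radial_limit_const radial_limit_ident l lfs)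
    have ca: "cnj a = cnj b * c" using l(4) by simp
    have r1: "c * cnj ?\<zeta> = b * cnj ?\<zeta> * cnj a"
    proof -
      have "b * cnj ?\<zeta> * cnj a = (b * cnj b) * (c * cnj ?\<zeta>)" unfolding ca by (simp only: mult_ac)
      then show ?thesis by (simp only: bb mult_1_left)
    qed
    have r2: "cnj (f 0) * b - (?\<zeta> - cnj \<mu>) * (c * cnj ?\<zeta>) = b * cnj ?\<zeta> * cnj (\<mu> * a - (a - f 0) * cnj ?\<zeta>)"
    proof -
      have "b * cnj ?\<zeta> * cnj (\<mu> * a - (a - f 0) * cnj ?\<zeta>)
        = cnj \<mu> * ((b * cnj b) * (c * cnj ?\<zeta>)) - (?\<zeta> * cnj ?\<zeta>) * ((b * cnj b) * c) + (?\<zeta> * cnj ?\<zeta>) * (b * cnj (f 0))"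
        by (simp add: ca algebra_simps)
      also have "\<dots> = cnj \<mu> * (c * cnj ?\<zeta>) - (?\<zeta> * cnj ?\<zeta>) * c + b * cnj (f 0)"
        by (simp only: bb cc mult_1_left)
      finally show ?thesis by (simp add: algebra_simps)
    qed
    show ?case
      using l(1) lfs lh lhs r1 r2 boundary_value_eq[OF l(1)] boundary_value_eq[OF l(2)] boundary_value_eq[OF lfs]
        boundary_value_eq[OF lh] boundary_value_eq[OF lhs] by (intro conjI exI) simp_all
  qed
  have hb: "has_boundary_values f" "has_boundary_values fs" "has_boundary_values h" "has_boundary_values hs"
    unfolding has_boundary_values_def using bd by (eventually_elim, blast)+
  have rels: "AE t in circ. boundary_value fs t = boundary_value I t * cnj (cis t) * cnj (boundary_value f t)"
    "AE t in circ. boundary_value hs t = boundary_value I t * cnj (cis t) * cnj (boundary_value h t)"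
    using bd by (eventually_elim, blast)+
  obtain Nf where Nf: "0 < Nf" "hardy_bound Nf f" using H_ex_hardy_bound[OF fH] by blast
  show ?thesis
  proof (rule that[of Nf fs hs])
    show "f holomorphic_on ball 0 1" by (rule hol)
    show "model_pair I Nf f fs"
      unfolding model_pair_def using Nf H_ex_hardy_bound[OF fsH] hb rels by blast
    show "model_pair I N (residual \<mu> f) hs"
      if "0 < N" "nrm (residual \<mu> f) \<le> N" for N
      unfolding model_pair_def h_def[abs_def, symmetric]
      using that H_hardy_bound[OF hH] H_ex_hardy_bound[OF hsH] hb rels by (simp add: h_def[abs_def])
    show "hs (cnj \<mu>) = cnj (f 0) * I (cnj \<mu>)" by (simp add: hs_def)
  qed
qed

lemma nrm_nonneg: "0 \<le> nrm F"
  by (simp add: weighted_hardy_norm_def hardy_norm_def)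

lemma nrm_cmult_le:
  assumes F: "F \<in> H"
  shows "nrm (\<lambda>z. k * F z) \<le> norm k * nrm F"
  unfolding weighted_hardy_norm_def[of p g "\<lambda>z. k * F z"]
proof (rule hardy_norm_leI[OF mult_g_holomorphic p_pos])
  show "(\<lambda>z. k * F z) holomorphic_on ball 0 1" using H_cmult[OF F] by (simp add: H_iff)
  show "0 \<le> norm k * nrm F" by (intro mult_nonneg_nonneg nrm_nonneg norm_ge_zero)
  fix r :: real assume r: "r \<in> {0..<1}"
  have "integral_mean p (\<lambda>z. k * F z * g z) r = norm k powr p * integral_mean p (\<lambda>z. F z * g z) r"
  proof -
    have "norm (k * x * y) powr p = norm k powr p * norm (x * y) powr p" for x y
      by (simp add: norm_mult powr_mult mult.assoc)
    then show ?thesis by (simp add: integral_mean_def)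
  qed
  also have "\<dots> \<le> norm k powr p * nrm F powr p" by (intro mult_left_mono H_mean_le F r) simp
  also have "\<dots> = (norm k * nrm F) powr p" by (rule powr_mult[symmetric])
  finally show "integral_mean p (\<lambda>z. k * F z * g z) r \<le> (norm k * nrm F) powr p" .
qed

lemma nrm_cmult:
  assumes F: "F \<in> H"
  shows "nrm (\<lambda>z. k * F z) = norm k * nrm F"
proof (cases "k = 0")
  case True
  then show ?thesis using nrm_cmult_le[OF F, of 0] nrm_nonneg[of "\<lambda>z. k * F z"] by simp
next
  case False
  have "nrm (\<lambda>z. (1 / k) * (k * F z)) \<le> norm (1 / k) * nrm (\<lambda>z. k * F z)"
    by (intro nrm_cmult_le H_cmult F)
  then have "norm k * nrm F \<le> nrm (\<lambda>z. k * F z)" using False by (simp add: norm_divide field_simps)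
  then show ?thesis using nrm_cmult_le[OF F, of k] by simp
qed

text \<open>With \<open>K\<close> outside the power the estimate is linear in \<open>K\<close>, and
  both inclusions use it with a \<open>K\<close> that tends to 0.\<close>

lemma nrm_dominated:
  assumes F: "F holomorphic_on ball 0 1" and F1: "F1 \<in> H" and F2: "F2 \<in> H"
    and K: "0 \<le> K" "\<And>z. norm z < 1 \<Longrightarrow> norm (F z) \<le> K * (norm (F1 z) + norm (F2 z))"
    and b: "nrm F1 \<le> b1" "nrm F2 \<le> b2"
  shows "nrm F \<le> K * (2 * (b1 powr p + b2 powr p) powr (1 / p))"
proof -
  have "nrm F \<le> ((2 * K) powr p * (nrm F1 powr p + nrm F2 powr p)) powr (1 / p)"
    by (rule H_dominated(2)[OF F F1 F2 K])
  also have "\<dots> \<le> ((2 * K) powr p * (b1 powr p + b2 powr p)) powr (1 / p)"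
    using p_pos b nrm_nonneg by (intro powr_mono2 mult_left_mono add_mono) auto
  also have "\<dots> = ((2 * K) powr p) powr (1 / p) * (b1 powr p + b2 powr p) powr (1 / p)"
    by (rule powr_mult)
  also have "((2 * K) powr p) powr (1 / p) = 2 * K" using K(1) p_pos by (simp add: powr_powr)
  finally show ?thesis by (simp add: mult_ac)
qed

lemma resolvent_bound:
  assumes \<mu>: "cnj \<mu> \<notin> inner_spectrum I"
  obtains K where "0 < K" "\<And>f N z. \<lbrakk>f \<in> X; 0 < N; nrm (residual \<mu> f) \<le> N; norm z < 1\<rbrakk> \<Longrightarrow>
     norm (f z) \<le> K * (N + norm (\<mu> * f z - backward_shift f z))"
proof (cases "1 \<le> norm \<mu>")
  case True
  obtain K where K: "0 < K" and Kb:
    "\<And>f fs h hs N Nf (z::complex). \<lbrakk>f holomorphic_on ball 0 1; model_pair I Nf f fs; model_pair I N h hs;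
       \<forall>z. norm z < 1 \<longrightarrow> f z * (1 - \<mu> * z) = f 0 - z * h z; norm z < 1\<rbrakk> \<Longrightarrow> norm (f z) \<le> K * (N + norm (h z))"
    by (rule resolvent_bound_outside[OF I True \<mu>]) (rule that)
  show ?thesis
  proof (rule that[OF K])
    fix f :: "complex \<Rightarrow> complex" and N :: real and z :: complex
    assume f: "f \<in> X" and N: "0 < N" "nrm (residual \<mu> f) \<le> N" and z: "norm z < 1"
    obtain fs hs Nf where *: "f holomorphic_on ball 0 1" "model_pair I Nf f fs"
      "\<And>N. \<lbrakk>0 < N; nrm (residual \<mu> f) \<le> N\<rbrakk> \<Longrightarrow> model_pair I N (residual \<mu> f) hs"
      "hs (cnj \<mu>) = cnj (f 0) * I (cnj \<mu>)"
      by (rule model_space_pairs[OF f, of \<mu>]) (rule that)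
    show "norm (f z) \<le> K * (N + norm (\<mu> * f z - backward_shift f z))"
      by (rule Kb[OF *(1,2) *(3)[OF N] _ z]) (intro allI impI residual_eq)
  qed
next
  case False
  then have \<mu>1: "norm \<mu> < 1" by simp
  \<comment> \<open>Being off the spectrum bounds \<open>I\<close> below on a punctured
    neighbourhood, because the \<open>Liminf\<close> ignores the point itself; continuity yields the
    value there.\<close>
  have I\<mu>: "I (cnj \<mu>) \<noteq> 0"
  proof -
    obtain \<eta> \<delta> where \<eta>: "0 < \<eta>" and \<delta>: "0 < \<delta>" "\<And>z. \<lbrakk>norm z < 1; z \<noteq> cnj \<mu>; norm (z - cnj \<mu>) < \<eta>\<rbrakk> \<Longrightarrow> \<delta> \<le> norm (I z)"
      by (rule not_inner_spectrum_lower_bound[of "cnj \<mu>" I]) (use \<mu>1 \<mu> in \<open>simp_all add: that\<close>)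
    have "isCont I (cnj \<mu>)"
      using holomorphic_on_imp_continuous_on[OF I_holomorphic] \<mu>1 by (simp add: continuous_on_eq_continuous_at)
    then have lim: "((\<lambda>z. norm (I z)) \<longlongrightarrow> norm (I (cnj \<mu>))) (at (cnj \<mu>))"
      unfolding isCont_def by (rule tendsto_norm)
    have "\<forall>\<^sub>F z in at (cnj \<mu>). norm z < 1 \<and> dist z (cnj \<mu>) < \<eta> \<and> z \<noteq> cnj \<mu>"
    proof (intro eventually_conj)
      show "\<forall>\<^sub>F z in at (cnj \<mu>). norm z < 1"
        using \<mu>1 by (intro order_tendstoD(2)[of norm "norm (cnj \<mu>)"] tendsto_norm tendsto_ident_at) auto
      show "\<forall>\<^sub>F z in at (cnj \<mu>). dist z (cnj \<mu>) < \<eta>"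
        using \<eta> by (auto simp: eventually_at)
      show "\<forall>\<^sub>F z in at (cnj \<mu>). z \<noteq> cnj \<mu>" by (simp add: eventually_at_filter)
    qed
    then have "\<forall>\<^sub>F z in at (cnj \<mu>). \<delta> \<le> norm (I z)"
      by eventually_elim (use \<delta>(2) in \<open>auto simp: dist_norm\<close>)
    then have "\<delta> \<le> norm (I (cnj \<mu>))" by (rule tendsto_lowerbound[OF lim]) simp
    then show ?thesis using \<delta>(1) by auto
  qed
  obtain K where K: "0 < K" and Kb:
    "\<And>f h hs N (z::complex). \<lbrakk>model_pair I N h hs; \<forall>z. norm z < 1 \<longrightarrow> f z * (1 - \<mu> * z) = f 0 - z * h z;
       hs (cnj \<mu>) = cnj (f 0) * I (cnj \<mu>); norm z < 1\<rbrakk> \<Longrightarrow> norm (f z) \<le> K * (N + norm (h z))"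
    by (rule resolvent_bound_inside[OF I \<mu>1 I\<mu>]) (rule that)
  show ?thesis
  proof (rule that[OF K])
    fix f :: "complex \<Rightarrow> complex" and N :: real and z :: complex
    assume f: "f \<in> X" and N: "0 < N" "nrm (residual \<mu> f) \<le> N" and z: "norm z < 1"
    obtain fs hs Nf where *: "f holomorphic_on ball 0 1" "model_pair I Nf f fs"
      "\<And>N. \<lbrakk>0 < N; nrm (residual \<mu> f) \<le> N\<rbrakk> \<Longrightarrow> model_pair I N (residual \<mu> f) hs"
      "hs (cnj \<mu>) = cnj (f 0) * I (cnj \<mu>)"
      by (rule model_space_pairs[OF f, of \<mu>]) (rule that)
    show "norm (f z) \<le> K * (N + norm (\<mu> * f z - backward_shift f z))"
      by (rule Kb[where f = f and N = N and hs = hs and z = z and h = "residual \<mu> f",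
            OF *(3)[OF N] _ *(4) z]) (intro allI impI residual_eq)
  qed
qed

text \<open>\<open>f n\<close> is dominated by \<open>K * N n\<close> times the sum of the constant
  1 and \<open>h n / N n\<close>, whose norms are bounded independently of \<open>n\<close>; unit
  vectors would have norms tending to 0.\<close>

lemma approx_point_spectrum_subset:
  assumes "\<mu> \<in> approx_point_spectrum X nrm backward_shift"
  shows "cnj \<mu> \<in> inner_spectrum I"
proof (rule ccontr)
  assume \<mu>: "cnj \<mu> \<notin> inner_spectrum I"
  obtain f where f': "\<forall>n::nat. f n \<in> X \<and> nrm (f n) = 1"
    and lim: "(\<lambda>n. nrm (residual \<mu> (f n))) \<longlonglongrightarrow> 0"
    using assms unfolding approx_point_spectrum_def mem_Collect_eq by (elim exE conjE) (rule that)
  have f: "f n \<in> X" "nrm (f n) = 1" for n using f' by blast+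
  obtain K where K: "0 < K" and Kb: "\<And>f N z. \<lbrakk>f \<in> X; 0 < N; nrm (residual \<mu> f) \<le> N; norm z < 1\<rbrakk> \<Longrightarrow>
     norm (f z) \<le> K * (N + norm (\<mu> * f z - backward_shift f z))"
    by (rule resolvent_bound[OF \<mu>]) (rule that)
  define A where "A = 2 * (nrm (\<lambda>z. 1) powr p + 1 powr p) powr (1 / p)"
  define h where "h n z = \<mu> * f n z - backward_shift (f n) z" for n z
  \<comment> \<open>The summand \<open>1 / real (Suc n)\<close> keeps \<open>N n\<close> positive
    even when the residual vanishes, as for an exact eigenvector.\<close>
  define N where "N n = nrm (h n) + 1 / real (Suc n)" for n
  have N: "0 < N n" "nrm (h n) \<le> N n" for n using nrm_nonneg[of "h n"] by (simp_all add: N_def add_nonneg_pos)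
  have le: "1 \<le> K * N n * A" for n
  proof -
    have fH: "f n \<in> H" using f(1)[of n] by (simp add: model_space_def)
    then have fhol: "f n holomorphic_on ball 0 1" by (simp add: H_iff)
    have hH: "h n \<in> H" using residual_H[OF fH, of \<mu>] by (simp add: h_def[abs_def])
    have "nrm (f n) \<le> K * N n * (2 * (nrm (\<lambda>z. 1) powr p + 1 powr p) powr (1 / p))"
    proof (rule nrm_dominated[OF fhol H_one H_cmult[OF hH, of "1 / of_real (N n)"]])
      show "0 \<le> K * N n" using K N(1)[of n] by simp
      show "nrm (\<lambda>z. 1 / of_real (N n) * h n z) \<le> 1"
        unfolding nrm_cmult[OF hH] using N[of n] by (simp add: norm_divide)
      fix z :: complex assume z: "norm z < 1"
      have "norm (f n z) \<le> K * (N n + norm (h n z))"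
        using Kb[OF f(1)[of n] N(1)[of n] _ z] N(2)[of n] by (simp add: h_def[abs_def])
      also have "\<dots> = K * N n * (norm (1::complex) + norm (1 / of_real (N n) * h n z))"
        using N(1)[of n] by (simp add: norm_mult norm_divide field_simps)
      finally show "norm (f n z) \<le> K * N n * (norm (1::complex) + norm (1 / of_real (N n) * h n z))" .
    qed simp
    then show ?thesis by (simp add: f(2) A_def)
  qed
  have "N \<longlonglongrightarrow> 0 + 0"
    unfolding N_def using lim LIMSEQ_Suc[OF lim_1_over_n[where 'a=real]] by (intro tendsto_add) (auto simp: h_def[abs_def])
  then have "(\<lambda>n. K * N n * A) \<longlonglongrightarrow> K * (0 + 0) * A" by (intro tendsto_intros)
  then have "(1::real) \<le> K * (0 + 0) * A" by (rule tendsto_lowerbound) (use le in auto)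
  then show False by simp
qed

section \<open>Approximate eigenvectors\<close>

lemma inner_spectrum_sequence:
  assumes \<nu>: "\<nu> \<in> inner_spectrum I" and e: "0 < e"
  obtains w where "norm w < 1" "norm (w - \<nu>) < e" "norm (I w) < e"
proof -
  let ?F = "at \<nu> within ball 0 1"
  have "Liminf ?F (\<lambda>z. ereal (norm (I z))) = 0" using \<nu> by (simp add: inner_spectrum_def)
  then have "\<not> ereal e \<le> Liminf ?F (\<lambda>z. ereal (norm (I z)))" using e by simp
  then have "\<not> (\<forall>\<^sub>F z in ?F. ereal e \<le> ereal (norm (I z)))"
    by (rule contrapos_nn) (rule Liminf_bounded)
  then have "\<exists>\<^sub>F z in ?F. norm (I z) < e" by (simp add: not_eventually not_le)
  moreover have "\<forall>\<^sub>F z in ?F. z \<in> ball 0 1 \<and> dist z \<nu> < e"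
    using e by (auto simp: eventually_at)
  ultimately have "\<exists>\<^sub>F z in ?F. norm (I z) < e \<and> z \<in> ball 0 1 \<and> dist z \<nu> < e"
    by (rule frequently_eventually_frequently)
  then obtain z where "norm (I z) < e \<and> z \<in> ball 0 1 \<and> dist z \<nu> < e" by (rule frequentlyE)
  then show ?thesis by (intro that[of z]) (auto simp: dist_norm)
qed

definition model_kernel :: "complex \<Rightarrow> complex \<Rightarrow> complex" where
  "model_kernel w z = (1 - cnj (I w) * I z) / (1 - cnj w * z)"

lemma one_minus_mult_nonzero: "norm w < 1 \<Longrightarrow> norm z \<le> 1 \<Longrightarrow> 1 - cnj w * z \<noteq> 0"
proof
  assume w: "norm w < 1" "norm z \<le> 1" "1 - cnj w * z = 0"
  have "norm (cnj w * z) \<le> norm w * 1" unfolding norm_mult using w by (intro mult_mono) auto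
  then show False using w by auto
qed

lemma model_kernel_H:
  assumes w: "norm w < 1" shows "model_kernel w \<in> H"
proof -
  have 1: "(\<lambda>z. 1 - cnj (I w) * I z) \<in> H" by (intro H_diff H_one H_cmult I_H)
  have "(\<lambda>z. (1 / (1 - cnj w * z)) * (1 - cnj (I w) * I z)) \<in> H"
  proof (rule H_bounded_mult[OF 1, of _ "1 / (1 - norm w)"])
    show "(\<lambda>z. 1 / (1 - cnj w * z)) holomorphic_on ball 0 1"
      using one_minus_mult_nonzero[OF w] by (intro holomorphic_intros) auto
    fix z :: complex assume z: "norm z < 1"
    have "norm (cnj w * z) \<le> norm w * 1" unfolding norm_mult using z by (intro mult_mono) auto
    then have "1 - norm w \<le> norm (1 - cnj w * z)" using norm_triangle_ineq2[of 1 "cnj w * z"] by simp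
    then show "norm (1 / (1 - cnj w * z)) \<le> 1 / (1 - norm w)"
      unfolding norm_divide using w by (intro frac_le) auto
  qed (use w in auto)
  then show ?thesis by (simp add: model_kernel_def[abs_def])
qed

text \<open>On the circle, \<open>I\<close> times the conjugate of the kernel is
  \<open>\<zeta> * (I \<zeta> - I w) / (\<zeta> - w)\<close>; this extends to the disk by a divided
  difference and vanishes at the origin, which gives the witness \<open>\<psi>\<close>.\<close>

lemma model_kernel_X:
  assumes w: "norm w < 1" shows "(\<lambda>z. k * model_kernel w z) \<in> X"
proof -
  define \<psi> where "\<psi> z = cnj k * (z * divided_difference I w z)" for z
  have \<psi>H: "\<psi> \<in> H" unfolding \<psi>_def
  proof (intro H_cmult H_bounded_mult[OF divided_difference_H[OF I_H w], of _ 1])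
    show "norm z \<le> 1" if "norm z < 1" for z :: complex using that by simp
  qed (auto intro: holomorphic_intros)
  have "AE t in circ. \<exists>a b c. has_radial_limit (\<lambda>z. k * model_kernel w z) (cis t) a \<and>
     has_radial_limit I (cis t) b \<and> has_radial_limit \<psi> (cis t) c \<and> a = b * cnj c"
  proof -
    have "AE t in circ. \<exists>l. has_radial_limit I (cis t) l \<and> norm l = 1" using I by (simp add: inner_function_def)
    then show ?thesis
    proof eventually_elim
      case (elim t)
      then obtain b where b: "has_radial_limit I (cis t) b" "norm b = 1" by blast
      let ?\<zeta> = "cis t"
      have bb: "b * cnj b = 1" using b(2) complex_norm_square[of b] by simp
      have cc: "?\<zeta> * cnj ?\<zeta> = 1" by (simp add: cis_cnj cis_mult)
      have ne: "1 - cnj w * ?\<zeta> \<noteq> 0" using one_minus_mult_nonzero[OF w] by simp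
      have l1: "has_radial_limit (\<lambda>z. k * model_kernel w z) ?\<zeta> (k * ((1 - cnj (I w) * b) / (1 - cnj w * ?\<zeta>)))"
        unfolding model_kernel_def by (intro radial_limit_intros radial_limit_const radial_limit_ident b(1) ne)
      have l2: "has_radial_limit \<psi> ?\<zeta> (cnj k * (?\<zeta> * ((b - I w) / (?\<zeta> - w))))"
        unfolding \<psi>_def by (intro radial_limit_intros radial_limit_const radial_limit_ident
          divided_difference_radial_limit b(1) w) simp
      have "?\<zeta> \<noteq> w" using w by auto
      then have ne2: "cnj ?\<zeta> - cnj w \<noteq> 0" by (metis complex_cnj_cancel_iff eq_iff_diff_eq_0)
      have d: "1 - cnj w * ?\<zeta> = ?\<zeta> * (cnj ?\<zeta> - cnj w)" using cc by (simp add: algebra_simps)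
      have "b * cnj (cnj k * (?\<zeta> * ((b - I w) / (?\<zeta> - w)))) = k * cnj ?\<zeta> * ((b * cnj b - cnj (I w) * b) / (cnj ?\<zeta> - cnj w))"
        by (simp add: algebra_simps)
      also have "\<dots> = k * ((?\<zeta> * cnj ?\<zeta>) * (1 - cnj (I w) * b) / (?\<zeta> * (cnj ?\<zeta> - cnj w)))"
        unfolding bb using ne2 by (simp add: divide_simps)
      also have "\<dots> = k * ((1 - cnj (I w) * b) / (1 - cnj w * ?\<zeta>))" unfolding cc d by simp
      finally have "k * ((1 - cnj (I w) * b) / (1 - cnj w * ?\<zeta>)) = b * cnj (cnj k * (?\<zeta> * ((b - I w) / (?\<zeta> - w))))" ..
      with l1 b(1) l2 show ?case by (intro exI conjI)
    qed
  qed
  moreover have "(\<lambda>z. k * model_kernel w z) \<in> H" by (intro H_cmult model_kernel_H w)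
  moreover have "\<psi> \<in> weighted_hardy_space0 p g" using \<psi>H by (simp add: weighted_hardy_space0_def \<psi>_def)
  ultimately show ?thesis unfolding model_space_def by blast
qed

lemma backward_shift_model_kernel:
  assumes w: "norm w < 1" and z: "norm z < 1"
  shows "backward_shift (\<lambda>z. k * model_kernel w z) z = cnj w * (k * model_kernel w z) - k * cnj (I w) * backward_shift I z"
proof (cases "z = 0")
  case True
  have "(I has_field_derivative deriv I 0) (at 0)"
    by (rule holomorphic_derivI[OF I_holomorphic]) auto
  then have "((\<lambda>z. k * model_kernel w z) has_field_derivative (cnj w * (k * model_kernel w 0) - k * cnj (I w) * deriv I 0)) (at 0)"
    unfolding model_kernel_def by (auto intro!: derivative_eq_intros simp: algebra_simps)
  then show ?thesis using True by (simp add: backward_shift_def DERIV_imp_deriv)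
next
  case False
  have "1 - cnj w * z \<noteq> 0" using one_minus_mult_nonzero[OF w] z by simp
  then show ?thesis using False
    by (simp add: backward_shift_def model_kernel_def divide_simps) (simp add: algebra_simps)
qed

lemma inner_spectrum_subset:
  assumes \<nu>: "\<nu> \<in> inner_spectrum I"
  shows "cnj \<nu> \<in> approx_point_spectrum X nrm backward_shift"
proof -
  obtain C where C: "0 < C" "\<And>z. norm z < 1 \<Longrightarrow> norm (I z) \<le> C" by (rule I_bounded) (rule that)
  \<comment> \<open>The last condition keeps the value of the kernel at the origin at least
    \<open>1 / 2\<close> in modulus, uniformly in \<open>n\<close>.\<close>
  have "\<exists>w. norm w < 1 \<and> norm (w - \<nu>) < 1 / real (Suc n) \<and> norm (I w) < 1 / real (Suc n) \<and> norm (I w) * C \<le> 1 / 2" for n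
  proof -
    have e: "0 < min (1 / real (Suc n)) (1 / (2 * C))" using C by simp
    obtain w where w: "norm w < 1" "norm (w - \<nu>) < min (1 / real (Suc n)) (1 / (2 * C))" "norm (I w) < min (1 / real (Suc n)) (1 / (2 * C))"
      by (rule inner_spectrum_sequence[OF \<nu> e]) (rule that)
    have "norm (I w) * C \<le> 1 / (2 * C) * C" using w(3) C by (intro mult_right_mono) auto
    then have "norm (I w) * C \<le> 1 / 2" using C by simp
    then show ?thesis using w by (intro exI[of _ w]) auto
  qed
  then obtain w where w: "\<And>n. norm (w n) < 1" "\<And>n. norm (w n - \<nu>) < 1 / real (Suc n)"
    "\<And>n. norm (I (w n)) < 1 / real (Suc n)" "\<And>n. norm (I (w n)) * C \<le> 1 / 2"
    by metis
  define c where "c n = nrm (model_kernel (w n))" for n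
  have g0: "0 < norm (g 0)" using g_nonzero[of 0] by simp
  \<comment> \<open>Evaluation at the origin bounds the norms of the kernels below, so normalising
    them cannot undo the smallness of \<open>I (w n)\<close>.\<close>
  have c: "norm (g 0) / 2 \<le> c n" for n
  proof -
    have "norm (cnj (I (w n)) * I 0) \<le> norm (I (w n)) * C"
      unfolding norm_mult using C(2)[of 0] by (intro mult_mono) auto
    then have "1 / 2 \<le> norm (model_kernel (w n) 0)"
      using w(4)[of n] norm_triangle_ineq2[of 1 "cnj (I (w n)) * I 0"] by (simp add: model_kernel_def)
    then have "1 / 2 * norm (g 0) \<le> norm (model_kernel (w n) 0) * norm (g 0)" by (rule mult_right_mono) simp
    also have "\<dots> \<le> c n"
      using norm_at_0_le_hardy_norm[of "\<lambda>z. model_kernel (w n) z * g z" p] model_kernel_H[OF w(1)[of n]] p_pos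
      by (simp add: H_iff c_def weighted_hardy_norm_def norm_mult)
    finally show ?thesis by simp
  qed
  have c0: "0 < c n" for n using c[of n] g0 by linarith
  define f where "f n z = (1 / of_real (c n)) * model_kernel (w n) z" for n z
  have fX: "f n \<in> X" for n
    unfolding f_def by (rule model_kernel_X[OF w(1)])
  have fH: "f n \<in> H" for n
    unfolding f_def by (rule H_cmult[OF model_kernel_H[OF w(1)]])
  have fn: "nrm (f n) = 1" for n
    unfolding f_def nrm_cmult[OF model_kernel_H[OF w(1)]] using c0[of n] by (simp add: norm_divide c_def)
  have BI: "backward_shift I \<in> H"
    unfolding backward_shift_divided_difference by (intro divided_difference_H I_H) simp
  \<comment> \<open>A common bound for the two coefficients of the residual:
    \<open>cnj (\<nu> - w n)\<close> in front of \<open>f n\<close> and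
    \<open>cnj (I (w n)) / c n\<close> in front of \<open>backward_shift I\<close>.\<close>
  define \<delta> where "\<delta> n = max (norm (w n - \<nu>)) (norm (I (w n)) / (norm (g 0) / 2))" for n
  define A where "A = 2 * (1 powr p + nrm (backward_shift I) powr p) powr (1 / p)"
  have le: "nrm (\<lambda>z. cnj \<nu> * f n z - backward_shift (f n) z) \<le> \<delta> n * A" for n
    unfolding A_def
  proof (rule nrm_dominated[OF _ fH BI, of _ "\<delta> n" n])
    have "backward_shift (f n) \<in> H"
      unfolding backward_shift_divided_difference by (intro divided_difference_H fH) simp
    then show "(\<lambda>z. cnj \<nu> * f n z - backward_shift (f n) z) holomorphic_on ball 0 1"
      using fH[of n] by (intro holomorphic_intros) (auto simp: H_iff)
    show "0 \<le> \<delta> n" by (simp add: \<delta>_def le_max_iff_disj)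
    fix z :: complex assume z: "norm z < 1"
    have "backward_shift (f n) z = cnj (w n) * f n z - 1 / of_real (c n) * cnj (I (w n)) * backward_shift I z"
      unfolding f_def by (rule backward_shift_model_kernel[OF w(1) z])
    then have "cnj \<nu> * f n z - backward_shift (f n) z = cnj (\<nu> - w n) * f n z + (cnj (I (w n)) / of_real (c n)) * backward_shift I z"
      by (simp add: algebra_simps)
    then have "norm (cnj \<nu> * f n z - backward_shift (f n) z) \<le> norm (w n - \<nu>) * norm (f n z) + norm (I (w n)) / c n * norm (backward_shift I z)"
      using norm_triangle_ineq[of "cnj (\<nu> - w n) * f n z" "(cnj (I (w n)) / of_real (c n)) * backward_shift I z"] c0[of n]
      by (simp only: norm_mult norm_divide complex_mod_cnj norm_of_real abs_of_pos norm_minus_commute[of \<nu>])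
    also have "\<dots> \<le> \<delta> n * norm (f n z) + \<delta> n * norm (backward_shift I z)"
    proof (intro add_mono mult_right_mono)
      have "norm (I (w n)) / c n \<le> norm (I (w n)) / (norm (g 0) / 2)"
        using c[of n] g0 by (intro divide_left_mono) (auto intro: mult_pos_pos c0)
      then show "norm (I (w n)) / c n \<le> \<delta> n" by (simp add: \<delta>_def)
    qed (auto simp: \<delta>_def)
    finally show "norm (cnj \<nu> * f n z - backward_shift (f n) z) \<le> \<delta> n * (norm (f n z) + norm (backward_shift I z))"
      by (simp add: distrib_left)
  qed (simp_all add: fn)
  have \<delta>lim: "\<delta> \<longlonglongrightarrow> 0"
  proof -
    have inv: "(\<lambda>n. 1 / real (Suc n)) \<longlonglongrightarrow> 0" using LIMSEQ_Suc[OF lim_1_over_n[where 'a=real]] by simp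
    have "(\<lambda>n. norm (w n - \<nu>)) \<longlonglongrightarrow> 0"
      by (rule tendsto_sandwich[OF _ _ tendsto_const inv]) (use w(2) in \<open>auto intro!: always_eventually less_imp_le\<close>)
    moreover have "(\<lambda>n. norm (I (w n))) \<longlonglongrightarrow> 0"
      by (rule tendsto_sandwich[OF _ _ tendsto_const inv]) (use w(3) in \<open>auto intro!: always_eventually less_imp_le\<close>)
    ultimately have "\<delta> \<longlonglongrightarrow> max 0 (0 / (norm (g 0) / 2))"
      unfolding \<delta>_def using g0 by (intro tendsto_max tendsto_divide tendsto_const) auto
    then show ?thesis by simp
  qed
  have "(\<lambda>n. nrm (\<lambda>z. cnj \<nu> * f n z - backward_shift (f n) z)) \<longlonglongrightarrow> 0"
  proof (rule tendsto_sandwich[OF _ _ tendsto_const])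
    show "(\<lambda>n. \<delta> n * A) \<longlonglongrightarrow> 0" using tendsto_mult_right[OF \<delta>lim, of A] by simp
  qed (use le nrm_nonneg in \<open>auto intro!: always_eventually\<close>)
  then show ?thesis unfolding approx_point_spectrum_def using fX fn by blast
qed

theorem spectrum_eq: "cnj ` inner_spectrum I = approx_point_spectrum X nrm backward_shift"
proof (intro equalityI subsetI)
  fix \<mu> assume "\<mu> \<in> approx_point_spectrum X nrm backward_shift"
  then have "cnj \<mu> \<in> inner_spectrum I" by (rule approx_point_spectrum_subset)
  then show "\<mu> \<in> cnj ` inner_spectrum I" by (intro image_eqI[of _ _ "cnj \<mu>"]) auto
qed (auto intro: inner_spectrum_subset)

end

theorem corollary1:
  fixes p :: real and g I :: "complex \<Rightarrow> complex"
  assumes "1 < p"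
    and "outer_function g" and "g \<in> hardy_space p"
    and "muckenhoupt_weight p (\<lambda>\<zeta>. norm (radial_limit g \<zeta>) powr p)"
    and "inner_function I"
  shows "cnj ` inner_spectrum I =
    approx_point_spectrum (model_space p g I) (weighted_hardy_norm p g) backward_shift"
proof -
  obtain c and \<phi> :: "complex \<Rightarrow> real" where c: "norm c = 1" and \<phi>: "\<forall>\<zeta>\<in>sphere 0 1. 0 < \<phi> \<zeta>"
    and ai: "(\<lambda>t. ln (\<phi> (cis t))) absolutely_integrable_on {0..2 * pi}"
    and geq: "\<forall>z\<in>ball 0 1. g z = c * exp (1 / (2 * pi) * integral {0..2 * pi}
            (\<lambda>t. (cis t + z) / (cis t - z) * of_real (ln (\<phi> (cis t)))))"
    using assms(2) unfolding outer_function_def by blast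
  define v where "v t = ln (\<phi> (cis t))" for t
  have v: "integrable circ v"
    unfolding v_def using absolutely_integrable_imp_integrable[OF ai] by simp
  have g: "g z = c * exp (herglotz v z)" if z: "norm z < 1" for z
    using geq z lebesgue_integral_eq_integral[OF herglotz_integrable[OF v z]]
    by (simp add: herglotz_def v_def)
  have "(\<lambda>t. (norm (radial_limit g (cis t)) powr p) powr (- 1 / (p - 1))) absolutely_integrable_on {0..2 * pi}"
    using assms(4) by (simp add: muckenhoupt_weight_def)
  from absolutely_integrable_imp_integrable[OF this]
  have w: "integrable circ (\<lambda>t. (norm (radial_limit g (cis t)) powr p) powr (- 1 / (p - 1)))" by simp
  \<comment> \<open>The two descriptions of the weight meet: a radial limit of modulus
    \<open>exp (v t)\<close> turns the power \<open>- 1 / (p - 1)\<close> of the weight into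
    \<open>exp (- (p / (p - 1)) * v t)\<close>.\<close>
  have eq: "AE t in circ. exp (- (p / (p - 1)) * v t) = (norm (radial_limit g (cis t)) powr p) powr (- 1 / (p - 1))"
  proof -
    have "AE t in circ. \<exists>l. has_radial_limit g (cis t) l \<and> norm l = exp (v t)"
      by (rule outer_radial_limit[OF v c]) (rule g)
    then show ?thesis
  proof eventually_elim
    case (elim t)
    then obtain l where l: "has_radial_limit g (cis t) l" "norm l = exp (v t)" by blast
    have "radial_limit g (cis t) = l"
      using l(1) unfolding radial_limit_def has_radial_limit_def by (intro tendsto_Lim) auto
    then show ?case using l(2) by (simp add: powr_def)
  qed
  qed
  have [measurable]: "v \<in> borel_measurable circ" using v by simp
  have "integrable circ (\<lambda>t. exp (- (p / (p - 1)) * v t))"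
    by (subst integrable_cong_AE[OF _ _ eq]) (use w in \<open>auto intro: borel_measurable_integrable\<close>)
  then interpret model_setup p g c v I
    using assms c v g by unfold_locales (auto simp: hardy_space_def)
  show ?thesis by (rule spectrum_eq)
qed

end
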